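(* Let $k$ be a commutative ring and let $(H,K,A,C)$ be a Yetter-Drinfeld datum over $k$. Regard ${}_A\mathsf{Mod}$ as an $({}_H\mathsf{Mod},{}_K\mathsf{Mod})$-biactegory via the $k$-linear tensor product, and let $E\simeq C\otimes_H-:{}_H\mathsf{Mod}\to{}_K\mathsf{Mod}$ be the associated op-monoidal functor. Then the lax $E$-center of the $({}_H\mathsf{Mod},{}_K\mathsf{Mod})$-biactegory ${}_A\mathsf{Mod}$ of left $A$-modules is isomorphic to the category of generalized Yetter-Drinfeld modules: $$\mathcal{Z}^w_{C\otimes_H-}({}_A\mathsf{Mod})\cong {}_A\mathsf{YD}^C(H,K).$$
   Context: Unadorned $\otimes$ is over $k$. **YD datum.** A (left-right) Yetter-Drinfeld datum is a four-tuple $(H,K,A,C)$ where $H,K$ are $k$-bialgebras, $A$ is an $(H,K)$-bicomodule algebra (a $k$-algebra with commuting left $H$-coaction $a\mapsto a_{[-1]}\otimes a_{[0]}\in H\otimes A$ and right $K$-coaction $a\mapsto a_{[0]}\otimes a_{[1]}\in A\otimes K$, both algebra maps), and $C$ is a $(K,H)$-bimodule coalgebra (a $k$-coalgebra with commuting left $K$-action $\triangleright:K\otimes C\to C$ and right $H$-action $\triangleleft:C\otimes H\to C$, both coalgebra maps). **Generalized YD modules.** ${}_A\mathsf{YD}^C(H,K)$ is the category whose objects are $k$-modules $M$ with a left $A$-module structure and a right $C$-comodule structure $m\mapsto m_{[0]}\otimes m_{[1]}\in M\otimes C$ such that for all $a\in A$, $m\in M$ $$(a_{[0]} m)_{[0]}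 \otimes (a_{[0]} m)_{[1]}\triangleleft a_{[-1]} = a_{[0]} m_{[0]} \otimes a_{[1]}\triangleright m_{[1]};$$ morphisms are $A$-linear $C$-colinear maps. **Biactegory.** For $V\in{}_H\mathsf{Mod}$, $M\in{}_A\mathsf{Mod}$, $W\in{}_K\mathsf{Mod}$, $A$ acts on $V\otimes M\otimes W$ by $a\cdot(v\otimes m\otimes w)=a_{[-1]}v\otimes a_{[0]}m\otimes a_{[1]}w$. **Op-monoidal functor.** $E=C\otimes_H-$ has structure morphisms $\psi_{V,W}:C\otimes_H(V\otimes W)\to (C\otimes_H V)\otimes (C\otimes_H W)$, $c\otimes_H(v\otimes w)\mapsto (c_{(1)}\otimes_H v)\otimes(c_{(2)}\otimes_H w)$, and $\psi_0:C\otimes_H k\to k$, $c\otimes_H\lambda\mapsto\epsilon(c)\lambda$. **Lax $E$-center.** For monoidal categories $\mathcal C,\mathcal D$, an op-monoidal functor $(E,\psi,\psi_0):\mathcal C\to\mathcal D$ and a $(\mathcal C,\mathcal D)$-biactegory $\mathcal M$ (left $\mathcal C$-action $\triangleright$, right $\mathcal D$-action $\triangleleft$, with compatible coherence constraints), the lax $E$-center $\mathcal Z^w_E(\mathcal M)$ has as objects pairs $(M,\beta^M)$ with $M\in\mathcal M$ and $\beta^M$ a natural transformation $\beta^M_V:V\triangleright M\to M\triangleleft E(V)$, natural in $V\in\mathcal C$, such that, suppressing associativity constraints, for all $V,W\in\mathcal C$ $$(\mathrm{id}_M\triangleleft\psi_{V,W})\circ\beta^M_{V\otimes W}=(\beta^M_V\triangleleft\mathrm{id}_{E(W)})\circ(\mathrm{id}_V\triangleright\beta^M_W)$$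 (the heptagon condition). Morphisms $f:(M,\beta^M)\to(N,\beta^N)$ are morphisms $f:M\to N$ in $\mathcal M$ with $\beta^N_V\circ(\mathrm{id}_V\triangleright f)=(f\triangleleft\mathrm{id}_{E(V)})\circ\beta^M_V$ for all $V\in\mathcal C$.
   Formalization: Objects of the lax center must also satisfy the unit condition: id_M ◁ ψ_0 after β_k is the canonical isomorphism. With the heptagon alone the claim fails: for A=H=K=C=k a field the center consists of modules with an idempotent (β=0 is allowed), not of k-modules. *)

theory Defs
  imports "HOL-Algebra.Module" "HOL-Algebra.Free_Abelian_Groups"
begin

text \<open>
  The type variable \<open>'u\<close> plays the role of a universe of sets: the ground ring, all algebras,
  coalgebras and modules have as carrier a subset of \<open>'u\<close>, and the categories below consist of
  all modules of this kind. For the universe to be closed under tensor products it suffices that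
  \<open>'u\<close> is infinite, see \<open>enc\<close>.

  Modules over the ground ring are modules in the sense of the library; the ring multiplication and
  the unit element contained in the record type are ignored unless an algebra is meant.
\<close>

section \<open>Linear algebra over a commutative ring\<close>

definition klin ::
  "'u ring \<Rightarrow> ('u,'u,'x) module_scheme \<Rightarrow> ('u,'u,'y) module_scheme \<Rightarrow> ('u \<Rightarrow> 'u) \<Rightarrow> bool" where
  "klin k M N f \<longleftrightarrow> f \<in> carrier M \<rightarrow> carrier N \<and>
     (\<forall>x\<in>carrier M. \<forall>y\<in>carrier M. f (x \<oplus>\<^bsub>M\<^esub> y) = f x \<oplus>\<^bsub>N\<^esub> f y) \<and>
     (\<forall>r\<in>carrier k. \<forall>x\<in>carrier M. f (r \<odot>\<^bsub>M\<^esub> x) = r \<odot>\<^bsub>N\<^esub> f x)"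

definition kbilin ::
  "'u ring \<Rightarrow> ('u,'u,'x) module_scheme \<Rightarrow> ('u,'u,'y) module_scheme \<Rightarrow> ('u,'u,'z) module_scheme
    \<Rightarrow> ('u \<Rightarrow> 'u \<Rightarrow> 'u) \<Rightarrow> bool" where
  "kbilin k M N P b \<longleftrightarrow>
     (\<forall>m\<in>carrier M. klin k N P (b m)) \<and> (\<forall>n\<in>carrier N. klin k M P (\<lambda>m. b m n))"

definition ground :: "'u ring \<Rightarrow> ('u,'u) module" where
  "ground k = \<lparr>carrier = carrier k, mult = mult k, one = one k, ring.zero = ring.zero k, add = add k,
     smult = mult k\<rparr>"

subsection \<open>Balanced tensor products\<close>

text \<open>
  For a set \<open>R\<close> acting on \<open>M\<close> from the right by \<open>ra\<close> and on \<open>N\<close> from the left by \<open>la\<close>, the balanced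
  tensor product is the quotient of the free abelian group on \<open>M \<times> N\<close> by the subgroup generated by
  the usual relators. The ground ring acts on the left factor. A class is represented in \<open>'u\<close> by the
  code of a chosen member; \<open>enc\<close> is injective whenever \<open>'u\<close> is infinite
  (\<open>eqpoll_free_Abelian_group_infinite\<close>).
\<close>

definition enc :: "('u \<times> 'u \<Rightarrow>\<^sub>0 int) \<Rightarrow> 'u" where
  "enc = (SOME e. inj e)"

definition dec :: "'u \<Rightarrow> ('u \<times> 'u \<Rightarrow>\<^sub>0 int)" where
  "dec = inv_into UNIV enc"

definition relators ::
  "'r set \<Rightarrow> ('u \<Rightarrow> 'r \<Rightarrow> 'u) \<Rightarrow> ('r \<Rightarrow> 'u \<Rightarrow> 'u) \<Rightarrow> ('u,'u,'x) module_scheme \<Rightarrow>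
    ('u,'u,'y) module_scheme \<Rightarrow> ('u \<times> 'u \<Rightarrow>\<^sub>0 int) set" where
  "relators R ra la M N =
     {frag_of (m \<oplus>\<^bsub>M\<^esub> m', n) - frag_of (m, n) - frag_of (m', n) | m m' n.
        m \<in> carrier M \<and> m' \<in> carrier M \<and> n \<in> carrier N} \<union>
     {frag_of (m, n \<oplus>\<^bsub>N\<^esub> n') - frag_of (m, n) - frag_of (m, n') | m n n'.
        m \<in> carrier M \<and> n \<in> carrier N \<and> n' \<in> carrier N} \<union>
     {frag_of (ra m r, n) - frag_of (m, la r n) | m r n.
        m \<in> carrier M \<and> r \<in> R \<and> n \<in> carrier N}"

definition bclass ::
  "'r set \<Rightarrow> ('u \<Rightarrow> 'r \<Rightarrow> 'u) \<Rightarrow> ('r \<Rightarrow> 'u \<Rightarrow> 'u) \<Rightarrow> ('u,'u,'x) module_scheme \<Rightarrow>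
    ('u,'u,'y) module_scheme \<Rightarrow> ('u \<times> 'u \<Rightarrow>\<^sub>0 int) \<Rightarrow> 'u" where
  "bclass R ra la M N p =
     (let F = free_Abelian_group (carrier M \<times> carrier N)
      in enc (SOME q. q \<in> generate F (relators R ra la M N) #>\<^bsub>F\<^esub> p))"

definition btensor ::
  "'r set \<Rightarrow> ('u \<Rightarrow> 'r \<Rightarrow> 'u) \<Rightarrow> ('r \<Rightarrow> 'u \<Rightarrow> 'u) \<Rightarrow> ('u,'u,'x) module_scheme \<Rightarrow>
    ('u,'u,'y) module_scheme \<Rightarrow> ('u,'u) module" where
  "btensor R ra la M N =
     \<lparr>carrier = bclass R ra la M N ` carrier (free_Abelian_group (carrier M \<times> carrier N)),
      mult = undefined, one = undefined,
      ring.zero = bclass R ra la M N 0,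
      add = (\<lambda>x y. bclass R ra la M N (dec x + dec y)),
      smult = (\<lambda>r x. bclass R ra la M N
        (frag_extend (\<lambda>(m, n). frag_of (r \<odot>\<^bsub>M\<^esub> m, n)) (dec x)))\<rparr>"

definition bpure ::
  "'r set \<Rightarrow> ('u \<Rightarrow> 'r \<Rightarrow> 'u) \<Rightarrow> ('r \<Rightarrow> 'u \<Rightarrow> 'u) \<Rightarrow> ('u,'u,'x) module_scheme \<Rightarrow>
    ('u,'u,'y) module_scheme \<Rightarrow> 'u \<Rightarrow> 'u \<Rightarrow> 'u" where
  "bpure R ra la M N m n = bclass R ra la M N (frag_of (m, n))"

text \<open>The linear map out of a balanced tensor product given by its values on pure tensors.\<close>

definition blift ::
  "'r set \<Rightarrow> ('u \<Rightarrow> 'r \<Rightarrow> 'u) \<Rightarrow> ('r \<Rightarrow> 'u \<Rightarrow> 'u) \<Rightarrow> 'u ring \<Rightarrow> ('u,'u,'x) module_scheme \<Rightarrow>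
    ('u,'u,'y) module_scheme \<Rightarrow> ('u,'u,'z) module_scheme \<Rightarrow> ('u \<Rightarrow> 'u \<Rightarrow> 'u) \<Rightarrow> 'u \<Rightarrow> 'u" where
  "blift R ra la k M N P b =
     (THE h. h \<in> extensional (carrier (btensor R ra la M N)) \<and>
        klin k (btensor R ra la M N) P h \<and>
        (\<forall>m\<in>carrier M. \<forall>n\<in>carrier N. h (bpure R ra la M N m n) = b m n))"

subsection \<open>Tensor products over the ground ring\<close>

definition tensor ::
  "'u ring \<Rightarrow> ('u,'u,'x) module_scheme \<Rightarrow> ('u,'u,'y) module_scheme \<Rightarrow> ('u,'u) module" where
  "tensor k M N = btensor (carrier k) (\<lambda>m r. r \<odot>\<^bsub>M\<^esub> m) (\<lambda>r n. r \<odot>\<^bsub>N\<^esub> n) M N"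

definition tpure ::
  "'u ring \<Rightarrow> ('u,'u,'x) module_scheme \<Rightarrow> ('u,'u,'y) module_scheme \<Rightarrow> 'u \<Rightarrow> 'u \<Rightarrow> 'u" where
  "tpure k M N = bpure (carrier k) (\<lambda>m r. r \<odot>\<^bsub>M\<^esub> m) (\<lambda>r n. r \<odot>\<^bsub>N\<^esub> n) M N"

text \<open>
  An expression in Sweedler notation, such as \<open>b a\<^sub>(\<^sub>1\<^sub>) a\<^sub>(\<^sub>2\<^sub>)\<close> with \<open>b\<close> bilinear, is rendered
  as \<open>tlift\<close> of \<open>b\<close> applied to the tensor in question.
\<close>

definition tlift ::
  "'u ring \<Rightarrow> ('u,'u,'x) module_scheme \<Rightarrow> ('u,'u,'y) module_scheme \<Rightarrow> ('u,'u,'z) module_scheme \<Rightarrow>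
    ('u \<Rightarrow> 'u \<Rightarrow> 'u) \<Rightarrow> 'u \<Rightarrow> 'u" where
  "tlift k M N P b = blift (carrier k) (\<lambda>m r. r \<odot>\<^bsub>M\<^esub> m) (\<lambda>r n. r \<odot>\<^bsub>N\<^esub> n) k M N P b"

definition tmap ::
  "'u ring \<Rightarrow> ('u,'u,'x) module_scheme \<Rightarrow> ('u,'u,'y) module_scheme \<Rightarrow> ('u,'u,'v) module_scheme \<Rightarrow>
    ('u,'u,'w) module_scheme \<Rightarrow> ('u \<Rightarrow> 'u) \<Rightarrow> ('u \<Rightarrow> 'u) \<Rightarrow> 'u \<Rightarrow> 'u" where
  "tmap k M N M' N' f g = tlift k M N (tensor k M' N') (\<lambda>m n. tpure k M' N' (f m) (g n))"

definition tassoc ::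
  "'u ring \<Rightarrow> ('u,'u,'x) module_scheme \<Rightarrow> ('u,'u,'y) module_scheme \<Rightarrow> ('u,'u,'z) module_scheme \<Rightarrow>
    'u \<Rightarrow> 'u" where
  "tassoc k X Y Z =
     tlift k (tensor k X Y) Z (tensor k X (tensor k Y Z))
       (\<lambda>t z. tlift k X Y (tensor k X (tensor k Y Z))
         (\<lambda>x y. tpure k X (tensor k Y Z) x (tpure k Y Z y z)) t)"

definition tassoc_inv ::
  "'u ring \<Rightarrow> ('u,'u,'x) module_scheme \<Rightarrow> ('u,'u,'y) module_scheme \<Rightarrow> ('u,'u,'z) module_scheme \<Rightarrow>
    'u \<Rightarrow> 'u" where
  "tassoc_inv k X Y Z =
     tlift k X (tensor k Y Z) (tensor k (tensor k X Y) Z)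
       (\<lambda>x t. tlift k Y Z (tensor k (tensor k X Y) Z)
         (\<lambda>y z. tpure k (tensor k X Y) Z (tpure k X Y x y) z) t)"

definition tlunit :: "'u ring \<Rightarrow> ('u,'u,'x) module_scheme \<Rightarrow> 'u \<Rightarrow> 'u" where
  "tlunit k X = tlift k (ground k) X X (\<lambda>r x. r \<odot>\<^bsub>X\<^esub> x)"

definition trunit :: "'u ring \<Rightarrow> ('u,'u,'x) module_scheme \<Rightarrow> 'u \<Rightarrow> 'u" where
  "trunit k X = tlift k X (ground k) X (\<lambda>x r. r \<odot>\<^bsub>X\<^esub> x)"

section \<open>Algebras, coalgebras, bialgebras, modules and comodules\<close>

definition k_algebra :: "'u ring \<Rightarrow> ('u,'u,'x) module_scheme \<Rightarrow> bool" where
  "k_algebra k A \<longleftrightarrow> Module.module k A \<and> Ring.ring A \<and>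
     (\<forall>r\<in>carrier k. \<forall>x\<in>carrier A. \<forall>y\<in>carrier A.
        (r \<odot>\<^bsub>A\<^esub> x) \<otimes>\<^bsub>A\<^esub> y = r \<odot>\<^bsub>A\<^esub> (x \<otimes>\<^bsub>A\<^esub> y) \<and>
        x \<otimes>\<^bsub>A\<^esub> (r \<odot>\<^bsub>A\<^esub> y) = r \<odot>\<^bsub>A\<^esub> (x \<otimes>\<^bsub>A\<^esub> y))"

definition algebra_map ::
  "'u ring \<Rightarrow> ('u,'u,'x) module_scheme \<Rightarrow> ('u,'u,'y) module_scheme \<Rightarrow> ('u \<Rightarrow> 'u) \<Rightarrow> bool" where
  "algebra_map k A B f \<longleftrightarrow> f \<in> ring_hom A B \<and> klin k A B f"

definition tensor_alg ::
  "'u ring \<Rightarrow> ('u,'u,'x) module_scheme \<Rightarrow> ('u,'u,'y) module_scheme \<Rightarrow> ('u,'u) module" where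
  "tensor_alg k A B = (tensor k A B)
     \<lparr>mult := (\<lambda>s t. tlift k A B (tensor k A B)
        (\<lambda>a b. tlift k A B (tensor k A B)
          (\<lambda>a' b'. tpure k A B (a \<otimes>\<^bsub>A\<^esub> a') (b \<otimes>\<^bsub>B\<^esub> b')) t) s),
      one := tpure k A B \<one>\<^bsub>A\<^esub> \<one>\<^bsub>B\<^esub>\<rparr>"

record 'u coalg = "('u,'u) module" +
  comul :: "'u \<Rightarrow> 'u"
  counit :: "'u \<Rightarrow> 'u"

definition coalgebra :: "'u ring \<Rightarrow> ('u,'x) coalg_scheme \<Rightarrow> bool" where
  "coalgebra k C \<longleftrightarrow> Module.module k C \<and>
     klin k C (tensor k C C) (comul C) \<and> klin k C (ground k) (counit C) \<and>
     (\<forall>c\<in>carrier C.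
        tassoc k C C C (tmap k C C (tensor k C C) C (comul C) (\<lambda>d. d) (comul C c)) =
          tmap k C C C (tensor k C C) (\<lambda>d. d) (comul C) (comul C c) \<and>
        tlift k C C C (\<lambda>d e. counit C d \<odot>\<^bsub>C\<^esub> e) (comul C c) = c \<and>
        tlift k C C C (\<lambda>d e. counit C e \<odot>\<^bsub>C\<^esub> d) (comul C c) = c)"

definition coalgebra_map ::
  "'u ring \<Rightarrow> ('u,'x) coalg_scheme \<Rightarrow> ('u,'y) coalg_scheme \<Rightarrow> ('u \<Rightarrow> 'u) \<Rightarrow> bool" where
  "coalgebra_map k C D f \<longleftrightarrow> klin k C D f \<and>
     (\<forall>c\<in>carrier C. comul D (f c) = tmap k C C D D f f (comul C c) \<and>
        counit D (f c) = counit C c)"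

definition tensor_coalg ::
  "'u ring \<Rightarrow> ('u,'x) coalg_scheme \<Rightarrow> ('u,'y) coalg_scheme \<Rightarrow> 'u coalg" where
  "tensor_coalg k C D = (let T = tensor k C D in
     \<lparr>carrier = carrier T, mult = mult T, one = one T, ring.zero = ring.zero T,
      add = add T, smult = smult T,
      comul = tlift k C D (tensor k T T)
        (\<lambda>c d. tlift k C C (tensor k T T)
          (\<lambda>c1 c2. tlift k D D (tensor k T T)
            (\<lambda>d1 d2. tpure k T T (tpure k C D c1 d1) (tpure k C D c2 d2)) (comul D d)) (comul C c)),
      counit = tlift k C D (ground k) (\<lambda>c d. counit C c \<otimes>\<^bsub>k\<^esub> counit D d)\<rparr>)"

definition bialgebra :: "'u ring \<Rightarrow> ('u,'x) coalg_scheme \<Rightarrow> bool" where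
  "bialgebra k H \<longleftrightarrow> k_algebra k H \<and> coalgebra k H \<and>
     algebra_map k H (tensor_alg k H H) (comul H) \<and> algebra_map k H (ground k) (counit H)"

subsection \<open>Left and right modules over an algebra\<close>

record 'u lmod = "('u,'u) module" +
  act :: "'u \<Rightarrow> 'u \<Rightarrow> 'u"

definition with_act :: "('u,'u,'x) module_scheme \<Rightarrow> ('u \<Rightarrow> 'u \<Rightarrow> 'u) \<Rightarrow> 'u lmod" where
  "with_act M f = \<lparr>carrier = carrier M, mult = mult M, one = one M, ring.zero = ring.zero M, add = add M,
     smult = smult M, act = f\<rparr>"

definition left_module ::
  "'u ring \<Rightarrow> ('u,'u,'x) module_scheme \<Rightarrow> ('u,'y) lmod_scheme \<Rightarrow> bool" where
  "left_module k A M \<longleftrightarrow> Module.module k M \<and> kbilin k A M M (act M) \<and>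
     (\<forall>m\<in>carrier M. act M \<one>\<^bsub>A\<^esub> m = m \<and>
        (\<forall>a\<in>carrier A. \<forall>b\<in>carrier A. act M (a \<otimes>\<^bsub>A\<^esub> b) m = act M a (act M b m)))"

definition right_action ::
  "'u ring \<Rightarrow> ('u,'u,'x) module_scheme \<Rightarrow> ('u,'u,'y) module_scheme \<Rightarrow> ('u \<Rightarrow> 'u \<Rightarrow> 'u) \<Rightarrow> bool" where
  "right_action k A M ra \<longleftrightarrow> Module.module k M \<and> kbilin k M A M ra \<and>
     (\<forall>m\<in>carrier M. ra m \<one>\<^bsub>A\<^esub> = m \<and>
        (\<forall>a\<in>carrier A. \<forall>b\<in>carrier A. ra m (a \<otimes>\<^bsub>A\<^esub> b) = ra (ra m a) b))"

definition lmod_map ::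
  "'u ring \<Rightarrow> ('u,'u,'x) module_scheme \<Rightarrow> 'u lmod \<Rightarrow> 'u lmod \<Rightarrow> ('u \<Rightarrow> 'u) \<Rightarrow> bool" where
  "lmod_map k A M N f \<longleftrightarrow> klin k M N f \<and>
     (\<forall>a\<in>carrier A. \<forall>m\<in>carrier M. f (act M a m) = act N a (f m))"

subsection \<open>Left and right comodules over a coalgebra\<close>

definition left_comodule ::
  "'u ring \<Rightarrow> ('u,'x) coalg_scheme \<Rightarrow> ('u,'u,'y) module_scheme \<Rightarrow> ('u \<Rightarrow> 'u) \<Rightarrow> bool" where
  "left_comodule k C M \<delta> \<longleftrightarrow> Module.module k M \<and> klin k M (tensor k C M) \<delta> \<and>
     (\<forall>m\<in>carrier M.
        tassoc k C C M (tmap k C M (tensor k C C) M (comul C) (\<lambda>x. x) (\<delta> m)) =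
          tmap k C M C (tensor k C M) (\<lambda>c. c) \<delta> (\<delta> m) \<and>
        tlift k C M M (\<lambda>c x. counit C c \<odot>\<^bsub>M\<^esub> x) (\<delta> m) = m)"

definition right_comodule ::
  "'u ring \<Rightarrow> ('u,'x) coalg_scheme \<Rightarrow> ('u,'u,'y) module_scheme \<Rightarrow> ('u \<Rightarrow> 'u) \<Rightarrow> bool" where
  "right_comodule k C M \<rho> \<longleftrightarrow> Module.module k M \<and> klin k M (tensor k M C) \<rho> \<and>
     (\<forall>m\<in>carrier M.
        tassoc k M C C (tmap k M C (tensor k M C) C \<rho> (\<lambda>c. c) (\<rho> m)) =
          tmap k M C M (tensor k C C) (\<lambda>x. x) (comul C) (\<rho> m) \<and>
        tlift k M C M (\<lambda>x c. counit C c \<odot>\<^bsub>M\<^esub> x) (\<rho> m) = m)"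

section \<open>Yetter-Drinfeld data\<close>

record 'u bicomod_alg = "('u,'u) module" +
  lcoact :: "'u \<Rightarrow> 'u"
  rcoact :: "'u \<Rightarrow> 'u"

definition bicomodule_algebra ::
  "'u ring \<Rightarrow> 'u coalg \<Rightarrow> 'u coalg \<Rightarrow> 'u bicomod_alg \<Rightarrow> bool" where
  "bicomodule_algebra k H K A \<longleftrightarrow> k_algebra k A \<and>
     left_comodule k H A (lcoact A) \<and> right_comodule k K A (rcoact A) \<and>
     (\<forall>a\<in>carrier A.
        tassoc k H A K (tmap k A K (tensor k H A) K (lcoact A) (\<lambda>x. x) (rcoact A a)) =
          tmap k H A H (tensor k A K) (\<lambda>h. h) (rcoact A) (lcoact A a)) \<and>
     algebra_map k A (tensor_alg k H A) (lcoact A) \<and>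
     algebra_map k A (tensor_alg k A K) (rcoact A)"

record 'u bimod_coalg = "'u coalg" +
  lact :: "'u \<Rightarrow> 'u \<Rightarrow> 'u"
  ract :: "'u \<Rightarrow> 'u \<Rightarrow> 'u"

definition bimodule_coalgebra ::
  "'u ring \<Rightarrow> 'u coalg \<Rightarrow> 'u coalg \<Rightarrow> 'u bimod_coalg \<Rightarrow> bool" where
  "bimodule_coalgebra k K H C \<longleftrightarrow> coalgebra k C \<and>
     left_module k K (with_act C (lact C)) \<and> right_action k H C (ract C) \<and>
     (\<forall>x\<in>carrier K. \<forall>c\<in>carrier C. \<forall>h\<in>carrier H.
        ract C (lact C x c) h = lact C x (ract C c h)) \<and>
     coalgebra_map k (tensor_coalg k K C) C (tlift k K C C (lact C)) \<and>
     coalgebra_map k (tensor_coalg k C H) C (tlift k C H C (ract C))"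

definition yd_datum ::
  "'u ring \<Rightarrow> 'u coalg \<Rightarrow> 'u coalg \<Rightarrow> 'u bicomod_alg \<Rightarrow> 'u bimod_coalg \<Rightarrow> bool" where
  "yd_datum k H K A C \<longleftrightarrow> bialgebra k H \<and> bialgebra k K \<and>
     bicomodule_algebra k H K A \<and> bimodule_coalgebra k K H C"

section \<open>Categories, monoidal categories and the lax center\<close>

record ('o, 'a) cat =
  Ob :: "'o set"
  Hom :: "'o \<Rightarrow> 'o \<Rightarrow> 'a set"
  Id :: "'o \<Rightarrow> 'a"
  Comp :: "'o \<Rightarrow> 'o \<Rightarrow> 'o \<Rightarrow> 'a \<Rightarrow> 'a \<Rightarrow> 'a"
    \<comment> \<open>\<open>Comp X Y Z g f\<close> is the composite of \<open>f : X \<rightarrow> Y\<close> and \<open>g : Y \<rightarrow> Z\<close>\<close>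

definition category :: "('o,'a,'x) cat_scheme \<Rightarrow> bool" where
  "category C \<longleftrightarrow>
     (\<forall>X\<in>Ob C. Id C X \<in> Hom C X X) \<and>
     (\<forall>X\<in>Ob C. \<forall>Y\<in>Ob C. \<forall>Z\<in>Ob C. \<forall>f\<in>Hom C X Y. \<forall>g\<in>Hom C Y Z. Comp C X Y Z g f \<in> Hom C X Z) \<and>
     (\<forall>X\<in>Ob C. \<forall>Y\<in>Ob C. \<forall>f\<in>Hom C X Y.
        Comp C X X Y f (Id C X) = f \<and> Comp C X Y Y (Id C Y) f = f) \<and>
     (\<forall>W\<in>Ob C. \<forall>X\<in>Ob C. \<forall>Y\<in>Ob C. \<forall>Z\<in>Ob C. \<forall>f\<in>Hom C W X. \<forall>g\<in>Hom C X Y. \<forall>h\<in>Hom C Y Z.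
        Comp C W Y Z h (Comp C W X Y g f) = Comp C W X Z (Comp C X Y Z h g) f)"

definition is_functor ::
  "('o,'a,'x) cat_scheme \<Rightarrow> ('p,'b,'y) cat_scheme \<Rightarrow> ('o \<Rightarrow> 'p) \<Rightarrow> ('o \<Rightarrow> 'o \<Rightarrow> 'a \<Rightarrow> 'b) \<Rightarrow> bool" where
  "is_functor C D F0 F1 \<longleftrightarrow>
     (\<forall>X\<in>Ob C. F0 X \<in> Ob D) \<and>
     (\<forall>X\<in>Ob C. \<forall>Y\<in>Ob C. \<forall>f\<in>Hom C X Y. F1 X Y f \<in> Hom D (F0 X) (F0 Y)) \<and>
     (\<forall>X\<in>Ob C. F1 X X (Id C X) = Id D (F0 X)) \<and>
     (\<forall>X\<in>Ob C. \<forall>Y\<in>Ob C. \<forall>Z\<in>Ob C. \<forall>f\<in>Hom C X Y. \<forall>g\<in>Hom C Y Z.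
        F1 X Z (Comp C X Y Z g f) = Comp D (F0 X) (F0 Y) (F0 Z) (F1 Y Z g) (F1 X Y f))"

definition isomorphic_categories ::
  "('o,'a,'x) cat_scheme \<Rightarrow> ('p,'b,'y) cat_scheme \<Rightarrow> bool" where
  "isomorphic_categories C D \<longleftrightarrow> category C \<and> category D \<and>
     (\<exists>F0 F1 G0 G1. is_functor C D F0 F1 \<and> is_functor D C G0 G1 \<and>
        (\<forall>X\<in>Ob C. G0 (F0 X) = X) \<and> (\<forall>X\<in>Ob D. F0 (G0 X) = X) \<and>
        (\<forall>X\<in>Ob C. \<forall>Y\<in>Ob C. \<forall>f\<in>Hom C X Y. G1 (F0 X) (F0 Y) (F1 X Y f) = f) \<and>
        (\<forall>X\<in>Ob D. \<forall>Y\<in>Ob D. \<forall>f\<in>Hom D X Y. F1 (G0 X) (G0 Y) (G1 X Y f) = f))"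

text \<open>
  In the three structures below, the operations on morphisms take source and target objects as
  arguments: for \<open>f : X \<rightarrow> X'\<close> and \<open>g : Y \<rightarrow> Y'\<close>, \<open>tmor X X' Y Y' f g\<close> is the tensor product of
  \<open>f\<close> and \<open>g\<close>, and similarly for the two actions.
\<close>

record ('o, 'a) moncat = "('o, 'a) cat" +
  tob :: "'o \<Rightarrow> 'o \<Rightarrow> 'o"
  tmor :: "'o \<Rightarrow> 'o \<Rightarrow> 'o \<Rightarrow> 'o \<Rightarrow> 'a \<Rightarrow> 'a \<Rightarrow> 'a"
  tunit :: 'o
  massoc :: "'o \<Rightarrow> 'o \<Rightarrow> 'o \<Rightarrow> 'a"  \<comment> \<open>\<open>(X \<otimes> Y) \<otimes> Z \<rightarrow> X \<otimes> (Y \<otimes> Z)\<close>\<close>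
  mlunit :: "'o \<Rightarrow> 'a"             \<comment> \<open>\<open>I \<otimes> X \<rightarrow> X\<close>\<close>
  mrunit :: "'o \<Rightarrow> 'a"             \<comment> \<open>\<open>X \<otimes> I \<rightarrow> X\<close>\<close>

record ('c, 'f, 'd, 'g) opmon =
  Eob :: "'c \<Rightarrow> 'd"
  Emor :: "'c \<Rightarrow> 'c \<Rightarrow> 'f \<Rightarrow> 'g"
  psi :: "'c \<Rightarrow> 'c \<Rightarrow> 'g"           \<comment> \<open>\<open>E (V \<otimes> W) \<rightarrow> E V \<otimes> E W\<close>\<close>
  psi0 :: 'g                      \<comment> \<open>\<open>E I \<rightarrow> I\<close>\<close>

record ('c, 'f, 'd, 'g, 'o, 'a) biact = "('o, 'a) cat" +
  lob :: "'c \<Rightarrow> 'o \<Rightarrow> 'o"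
  lmor :: "'c \<Rightarrow> 'c \<Rightarrow> 'o \<Rightarrow> 'o \<Rightarrow> 'f \<Rightarrow> 'a \<Rightarrow> 'a"
  rob :: "'o \<Rightarrow> 'd \<Rightarrow> 'o"
  rmor :: "'o \<Rightarrow> 'o \<Rightarrow> 'd \<Rightarrow> 'd \<Rightarrow> 'a \<Rightarrow> 'g \<Rightarrow> 'a"
  blassoc :: "'c \<Rightarrow> 'c \<Rightarrow> 'o \<Rightarrow> 'a"  \<comment> \<open>\<open>(V \<otimes> W) \<triangleright> M \<rightarrow> V \<triangleright> (W \<triangleright> M)\<close>\<close>
  blunit :: "'o \<Rightarrow> 'a"              \<comment> \<open>\<open>I \<triangleright> M \<rightarrow> M\<close>\<close>
  brassoc :: "'o \<Rightarrow> 'd \<Rightarrow> 'd \<Rightarrow> 'a"  \<comment> \<open>\<open>M \<triangleleft> (X \<otimes> Y) \<rightarrow> (M \<triangleleft> X) \<triangleleft> Y\<close>\<close>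
  brunit :: "'o \<Rightarrow> 'a"              \<comment> \<open>\<open>M \<triangleleft> I \<rightarrow> M\<close>\<close>
  bmid :: "'c \<Rightarrow> 'o \<Rightarrow> 'd \<Rightarrow> 'a"     \<comment> \<open>\<open>V \<triangleright> (M \<triangleleft> X) \<rightarrow> (V \<triangleright> M) \<triangleleft> X\<close>\<close>

definition nat_family ::
  "('c,'f,'x) moncat_scheme \<Rightarrow> ('d,'g,'y) moncat_scheme \<Rightarrow> ('c,'f,'d,'g) opmon \<Rightarrow>
    ('c,'f,'d,'g,'o,'a) biact \<Rightarrow> 'o \<Rightarrow> ('c \<Rightarrow> 'a) \<Rightarrow> bool" where
  "nat_family C D E B M \<beta> \<longleftrightarrow> \<beta> \<in> extensional (Ob C) \<and>
     (\<forall>V\<in>Ob C. \<beta> V \<in> Hom B (lob B V M) (rob B M (Eob E V))) \<and>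
     (\<forall>V\<in>Ob C. \<forall>W\<in>Ob C. \<forall>f\<in>Hom C V W.
        Comp B (lob B V M) (rob B M (Eob E V)) (rob B M (Eob E W))
          (rmor B M M (Eob E V) (Eob E W) (Id B M) (Emor E V W f)) (\<beta> V) =
        Comp B (lob B V M) (lob B W M) (rob B M (Eob E W))
          (\<beta> W) (lmor B V W M M f (Id B M)))"

definition heptagon ::
  "('c,'f,'x) moncat_scheme \<Rightarrow> ('d,'g,'y) moncat_scheme \<Rightarrow> ('c,'f,'d,'g) opmon \<Rightarrow>
    ('c,'f,'d,'g,'o,'a) biact \<Rightarrow> 'o \<Rightarrow> ('c \<Rightarrow> 'a) \<Rightarrow> bool" where
  "heptagon C D E B M \<beta> \<longleftrightarrow> (\<forall>V\<in>Ob C. \<forall>W\<in>Ob C.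
     let EV = Eob E V; EW = Eob E W; EVW = Eob E (tob C V W);
         P1 = lob B (tob C V W) M;
         P2 = rob B M EVW;
         P3 = rob B M (tob D EV EW);
         Q2 = lob B V (lob B W M);
         Q3 = lob B V (rob B M EW);
         Q4 = rob B (lob B V M) EW;
         P4 = rob B (rob B M EV) EW
     in Comp B P1 P3 P4 (brassoc B M EV EW)
          (Comp B P1 P2 P3 (rmor B M M EVW (tob D EV EW) (Id B M) (psi E V W)) (\<beta> (tob C V W))) =
        Comp B P1 Q4 P4 (rmor B (lob B V M) (rob B M EV) EW EW (\<beta> V) (Id D EW))
          (Comp B P1 Q3 Q4 (bmid B V M EW)
            (Comp B P1 Q2 Q3 (lmor B V V (lob B W M) (rob B M EW) (Id C V) (\<beta> W))
              (blassoc B V W M))))"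

text \<open>
  Compatibility with \<open>\<psi>\<^sub>0\<close> is part of the notion of an object of the lax center. As \<open>\<beta>\<close> is not
  required to be invertible, it is not implied by the heptagon, which holds for \<open>\<beta> = 0\<close>.
\<close>

definition unit_triangle ::
  "('c,'f,'x) moncat_scheme \<Rightarrow> ('d,'g,'y) moncat_scheme \<Rightarrow> ('c,'f,'d,'g) opmon \<Rightarrow>
    ('c,'f,'d,'g,'o,'a) biact \<Rightarrow> 'o \<Rightarrow> ('c \<Rightarrow> 'a) \<Rightarrow> bool" where
  "unit_triangle C D E B M \<beta> \<longleftrightarrow>
     (let EI = Eob E (tunit C); P1 = lob B (tunit C) M; P2 = rob B M EI; P3 = rob B M (tunit D)
      in Comp B P1 P3 M (brunit B M)
           (Comp B P1 P2 P3 (rmor B M M EI (tunit D) (Id B M) (psi0 E)) (\<beta> (tunit C))) =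
         blunit B M)"

definition lax_center ::
  "('c,'f,'x) moncat_scheme \<Rightarrow> ('d,'g,'y) moncat_scheme \<Rightarrow> ('c,'f,'d,'g) opmon \<Rightarrow>
    ('c,'f,'d,'g,'o,'a) biact \<Rightarrow> ('o \<times> ('c \<Rightarrow> 'a), 'a) cat" where
  "lax_center C D E B =
     \<lparr>Ob = {(M, \<beta>). M \<in> Ob B \<and> nat_family C D E B M \<beta> \<and> heptagon C D E B M \<beta> \<and>
        unit_triangle C D E B M \<beta>},
      Hom = (\<lambda>(M, \<beta>) (N, \<gamma>). {f \<in> Hom B M N. \<forall>V\<in>Ob C.
        Comp B (lob B V M) (lob B V N) (rob B N (Eob E V))
          (\<gamma> V) (lmor B V V M N (Id C V) f) =
        Comp B (lob B V M) (rob B M (Eob E V)) (rob B N (Eob E V))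
          (rmor B M N (Eob E V) (Eob E V) f (Id D (Eob E V))) (\<beta> V)}),
      Id = (\<lambda>(M, \<beta>). Id B M),
      Comp = (\<lambda>(M, \<beta>) (N, \<gamma>) (P, \<delta>). Comp B M N P)\<rparr>"

section \<open>The categories and functors attached to a Yetter-Drinfeld datum\<close>

definition mod_cat :: "'u ring \<Rightarrow> ('u,'u,'x) module_scheme \<Rightarrow> ('u lmod, 'u \<Rightarrow> 'u) cat" where
  "mod_cat k A =
     \<lparr>Ob = {M. left_module k A M},
      Hom = (\<lambda>M N. {f \<in> extensional (carrier M). lmod_map k A M N f}),
      Id = (\<lambda>M. \<lambda>x\<in>carrier M. x),
      Comp = (\<lambda>M N P g f. compose (carrier M) g f)\<rparr>"

text \<open>
  The tensor product of a \<open>B\<close>-module \<open>V\<close> and a \<open>B'\<close>-module \<open>W\<close> becomes a module over any algebra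
  with a map \<open>\<delta>\<close> to \<open>B \<otimes> B'\<close>.
\<close>

definition act_tensor ::
  "'u ring \<Rightarrow> ('u,'u,'x) module_scheme \<Rightarrow> ('u,'u,'y) module_scheme \<Rightarrow> ('u \<Rightarrow> 'u) \<Rightarrow>
    'u lmod \<Rightarrow> 'u lmod \<Rightarrow> 'u lmod" where
  "act_tensor k B B' \<delta> V W = with_act (tensor k V W)
     (\<lambda>a t. tlift k B B' (tensor k V W) (\<lambda>b b'. tmap k V W V W (act V b) (act W b') t) (\<delta> a))"

definition triv_mod :: "'u ring \<Rightarrow> 'u coalg \<Rightarrow> 'u lmod" where
  "triv_mod k H = with_act (ground k) (\<lambda>h r. counit H h \<otimes>\<^bsub>k\<^esub> r)"

definition mod_moncat :: "'u ring \<Rightarrow> 'u coalg \<Rightarrow> ('u lmod, 'u \<Rightarrow> 'u) moncat" where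
  "mod_moncat k H =
     \<lparr>Ob = Ob (mod_cat k H), Hom = Hom (mod_cat k H), Id = Id (mod_cat k H),
      Comp = Comp (mod_cat k H),
      tob = act_tensor k H H (comul H),
      tmor = (\<lambda>X X' Y Y'. tmap k X Y X' Y'),
      tunit = triv_mod k H,
      massoc = tassoc k, mlunit = tlunit k, mrunit = trunit k\<rparr>"

definition mod_biact ::
  "'u ring \<Rightarrow> 'u coalg \<Rightarrow> 'u coalg \<Rightarrow> 'u bicomod_alg \<Rightarrow>
    ('u lmod, 'u \<Rightarrow> 'u, 'u lmod, 'u \<Rightarrow> 'u, 'u lmod, 'u \<Rightarrow> 'u) biact" where
  "mod_biact k H K A =
     \<lparr>Ob = Ob (mod_cat k A), Hom = Hom (mod_cat k A), Id = Id (mod_cat k A),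
      Comp = Comp (mod_cat k A),
      lob = act_tensor k H A (lcoact A),
      lmor = (\<lambda>V V' M M'. tmap k V M V' M'),
      rob = act_tensor k A K (rcoact A),
      rmor = (\<lambda>M M' W W'. tmap k M W M' W'),
      blassoc = tassoc k, blunit = tlunit k,
      brassoc = tassoc_inv k, brunit = trunit k,
      bmid = tassoc_inv k\<rparr>"

subsection \<open>The op-monoidal functor given by \<open>C \<otimes>\<^sub>H V\<close>\<close>

definition htensor ::
  "'u coalg \<Rightarrow> 'u bimod_coalg \<Rightarrow> 'u lmod \<Rightarrow> ('u,'u) module" where
  "htensor H C V = btensor (carrier H) (ract C) (act V) C V"

definition hpure :: "'u coalg \<Rightarrow> 'u bimod_coalg \<Rightarrow> 'u lmod \<Rightarrow> 'u \<Rightarrow> 'u \<Rightarrow> 'u" where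
  "hpure H C V = bpure (carrier H) (ract C) (act V) C V"

definition hlift ::
  "'u ring \<Rightarrow> 'u coalg \<Rightarrow> 'u bimod_coalg \<Rightarrow> 'u lmod \<Rightarrow> ('u,'u,'x) module_scheme \<Rightarrow>
    ('u \<Rightarrow> 'u \<Rightarrow> 'u) \<Rightarrow> 'u \<Rightarrow> 'u" where
  "hlift k H C V P b = blift (carrier H) (ract C) (act V) k C V P b"

definition ind_mod :: "'u ring \<Rightarrow> 'u coalg \<Rightarrow> 'u bimod_coalg \<Rightarrow> 'u lmod \<Rightarrow> 'u lmod" where
  "ind_mod k H C V = with_act (htensor H C V)
     (\<lambda>x t. hlift k H C V (htensor H C V) (\<lambda>c v. hpure H C V (lact C x c) v) t)"

definition ind_functor ::
  "'u ring \<Rightarrow> 'u coalg \<Rightarrow> 'u bimod_coalg \<Rightarrow>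
    ('u lmod, 'u \<Rightarrow> 'u, 'u lmod, 'u \<Rightarrow> 'u) opmon" where
  "ind_functor k H C =
     \<lparr>Eob = ind_mod k H C,
      Emor = (\<lambda>V W f. hlift k H C V (htensor H C W) (\<lambda>c v. hpure H C W c (f v))),
      psi = (\<lambda>V W. let P = tensor k (htensor H C V) (htensor H C W) in
        hlift k H C (act_tensor k H H (comul H) V W) P
          (\<lambda>c t. tlift k C C P
            (\<lambda>c1 c2. tlift k V W P
              (\<lambda>v w. tpure k (htensor H C V) (htensor H C W) (hpure H C V c1 v) (hpure H C W c2 w)) t)
            (comul C c))),
      psi0 = hlift k H C (triv_mod k H) (ground k) (\<lambda>c r. counit C c \<otimes>\<^bsub>k\<^esub> r)\<rparr>"

subsection \<open>Generalized Yetter-Drinfeld modules\<close>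

definition yd_condition ::
  "'u ring \<Rightarrow> 'u coalg \<Rightarrow> 'u coalg \<Rightarrow> 'u bicomod_alg \<Rightarrow> 'u bimod_coalg \<Rightarrow> 'u lmod \<Rightarrow>
    ('u \<Rightarrow> 'u) \<Rightarrow> bool" where
  "yd_condition k H K A C M \<rho> \<longleftrightarrow> (\<forall>a\<in>carrier A. \<forall>m\<in>carrier M.
     tlift k H A (tensor k M C)
       (\<lambda>h a'. tmap k M C M C (\<lambda>x. x) (\<lambda>c. ract C c h) (\<rho> (act M a' m))) (lcoact A a) =
     tlift k A K (tensor k M C)
       (\<lambda>a' x. tmap k M C M C (act M a') (lact C x) (\<rho> m)) (rcoact A a))"

definition yd_cat ::
  "'u ring \<Rightarrow> 'u coalg \<Rightarrow> 'u coalg \<Rightarrow> 'u bicomod_alg \<Rightarrow> 'u bimod_coalg \<Rightarrow>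
    ('u lmod \<times> ('u \<Rightarrow> 'u), 'u \<Rightarrow> 'u) cat" where
  "yd_cat k H K A C =
     \<lparr>Ob = {(M, \<rho>). left_module k A M \<and> \<rho> \<in> extensional (carrier M) \<and>
        right_comodule k C M \<rho> \<and> yd_condition k H K A C M \<rho>},
      Hom = (\<lambda>(M, \<rho>) (N, \<sigma>). {f \<in> extensional (carrier M). lmod_map k A M N f \<and>
        (\<forall>m\<in>carrier M. \<sigma> (f m) = tmap k M C N C f (\<lambda>c. c) (\<rho> m))}),
      Id = (\<lambda>(M, \<rho>). \<lambda>x\<in>carrier M. x),
      Comp = (\<lambda>(M, \<rho>) (N, \<sigma>) (P, \<tau>) g f. compose (carrier M) g f)\<rparr>"

end

(* A natural family beta_V : V (x) M -> M (x) (C (x)_H V) is determined by its value at the regular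
   module: for v in V the H-linear map H -> V, h |-> h v, carries 1 to v, so naturality gives
   beta_V (v (x) m) = m_0 (x) (m_1 (x)_H v), where rho m = m_0 (x) m_1 is the image of
   beta_H (1 (x) m) under C (x)_H H = C. Inserting this formula, A-linearity of all beta_V becomes
   the Yetter-Drinfeld condition, the heptagon becomes coassociativity and the unit triangle becomes
   counitality of rho; in each case the condition on rho is read off from V = H and v = 1, because
   c |-> c (x)_H 1 is split injective. The same argument identifies the morphisms. *)

theory Submission
  imports Defs
begin

section \<open>Balanced tensor products and their universal property\<close>

text \<open>Two obstacles shape the proof. Over a commutative ring, tensoring with M need not
  preserve injections, so injectivity of c |-> c (x)_H 1 alone would not permit cancelling it inside
  M (x) C or (M (x) C) (x) C. The retraction \<open>\<theta>\<close> : C (x)_H H -> C, c (x) h |-> c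
  h, does permit it, since tensoring preserves left inverses. Moreover, a coproduct or a coaction is
  in general not a pure tensor, so its Sweedler components cannot be named. An identity involving
  one is therefore proved with an arbitrary tensor in its place: both sides are then linear in that
  tensor, and extensionality leaves pure tensors, one tensor argument at a time. An isomorphism of
  categories, as opposed to an equivalence, requires both round trips on objects to be equalities of
  functions, also outside the carriers. This is why families, their components and coactions are
  extensional and the constructed ones are restricted. Naturality can be tested at H because the
  regular module has the carrier of H and so lies in the same universe \<open>'u\<close>.\<close>

lemma klinI:
  assumes "\<And>x. x \<in> carrier M \<Longrightarrow> f x \<in> carrier N"
    and "\<And>x y. x \<in> carrier M \<Longrightarrow> y \<in> carrier M \<Longrightarrow> f (x \<oplus>\<^bsub>M\<^esub> y) = f x \<oplus>\<^bsub>N\<^esub> f y"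
    and "\<And>r x. r \<in> carrier k \<Longrightarrow> x \<in> carrier M \<Longrightarrow> f (r \<odot>\<^bsub>M\<^esub> x) = r \<odot>\<^bsub>N\<^esub> f x"
  shows "klin k M N f"
  using assms by (auto simp: klin_def)

lemma
  assumes "klin k M N f"
  shows klin_closed: "x \<in> carrier M \<Longrightarrow> f x \<in> carrier N"
    and klin_add: "x \<in> carrier M \<Longrightarrow> y \<in> carrier M \<Longrightarrow> f (x \<oplus>\<^bsub>M\<^esub> y) = f x \<oplus>\<^bsub>N\<^esub> f y"
    and klin_smult: "r \<in> carrier k \<Longrightarrow> x \<in> carrier M \<Longrightarrow> f (r \<odot>\<^bsub>M\<^esub> x) = r \<odot>\<^bsub>N\<^esub> f x"
  using assms by (auto simp: klin_def)

lemma kbilinI: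
  assumes "\<And>m. m \<in> carrier M \<Longrightarrow> klin k N P (b m)"
    and "\<And>n. n \<in> carrier N \<Longrightarrow> klin k M P (\<lambda>m. b m n)"
  shows "kbilin k M N P b"
  using assms by (auto simp: kbilin_def)

lemma
  assumes "kbilin k M N P b"
  shows kbilin_left: "n \<in> carrier N \<Longrightarrow> klin k M P (\<lambda>m. b m n)"
    and kbilin_right: "m \<in> carrier M \<Longrightarrow> klin k N P (b m)"
    and kbilin_closed: "m \<in> carrier M \<Longrightarrow> n \<in> carrier N \<Longrightarrow> b m n \<in> carrier P"
  using assms by (auto simp: kbilin_def klin_def)

text \<open>Cardinality: the free abelian group on an infinite set has the cardinality of that set,
  and an infinite set is equipotent to its square. So the choice in \<open>enc\<close> is made from
  a nonempty set of injections.\<close>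

lemma inj_enc:
  assumes "infinite (UNIV :: 'u set)"
  shows "inj (enc :: ('u \<times> 'u \<Rightarrow>\<^sub>0 int) \<Rightarrow> 'u)"
proof -
  have "(UNIV :: ('u \<times> 'u \<Rightarrow>\<^sub>0 int) set) \<approx> carrier (free_Abelian_group (UNIV :: ('u \<times> 'u) set))"
    by (simp add: free_Abelian_group_def)
  also have "\<dots> \<approx> (UNIV :: ('u \<times> 'u) set)"
    using assms by (intro eqpoll_free_Abelian_group_infinite) (simp add: finite_prod)
  also have "(UNIV :: ('u \<times> 'u) set) \<approx> (UNIV :: 'u set)"
    using Times_same_infinite_bij_betw[OF assms] by (auto simp: eqpoll_def)
  finally have "\<exists>e. inj (e :: ('u \<times> 'u \<Rightarrow>\<^sub>0 int) \<Rightarrow> 'u)"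
    unfolding eqpoll_def bij_betw_def by blast
  then show ?thesis
    unfolding enc_def by (rule someI_ex)
qed

lemma dec_enc:
  assumes "infinite (UNIV :: 'u set)"
  shows "dec (enc p :: 'u) = p"
  using inj_enc[OF assms] by (simp add: dec_def)

locale tensor_universe =
  fixes k :: "'u ring"
  assumes infinite_universe: "infinite (UNIV :: 'u set)" and cring: "cring k"

text \<open>Common frame for both tensor products: \<open>R\<close> is the carrier of
  \<open>k\<close> for tensor products over the ground ring, and the carrier of H for C (x)_H V.
  Scalars act through the left factor; linearity of \<open>ra\<close> makes this action respect the
  balancing relators.\<close>

locale balanced = tensor_universe k for k :: "'u ring" +
  fixes R :: "'r set" and ra :: "'u \<Rightarrow> 'r \<Rightarrow> 'u" and la :: "'r \<Rightarrow> 'u \<Rightarrow> 'u"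
    and M :: "('u,'u,'x) module_scheme" and N :: "('u,'u,'y) module_scheme"
  assumes module_M: "Module.module k M" and module_N: "Module.module k N"
    and ra_klin: "r \<in> R \<Longrightarrow> klin k M M (\<lambda>m. ra m r)"
    and la_closed: "r \<in> R \<Longrightarrow> n \<in> carrier N \<Longrightarrow> la r n \<in> carrier N"
begin

interpretation M: Module.module k M by (rule module_M)
interpretation N: Module.module k N by (rule module_N)

abbreviation "F \<equiv> free_Abelian_group (carrier M \<times> carrier N)"
abbreviation "S \<equiv> generate F (relators R ra la M N)"
abbreviation "cls \<equiv> bclass R ra la M N"
abbreviation "T \<equiv> btensor R ra la M N"
abbreviation "scale r \<equiv> frag_extend (\<lambda>(m, n). frag_of (r \<odot>\<^bsub>M\<^esub> m, n))"

lemma relators_closed: "relators R ra la M N \<subseteq> carrier F"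
proof -
  note keys = keys_diff[THEN subsetD]
  show ?thesis
    unfolding relators_def
    by (auto dest!: keys simp: keys_frag_of la_closed klin_closed[OF ra_klin])
qed

lemma subgroup_S: "subgroup S F"
  by (rule group.generate_is_subgroup[OF group_free_Abelian_group relators_closed])

lemma S_keys: "p \<in> S \<Longrightarrow> Poly_Mapping.keys p \<subseteq> carrier M \<times> carrier N"
  using subgroup.subset[OF subgroup_S] by (force simp: free_Abelian_group_def)

lemma S_zero: "0 \<in> S"
  using subgroup.one_closed[OF subgroup_S] by simp

lemma S_add: "p \<in> S \<Longrightarrow> q \<in> S \<Longrightarrow> p + q \<in> S"
  using subgroup.m_closed[OF subgroup_S] by simp

lemma S_uminus: "p \<in> S \<Longrightarrow> - p \<in> S"
  using subgroup.m_inv_closed[OF subgroup_S, of p] S_keys[of p] by simp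

lemma S_diff: "p \<in> S \<Longrightarrow> q \<in> S \<Longrightarrow> p - q \<in> S"
  using S_add[of p "- q"] S_uminus[of q] by simp

lemma S_relator: "p \<in> relators R ra la M N \<Longrightarrow> p \<in> S"
  by (rule generate.incl)

lemma coset_eq: "S #>\<^bsub>F\<^esub> p = {q. q - p \<in> S}"
proof -
  have "q \<in> S #>\<^bsub>F\<^esub> p \<longleftrightarrow> q - p \<in> S" for q
  proof
    assume "q - p \<in> S"
    then have "(q - p) + p \<in> S #>\<^bsub>F\<^esub> p"
      unfolding r_coset_def mult_free_Abelian_group by blast
    then show "q \<in> S #>\<^bsub>F\<^esub> p" by simp
  qed (auto simp: r_coset_def)
  then show ?thesis by blast
qed

text \<open>The representative stored in the code lies in the coset of \<open>p\<close>. Together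
  with \<open>cls_eqI\<close> this is all that the rest of the locale uses about the choice made in
  \<open>bclass\<close>.\<close>

lemma dec_cls: "dec (cls p) - p \<in> S"
proof -
  have "\<exists>q. q \<in> S #>\<^bsub>F\<^esub> p"
    using S_zero by (auto simp: coset_eq intro: exI[of _ p])
  then have "(SOME q. q \<in> S #>\<^bsub>F\<^esub> p) \<in> S #>\<^bsub>F\<^esub> p"
    by (rule someI_ex)
  then show ?thesis
    by (simp add: bclass_def Let_def dec_enc[OF infinite_universe] coset_eq)
qed

lemma cls_eqI:
  assumes "p - q \<in> S"
  shows "cls p = cls q"
proof -
  have "S #>\<^bsub>F\<^esub> p = S #>\<^bsub>F\<^esub> q"
  proof -
    have "x - p \<in> S \<longleftrightarrow> x - q \<in> S" for x
      using S_add[OF _ assms, of "x - p"] S_diff[OF _ assms, of "x - q"] by auto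
    then show ?thesis by (simp add: coset_eq)
  qed
  then show ?thesis
    by (simp add: bclass_def Let_def)
qed

lemma carrier_T: "carrier T = cls ` {p. Poly_Mapping.keys p \<subseteq> carrier M \<times> carrier N}"
  by (auto simp: btensor_def free_Abelian_group_def)

lemma cls_closed: "Poly_Mapping.keys p \<subseteq> carrier M \<times> carrier N \<Longrightarrow> cls p \<in> carrier T"
  unfolding carrier_T by (intro imageI CollectI)

lemma T_cases:
  assumes "x \<in> carrier T"
  obtains p where "Poly_Mapping.keys p \<subseteq> carrier M \<times> carrier N" "x = cls p"
  using assms by (auto simp: carrier_T)

lemma zero_T: "\<zero>\<^bsub>T\<^esub> = cls 0"
  by (simp add: btensor_def)

lemma add_T: "cls p \<oplus>\<^bsub>T\<^esub> cls q = cls (p + q)"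
proof -
  have "dec (cls p) + dec (cls q) - (p + q) = (dec (cls p) - p) + (dec (cls q) - q)"
    by simp
  also have "\<dots> \<in> S"
    by (intro S_add dec_cls)
  finally show ?thesis
    by (simp add: btensor_def cls_eqI)
qed

lemma pure_relators:
  shows "m \<in> carrier M \<Longrightarrow> m' \<in> carrier M \<Longrightarrow> n \<in> carrier N \<Longrightarrow>
      frag_of (m \<oplus>\<^bsub>M\<^esub> m', n) - frag_of (m, n) - frag_of (m', n) \<in> S"
    and "m \<in> carrier M \<Longrightarrow> n \<in> carrier N \<Longrightarrow> n' \<in> carrier N \<Longrightarrow>
      frag_of (m, n \<oplus>\<^bsub>N\<^esub> n') - frag_of (m, n) - frag_of (m, n') \<in> S"
    and "m \<in> carrier M \<Longrightarrow> r \<in> R \<Longrightarrow> n \<in> carrier N \<Longrightarrow>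
      frag_of (ra m r, n) - frag_of (m, la r n) \<in> S"
  by (rule S_relator, force simp: relators_def)+

lemma keys_scale:
  assumes "r \<in> carrier k" "Poly_Mapping.keys p \<subseteq> carrier M \<times> carrier N"
  shows "Poly_Mapping.keys (scale r p) \<subseteq> carrier M \<times> carrier N"
  using keys_frag_extend[THEN subsetD, of _ "\<lambda>(m, n). frag_of (r \<odot>\<^bsub>M\<^esub> m, n)" p] assms
  by (force simp: keys_frag_of)

lemma relators_cases:
  assumes "p \<in> relators R ra la M N"
  obtains (left) m m' n where "p = frag_of (m \<oplus>\<^bsub>M\<^esub> m', n) - frag_of (m, n) - frag_of (m', n)"
      "m \<in> carrier M" "m' \<in> carrier M" "n \<in> carrier N"
    | (right) m n n' where "p = frag_of (m, n \<oplus>\<^bsub>N\<^esub> n') - frag_of (m, n) - frag_of (m, n')"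
      "m \<in> carrier M" "n \<in> carrier N" "n' \<in> carrier N"
    | (mid) m r n where "p = frag_of (ra m r, n) - frag_of (m, la r n)"
      "m \<in> carrier M" "r \<in> R" "n \<in> carrier N"
  using assms unfolding relators_def by blast

text \<open>Scaling turns each relator into a relator of the same kind; for the balancing relator
  this is the linearity of \<open>ra\<close>. Hence scalar multiplication of formal sums descends to
  the quotient.\<close>

lemma scale_S:
  assumes r: "r \<in> carrier k" and p: "p \<in> S"
  shows "scale r p \<in> S"
proof -
  have rel: "scale r h \<in> S" if "h \<in> relators R ra la M N" for h
    using that
  proof (cases h rule: relators_cases)
    case (left m m' n)
    then show ?thesis
      using pure_relators(1)[of "r \<odot>\<^bsub>M\<^esub> m" "r \<odot>\<^bsub>M\<^esub> m'" n] r
      by (simp add: frag_extend_diff M.smult_r_distr)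
  next
    case (right m n n')
    then show ?thesis
      using pure_relators(2)[of "r \<odot>\<^bsub>M\<^esub> m" n n'] r by (simp add: frag_extend_diff)
  next
    case (mid m r' n)
    then show ?thesis
      using pure_relators(3)[of "r \<odot>\<^bsub>M\<^esub> m" r' n] r
      by (simp add: frag_extend_diff klin_smult[OF ra_klin])
  qed
  show ?thesis
    using p
  proof (induction p rule: generate.induct)
    case (inv h)
    then have "inv\<^bsub>F\<^esub> h = - h"
      using relators_closed by auto
    then show ?case
      using rel[OF inv] by (simp add: frag_extend_minus S_uminus)
  next
    case (eng h1 h2)
    then show ?case by (simp add: frag_extend_add S_add)
  qed (simp_all add: S_zero rel)
qed

lemma smult_T:
  assumes "r \<in> carrier k"
  shows "r \<odot>\<^bsub>T\<^esub> cls p = cls (scale r p)"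
  using scale_S[OF assms dec_cls, of p] by (simp add: btensor_def frag_extend_diff cls_eqI)

lemma keys_add_closed:
  "Poly_Mapping.keys p \<subseteq> X \<Longrightarrow> Poly_Mapping.keys q \<subseteq> X \<Longrightarrow> Poly_Mapping.keys (p + q) \<subseteq> X"
  using keys_add[of p q] by blast

lemma keys_diff_closed:
  "Poly_Mapping.keys p \<subseteq> X \<Longrightarrow> Poly_Mapping.keys q \<subseteq> X \<Longrightarrow> Poly_Mapping.keys (p - q) \<subseteq> X"
  using keys_diff[of p q] by blast

lemma abelian_group_T: "abelian_group T"
proof (rule abelian_groupI)
  fix x assume "x \<in> carrier T"
  then obtain p where p: "Poly_Mapping.keys p \<subseteq> carrier M \<times> carrier N" "x = cls p"
    by (auto simp: carrier_T)
  then have "cls (- p) \<oplus>\<^bsub>T\<^esub> x = \<zero>\<^bsub>T\<^esub>"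
    by (simp add: add_T zero_T)
  with p show "\<exists>y\<in>carrier T. y \<oplus>\<^bsub>T\<^esub> x = \<zero>\<^bsub>T\<^esub>"
    unfolding carrier_T by (intro bexI[of _ "cls (- p)"]) auto
next
  fix x y assume "x \<in> carrier T" "y \<in> carrier T"
  then show "x \<oplus>\<^bsub>T\<^esub> y \<in> carrier T"
    by (elim T_cases) (simp only: add_T cls_closed keys_add_closed)
qed (auto simp: carrier_T zero_T add_T add_ac intro!: imageI)

lemma module_T: "Module.module k T"
proof (rule moduleI[OF cring abelian_group_T])
  fix r x assume "r \<in> carrier k" "x \<in> carrier T"
  then show "r \<odot>\<^bsub>T\<^esub> x \<in> carrier T"
    using keys_scale by (auto simp: carrier_T smult_T intro!: imageI)
next
  fix r s x assume rs: "r \<in> carrier k" "s \<in> carrier k" and "x \<in> carrier T"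
  then obtain p where p: "Poly_Mapping.keys p \<subseteq> carrier M \<times> carrier N" "x = cls p"
    by (auto simp: carrier_T)
  \<comment> \<open>This law holds only modulo relations, by additivity in the left slot. The laws
    for products of scalars and for the unit hold already for formal sums.\<close>
  from p(1) have "scale (r \<oplus>\<^bsub>k\<^esub> s) p - (scale r p + scale s p) \<in> S"
  proof (induction p rule: frag_induction)
    case (one x)
    then show ?case
      using pure_relators(1)[of "r \<odot>\<^bsub>M\<^esub> fst x" "s \<odot>\<^bsub>M\<^esub> fst x" "snd x"] rs
      by (auto simp: M.smult_l_distr diff_diff_eq)
  next
    case (diff a b)
    then show ?case
      using S_diff[OF diff] by (simp add: frag_extend_diff algebra_simps)
  qed (simp add: S_zero)
  then show "(r \<oplus>\<^bsub>k\<^esub> s) \<odot>\<^bsub>T\<^esub> x = r \<odot>\<^bsub>T\<^esub> x \<oplus>\<^bsub>T\<^esub> s \<odot>\<^bsub>T\<^esub> x"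
    using rs p by (simp add: smult_T add_T cls_eqI M.R.add.m_closed M.R.m_closed M.R.one_closed)
next
  fix r x y assume "r \<in> carrier k" "x \<in> carrier T" "y \<in> carrier T"
  then show "r \<odot>\<^bsub>T\<^esub> (x \<oplus>\<^bsub>T\<^esub> y) = r \<odot>\<^bsub>T\<^esub> x \<oplus>\<^bsub>T\<^esub> r \<odot>\<^bsub>T\<^esub> y"
    by (auto simp: carrier_T smult_T add_T frag_extend_add)
next
  fix r s x assume rs: "r \<in> carrier k" "s \<in> carrier k" and "x \<in> carrier T"
  then obtain p where p: "Poly_Mapping.keys p \<subseteq> carrier M \<times> carrier N" "x = cls p"
    by (auto simp: carrier_T)
  from p(1) have "scale (r \<otimes>\<^bsub>k\<^esub> s) p = scale r (scale s p)"
    by (induction p rule: frag_induction) (auto simp: frag_extend_diff M.smult_assoc1 rs)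
  then show "(r \<otimes>\<^bsub>k\<^esub> s) \<odot>\<^bsub>T\<^esub> x = r \<odot>\<^bsub>T\<^esub> (s \<odot>\<^bsub>T\<^esub> x)"
    using rs p by (simp add: smult_T M.R.add.m_closed M.R.m_closed M.R.one_closed)
next
  fix x assume "x \<in> carrier T"
  then obtain p where p: "Poly_Mapping.keys p \<subseteq> carrier M \<times> carrier N" "x = cls p"
    by (auto simp: carrier_T)
  from p(1) have "scale \<one>\<^bsub>k\<^esub> p = p"
    by (induction p rule: frag_induction) (auto simp: frag_extend_diff)
  then show "\<one>\<^bsub>k\<^esub> \<odot>\<^bsub>T\<^esub> x = x"
    using p by (simp add: smult_T M.R.add.m_closed M.R.m_closed M.R.one_closed)
qed

lemma bpure_closed:
  "m \<in> carrier M \<Longrightarrow> n \<in> carrier N \<Longrightarrow> bpure R ra la M N m n \<in> carrier T"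
  by (auto simp: bpure_def carrier_T keys_frag_of)

lemma bpure_add_left:
  "m \<in> carrier M \<Longrightarrow> m' \<in> carrier M \<Longrightarrow> n \<in> carrier N \<Longrightarrow>
    bpure R ra la M N (m \<oplus>\<^bsub>M\<^esub> m') n = bpure R ra la M N m n \<oplus>\<^bsub>T\<^esub> bpure R ra la M N m' n"
  using pure_relators(1) by (simp add: bpure_def add_T cls_eqI diff_diff_eq)

lemma bpure_add_right:
  "m \<in> carrier M \<Longrightarrow> n \<in> carrier N \<Longrightarrow> n' \<in> carrier N \<Longrightarrow>
    bpure R ra la M N m (n \<oplus>\<^bsub>N\<^esub> n') = bpure R ra la M N m n \<oplus>\<^bsub>T\<^esub> bpure R ra la M N m n'"
  using pure_relators(2) by (simp add: bpure_def add_T cls_eqI diff_diff_eq)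

lemma bpure_smult_left:
  "r \<in> carrier k \<Longrightarrow> bpure R ra la M N (r \<odot>\<^bsub>M\<^esub> m) n = r \<odot>\<^bsub>T\<^esub> bpure R ra la M N m n"
  by (simp add: bpure_def smult_T)

lemma bpure_balanced:
  "m \<in> carrier M \<Longrightarrow> r \<in> R \<Longrightarrow> n \<in> carrier N \<Longrightarrow>
    bpure R ra la M N (ra m r) n = bpure R ra la M N m (la r n)"
  using pure_relators(3) by (simp add: bpure_def cls_eqI)

section \<open>Linear maps out of the quotient\<close>

lemma add_eq_cls_diff:
  assumes P: "Module.module k P" and f: "klin k T P f"
    and "Poly_Mapping.keys p \<subseteq> carrier M \<times> carrier N" "Poly_Mapping.keys q \<subseteq> carrier M \<times> carrier N"
  shows "f (cls (p - q)) = f (cls p) \<ominus>\<^bsub>P\<^esub> f (cls q)"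
proof -
  interpret P: Module.module k P by (rule P)
  have *: "cls (p - q) \<in> carrier T" "cls q \<in> carrier T" "cls p \<in> carrier T"
    by (intro cls_closed keys_diff_closed assms(3,4))+
  have "f (cls p) = f (cls (p - q)) \<oplus>\<^bsub>P\<^esub> f (cls q)"
    using klin_add[OF f *(1,2)] by (simp add: add_T)
  then show ?thesis
    using * klin_closed[OF f] by (simp add: P.M.minus_eq P.M.a_assoc P.M.r_neg)
qed

text \<open>Classes of pure tensors generate the quotient as a group. The extensionality rules for
  both tensor products are instances of this one.\<close>

lemma klin_T_ext:
  assumes P: "Module.module k P" and f: "klin k T P f" and g: "klin k T P g"
    and eq: "\<And>m n. m \<in> carrier M \<Longrightarrow> n \<in> carrier N \<Longrightarrow>
      f (bpure R ra la M N m n) = g (bpure R ra la M N m n)"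
    and t: "t \<in> carrier T"
  shows "f t = g t"
proof -
  interpret T: Module.module k T by (rule module_T)
  interpret P: Module.module k P by (rule P)
  have zero: "h \<zero>\<^bsub>T\<^esub> = \<zero>\<^bsub>P\<^esub>" if "klin k T P h" for h
    using klin_smult[OF that, of "\<zero>\<^bsub>k\<^esub>" "\<zero>\<^bsub>T\<^esub>"] klin_closed[OF that, of "\<zero>\<^bsub>T\<^esub>"] by simp
  obtain p where p: "Poly_Mapping.keys p \<subseteq> carrier M \<times> carrier N" "t = cls p"
    using t by (auto simp: carrier_T)
  from p(1) have "f (cls p) = g (cls p)"
  proof (induction p rule: free_Abelian_group_induct[consumes 1])
    case 1
    then show ?case using zero[OF f] zero[OF g] by (simp flip: zero_T)
  next
    case (2 p q)
    then show ?case by (simp add: add_eq_cls_diff[OF P f] add_eq_cls_diff[OF P g])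
  next
    case (3 a)
    then show ?case using eq by (auto simp: bpure_def)
  qed
  with p show ?thesis by simp
qed

text \<open>\<open>blift\<close> is a definite description, so existence and uniqueness are both
  needed: existence from the universal property of the free abelian group, uniqueness from
  \<open>klin_T_ext\<close> on the carrier and extensionality outside it.\<close>

lemma blift:
  assumes P: "Module.module k P" and b: "kbilin k M N P b"
    and bal: "\<And>m r n. m \<in> carrier M \<Longrightarrow> r \<in> R \<Longrightarrow> n \<in> carrier N \<Longrightarrow> b (ra m r) n = b m (la r n)"
  shows blift_extensional: "blift R ra la k M N P b \<in> extensional (carrier T)"
    and blift_klin: "klin k T P (blift R ra la k M N P b)"
    and blift_bpure: "m \<in> carrier M \<Longrightarrow> n \<in> carrier N \<Longrightarrow>
      blift R ra la k M N P b (bpure R ra la M N m n) = b m n"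
proof -
  interpret P: Module.module k P by (rule P)
  have add_P: "comm_group (add_monoid P)"
    by (rule P.M.a_comm_group)
  have img: "(\<lambda>(m, n). b m n) ` (carrier M \<times> carrier N) \<subseteq> carrier (add_monoid P)"
    using kbilin_closed[OF b] by auto
  obtain h where h: "h \<in> hom F (add_monoid P)"
    and h_of: "\<And>x. x \<in> carrier M \<times> carrier N \<Longrightarrow> h (frag_of x) = (\<lambda>(m, n). b m n) x"
    using comm_group.free_Abelian_group_universal[OF add_P img] by blast
  have h_closed: "h p \<in> carrier P" if "Poly_Mapping.keys p \<subseteq> carrier M \<times> carrier N" for p
    using hom_in_carrier[OF h, of p] that by simp
  have h_add: "h (p + q) = h p \<oplus>\<^bsub>P\<^esub> h q"
    if "Poly_Mapping.keys p \<subseteq> carrier M \<times> carrier N" "Poly_Mapping.keys q \<subseteq> carrier M \<times> carrier N" for p q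
    using hom_mult[OF h, of p q] that by simp
  have h_diff: "h (p - q) = h p \<ominus>\<^bsub>P\<^esub> h q"
    if "Poly_Mapping.keys p \<subseteq> carrier M \<times> carrier N" "Poly_Mapping.keys q \<subseteq> carrier M \<times> carrier N" for p q
  proof -
    have "h p = h (p - q) \<oplus>\<^bsub>P\<^esub> h q"
      using h_add[OF keys_diff_closed[OF that] that(2)] by simp
    then show ?thesis
      using that h_closed h_closed[OF keys_diff_closed[OF that]] by (simp add: P.M.minus_eq P.M.a_assoc P.M.r_neg)
  qed
  have h_zero: "h 0 = \<zero>\<^bsub>P\<^esub>"
    using h_diff[of 0 0] h_closed[of 0] by (simp add: P.M.minus_eq P.M.r_neg)
  have keys_of: "Poly_Mapping.keys (frag_of (m, n)) \<subseteq> carrier M \<times> carrier N"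
    if "m \<in> carrier M" "n \<in> carrier N" for m n
    using that by (simp add: keys_frag_of)
  note b_closed = kbilin_closed[OF b]
  have h_rel: "h p = \<zero>\<^bsub>P\<^esub>" if "p \<in> relators R ra la M N" for p
  proof -
    have bl: "b (m \<oplus>\<^bsub>M\<^esub> m') n = b m n \<oplus>\<^bsub>P\<^esub> b m' n"
      if "m \<in> carrier M" "m' \<in> carrier M" "n \<in> carrier N" for m m' n
      using klin_add[OF kbilin_left[OF b that(3)] that(1,2)] .
    have br: "b m (n \<oplus>\<^bsub>N\<^esub> n') = b m n \<oplus>\<^bsub>P\<^esub> b m n'"
      if "m \<in> carrier M" "n \<in> carrier N" "n' \<in> carrier N" for m n n'
      using klin_add[OF kbilin_right[OF b that(1)] that(2,3)] .
    have cancel: "x \<oplus>\<^bsub>P\<^esub> y \<ominus>\<^bsub>P\<^esub> x \<ominus>\<^bsub>P\<^esub> y = \<zero>\<^bsub>P\<^esub>"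
      if "x \<in> carrier P" "y \<in> carrier P" for x y
      using that
      by (simp add: P.M.minus_eq P.M.a_comm[of x y] P.M.a_assoc P.M.r_neg)
    show ?thesis
      using that
    proof (cases p rule: relators_cases)
      case (left m m' n)
      then show ?thesis
        by (simp add: h_diff keys_of keys_diff_closed h_of bl cancel b_closed M.M.add.m_closed)
    next
      case (right m n n')
      then show ?thesis
        by (simp add: h_diff keys_of keys_diff_closed h_of br cancel b_closed N.M.add.m_closed)
    next
      case (mid m r n)
      then show ?thesis
        by (simp add: h_diff keys_of h_of bal b_closed la_closed klin_closed[OF ra_klin]
            P.M.minus_eq P.M.r_neg)
    qed
  qed
  have h_S: "h p = \<zero>\<^bsub>P\<^esub>" if "p \<in> S" for p
    using that
  proof (induction p rule: generate.induct)
    case (inv p)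
    then show ?case
      using h_diff[of 0 p] h_rel[of p] h_zero relators_closed by (auto simp: P.M.minus_eq)
  next
    case (eng p q)
    then show ?case
      using h_add[of p q] S_keys by simp
  qed (simp_all add: h_zero h_rel)
  have keys_dec: "Poly_Mapping.keys (dec (cls p)) \<subseteq> carrier M \<times> carrier N"
    if "Poly_Mapping.keys p \<subseteq> carrier M \<times> carrier N" for p
    using keys_add_closed[OF S_keys[OF dec_cls[of p]] that] by simp
  have h_dec: "h (dec (cls p)) = h p" if "Poly_Mapping.keys p \<subseteq> carrier M \<times> carrier N" for p
    using h_add[OF S_keys[OF dec_cls[of p]] that] h_S[OF dec_cls[of p]] h_closed[OF that] by simp
  have h_scale: "h (scale r p) = r \<odot>\<^bsub>P\<^esub> h p"
    if "r \<in> carrier k" "Poly_Mapping.keys p \<subseteq> carrier M \<times> carrier N" for r p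
    using that(2)
  proof (induction p rule: free_Abelian_group_induct[consumes 1])
    case (2 p q)
    then show ?case
      using that(1)
      by (simp add: frag_extend_diff h_diff keys_scale P.M.minus_eq P.smult_r_distr P.smult_r_minus
          h_closed)
  next
    case (3 a)
    then show ?case
      using that(1) klin_smult[OF kbilin_left[OF b]] by (auto simp: h_of)
  qed (simp add: h_zero that)
  let ?Q = "\<lambda>h. h \<in> extensional (carrier T) \<and> klin k T P h \<and>
        (\<forall>m\<in>carrier M. \<forall>n\<in>carrier N. h (bpure R ra la M N m n) = b m n)"
  \<comment> \<open>\<open>dec\<close> recovers the stored representative; by \<open>h_dec\<close>
    any other member of the coset gives the same value, so this is the map induced by
    \<open>h\<close> on the quotient.\<close>
  let ?h = "\<lambda>x\<in>carrier T. h (dec x)"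
  have Q: "?Q ?h"
  proof (intro conjI ballI)
    show "klin k T P ?h"
    proof (rule klinI; elim T_cases)
      fix x y p q
      assume p: "Poly_Mapping.keys p \<subseteq> carrier M \<times> carrier N" "x = cls p"
      then show "?h x \<in> carrier P" by (simp add: cls_closed h_dec h_closed)
      assume "Poly_Mapping.keys q \<subseteq> carrier M \<times> carrier N" "y = cls q"
      with p show "?h (x \<oplus>\<^bsub>T\<^esub> y) = ?h x \<oplus>\<^bsub>P\<^esub> ?h y"
        by (simp add: add_T cls_closed keys_add_closed h_dec h_add)
    next
      fix r x p
      assume "r \<in> carrier k" "Poly_Mapping.keys p \<subseteq> carrier M \<times> carrier N" "x = cls p"
      then show "?h (r \<odot>\<^bsub>T\<^esub> x) = r \<odot>\<^bsub>P\<^esub> ?h x"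
        by (simp add: smult_T cls_closed keys_scale h_dec h_scale)
    qed
    show "?h (bpure R ra la M N m n) = b m n" if "m \<in> carrier M" "n \<in> carrier N" for m n
      using that bpure_closed[OF that] by (simp add: bpure_def h_dec h_of keys_frag_of)
  qed simp
  moreover have "g = ?h" if "?Q g" for g
  proof (rule extensionalityI[of _ "carrier T"])
    show "g x = ?h x" if "x \<in> carrier T" for x
      using klin_T_ext[OF P _ _ _ that, of g ?h] \<open>?Q g\<close> Q by auto
  qed (use that in auto)
  ultimately have "?Q (THE h. ?Q h)"
    by (rule theI[of ?Q])
  then have *: "?Q (blift R ra la k M N P b)"
    unfolding blift_def .
  then show "blift R ra la k M N P b \<in> extensional (carrier T)"
    and "klin k T P (blift R ra la k M N P b)"
    and "m \<in> carrier M \<Longrightarrow> n \<in> carrier N \<Longrightarrow>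
      blift R ra la k M N P b (bpure R ra la M N m n) = b m n"
    by auto
qed

text \<open>Linearity in a parameter of the bilinear map, as opposed to linearity in the tensor it
  is applied to. For fixed parameters both sides of each law are linear in the tensor (for scalars
  by commutativity of \<open>k\<close>), so pure tensors decide.\<close>

lemma klin_blift_param:
  assumes X: "Module.module k X" and P: "Module.module k P"
    and b: "\<And>x. x \<in> carrier X \<Longrightarrow> kbilin k M N P (b x)"
    and bal: "\<And>x m r n. x \<in> carrier X \<Longrightarrow> m \<in> carrier M \<Longrightarrow> r \<in> R \<Longrightarrow> n \<in> carrier N \<Longrightarrow>
      b x (ra m r) n = b x m (la r n)"
    and lin: "\<And>m n. m \<in> carrier M \<Longrightarrow> n \<in> carrier N \<Longrightarrow> klin k X P (\<lambda>x. b x m n)"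
    and t: "t \<in> carrier T"
  shows "klin k X P (\<lambda>x. blift R ra la k M N P (b x) t)"
proof -
  interpret X: Module.module k X by (rule X)
  interpret P: Module.module k P by (rule P)
  note blift' = blift_klin[OF P b bal] blift_bpure[OF P b bal]
  show ?thesis
  proof (rule klinI)
    show "blift R ra la k M N P (b x) t \<in> carrier P" if "x \<in> carrier X" for x
      using klin_closed[OF blift'(1) t] that by blast
  next
    fix x y assume xy: "x \<in> carrier X" "y \<in> carrier X"
    let ?g = "\<lambda>t. blift R ra la k M N P (b x) t \<oplus>\<^bsub>P\<^esub> blift R ra la k M N P (b y) t"
    have "klin k T P ?g"
      using klin_closed[OF blift'(1)] klin_add[OF blift'(1)] klin_smult[OF blift'(1)] xy
      by (intro klinI) (simp_all add: P.M.add.m_assoc P.M.add.m_lcomm P.smult_r_distr)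
    then show "blift R ra la k M N P (b (x \<oplus>\<^bsub>X\<^esub> y)) t = ?g t"
      using xy by (rule_tac klin_T_ext[OF P blift'(1) _ _ t]) (simp_all add: blift' klin_add[OF lin])
  next
    fix r x assume rx: "r \<in> carrier k" "x \<in> carrier X"
    let ?g = "\<lambda>t. r \<odot>\<^bsub>P\<^esub> blift R ra la k M N P (b x) t"
    have "klin k T P ?g"
      using klin_closed[OF blift'(1)] klin_add[OF blift'(1)] klin_smult[OF blift'(1)] rx
      by (intro klinI)
        (simp_all add: P.smult_r_distr M.R.m_comm flip: P.smult_assoc1)
    then show "blift R ra la k M N P (b (r \<odot>\<^bsub>X\<^esub> x)) t = ?g t"
      using rx by (rule_tac klin_T_ext[OF P blift'(1) _ _ t]) (simp_all add: blift' klin_smult[OF lin])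
  qed
qed

end

section \<open>Linearity of expressions in Sweedler notation\<close>

lemma btensor_cong:
  assumes "carrier M = carrier M'" "add M = add M'" "smult M = smult M'"
    and "carrier N = carrier N'" "add N = add N'"
  shows "btensor R ra la M N = btensor R ra la M' N'"
    and "bpure R ra la M N = bpure R ra la M' N'"
proof -
  have "bclass R ra la M N = bclass R ra la M' N'"
    by (intro ext) (simp add: bclass_def relators_def assms)
  then show "btensor R ra la M N = btensor R ra la M' N'"
    and "bpure R ra la M N = bpure R ra la M' N'"
    by (simp_all add: btensor_def bpure_def assms fun_eq_iff)
qed

lemma klin_cong_modules:
  assumes "carrier M = carrier M'" "add M = add M'" "smult M = smult M'"
    and "carrier N = carrier N'" "add N = add N'" "smult N = smult N'"
  shows "klin k M N = klin k M' N'"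
  by (simp add: klin_def assms fun_eq_iff)

lemma blift_cong_modules:
  assumes "carrier M = carrier M'" "add M = add M'" "smult M = smult M'"
    and "carrier N = carrier N'" "add N = add N'"
    and "carrier P = carrier P'" "add P = add P'" "smult P = smult P'"
  shows "blift R ra la k M N P = blift R ra la k M' N' P'"
  unfolding blift_def btensor_cong[OF assms(1-5)] assms(1,4)
    klin_cong_modules[OF refl refl refl assms(6-8)]
  by simp

lemma module_cong:
  assumes "Module.module k M" "carrier M = carrier M'" "add M = add M'" "smult M = smult M'"
    "ring.zero M = ring.zero M'"
  shows "Module.module k M'"
proof -
  interpret M: Module.module k M by (rule assms(1))
  note eqs = assms(2-5)[symmetric]
  show ?thesis
  proof (rule moduleI)
    show "abelian_group M'"
    proof (rule abelian_groupI)
      show "\<exists>y\<in>carrier M'. y \<oplus>\<^bsub>M'\<^esub> x = \<zero>\<^bsub>M'\<^esub>" if "x \<in> carrier M'" for x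
        using that by (auto simp: eqs intro!: bexI[of _ "\<ominus>\<^bsub>M\<^esub> x"] M.M.l_neg)
    qed (simp_all add: eqs M.M.a_ac)
  qed (simp_all add: eqs M.R.is_cring M.smult_l_distr M.smult_r_distr M.smult_assoc1)
qed

lemma with_act_simps [simp]:
  "carrier (with_act M f) = carrier M" "add (with_act M f) = add M"
  "smult (with_act M f) = smult M" "ring.zero (with_act M f) = ring.zero M"
  "act (with_act M f) = f"
  by (simp_all add: with_act_def)

lemma module_with_act [simp]: "Module.module k (with_act M f) \<longleftrightarrow> Module.module k M"
  by (auto elim: module_cong)

lemma klin_with_act [simp]:
  "klin k (with_act M f) N = klin k M N" "klin k M (with_act N f) = klin k M N"
  by (rule klin_cong_modules; simp)+

lemma kbilin_with_act [simp]:
  "kbilin k (with_act M f) N P = kbilin k M N P"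
  "kbilin k M (with_act N f) P = kbilin k M N P"
  "kbilin k M N (with_act P f) = kbilin k M N P"
  by (simp_all add: kbilin_def fun_eq_iff)

lemma btensor_with_act [simp]:
  "btensor R ra la (with_act M f) N = btensor R ra la M N"
  "btensor R ra la M (with_act N f) = btensor R ra la M N"
  "bpure R ra la (with_act M f) N = bpure R ra la M N"
  "bpure R ra la M (with_act N f) = bpure R ra la M N"
  "blift R ra la k (with_act M f) N P = blift R ra la k M N P"
  "blift R ra la k M (with_act N f) P = blift R ra la k M N P"
  "blift R ra la k M N (with_act P f) = blift R ra la k M N P"
  by (rule btensor_cong blift_cong_modules; simp)+

lemma tensor_with_act [simp]:
  "tensor k (with_act M f) N = tensor k M N"
  "tensor k M (with_act N f) = tensor k M N"
  "tpure k (with_act M f) N = tpure k M N"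
  "tpure k M (with_act N f) = tpure k M N"
  "tlift k (with_act M f) N P = tlift k M N P"
  "tlift k M (with_act N f) P = tlift k M N P"
  "tlift k M N (with_act P f) = tlift k M N P"
  by (simp_all add: tensor_def tpure_def tlift_def fun_eq_iff)

lemma tmap_with_act [simp]:
  "tmap k (with_act M f) N M' N' = tmap k M N M' N'"
  "tmap k M (with_act N f) M' N' = tmap k M N M' N'"
  "tmap k M N (with_act M' f) N' = tmap k M N M' N'"
  "tmap k M N M' (with_act N' f) = tmap k M N M' N'"
  "tassoc k (with_act M f) N P = tassoc k M N P"
  "tassoc k M (with_act N f) P = tassoc k M N P"
  "tassoc k M N (with_act P f) = tassoc k M N P"
  "tassoc_inv k (with_act M f) N P = tassoc_inv k M N P"
  "tassoc_inv k M (with_act N f) P = tassoc_inv k M N P"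
  "tassoc_inv k M N (with_act P f) = tassoc_inv k M N P"
  "tlunit k (with_act M f) = tlunit k M"
  "trunit k (with_act M f) = trunit k M"
  by (simp_all add: tmap_def tassoc_def tassoc_inv_def tlunit_def trunit_def fun_eq_iff)

lemma ground_simps [simp]:
  "carrier (ground k) = carrier k" "add (ground k) = add k" "smult (ground k) = mult k"
  "ring.zero (ground k) = ring.zero k" "mult (ground k) = mult k" "one (ground k) = one k"
  by (simp_all add: ground_def)

lemma blift_cong:
  assumes "\<And>m n. m \<in> carrier M \<Longrightarrow> n \<in> carrier N \<Longrightarrow> b m n = b' m n"
  shows "blift R ra la k M N P b = blift R ra la k M N P b'"
  unfolding blift_def using assms by (metis (no_types, lifting))

lemma tmap_cong:
  assumes "\<And>m. m \<in> carrier M \<Longrightarrow> f m = f' m" "\<And>n. n \<in> carrier N \<Longrightarrow> g n = g' n"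
  shows "tmap k M N M' N' f g = tmap k M N M' N' f' g'"
  unfolding tmap_def tlift_def using assms by (intro blift_cong) simp

lemma tmap_restrict [simp]:
  "tmap k M N M' N' (\<lambda>x\<in>carrier M. x) g = tmap k M N M' N' (\<lambda>x. x) g"
  "tmap k M N M' N' f (\<lambda>x\<in>carrier N. x) = tmap k M N M' N' f (\<lambda>x. x)"
  by (rule tmap_cong; simp)+

text \<open>Composites in the module categories are restricted to the carrier, so an equation
  between two of them is a pointwise equation there.\<close>

lemma compose_eq_iff: "compose S g f = compose S g' f' \<longleftrightarrow> (\<forall>x\<in>S. g (f x) = g' (f' x))"
  by (auto simp: compose_def restrict_def fun_eq_iff)

lemma compose_eq_ext_iff:
  assumes "h \<in> extensional S"
  shows "compose S g f = h \<longleftrightarrow> (\<forall>x\<in>S. g (f x) = h x)"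
  using assms by (auto simp: compose_def restrict_def fun_eq_iff extensional_def)

text \<open>Normal form: for all linear constructions a tensor product with diagonal action is the
  bare tensor product, so that nested terms agree syntactically. The same is done for induced
  modules and the unit object below.\<close>

lemma act_tensor_simps [simp]:
  "carrier (act_tensor k B B' \<delta> V W) = carrier (tensor k V W)"
  "add (act_tensor k B B' \<delta> V W) = add (tensor k V W)"
  "smult (act_tensor k B B' \<delta> V W) = smult (tensor k V W)"
  "Module.module k (act_tensor k B B' \<delta> V W) \<longleftrightarrow> Module.module k (tensor k V W)"
  "klin k (act_tensor k B B' \<delta> V W) = klin k (tensor k V W)"
  "klin k X (act_tensor k B B' \<delta> V W) = klin k X (tensor k V W)"
  "kbilin k X (act_tensor k B B' \<delta> V W) P = kbilin k X (tensor k V W) P"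
  "tensor k (act_tensor k B B' \<delta> V W) X = tensor k (tensor k V W) X"
  "tensor k X (act_tensor k B B' \<delta> V W) = tensor k X (tensor k V W)"
  "tpure k (act_tensor k B B' \<delta> V W) X = tpure k (tensor k V W) X"
  "tpure k X (act_tensor k B B' \<delta> V W) = tpure k X (tensor k V W)"
  "tmap k (act_tensor k B B' \<delta> V W) X = tmap k (tensor k V W) X"
  "tmap k X (act_tensor k B B' \<delta> V W) = tmap k X (tensor k V W)"
  "tmap k X Y (act_tensor k B B' \<delta> V W) = tmap k X Y (tensor k V W)"
  "tmap k X Y Z (act_tensor k B B' \<delta> V W) = tmap k X Y Z (tensor k V W)"
  "tassoc_inv k (act_tensor k B B' \<delta> V W) = tassoc_inv k (tensor k V W)"
  "tassoc_inv k X (act_tensor k B B' \<delta> V W) = tassoc_inv k X (tensor k V W)"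
  "tassoc_inv k X Y (act_tensor k B B' \<delta> V W) = tassoc_inv k X Y (tensor k V W)"
  by (simp_all add: act_tensor_def fun_eq_iff)

lemma ind_mod_simps [simp]:
  "carrier (ind_mod k H C V) = carrier (htensor H C V)"
  "tensor k (ind_mod k H C V) X = tensor k (htensor H C V) X"
  "tensor k X (ind_mod k H C V) = tensor k X (htensor H C V)"
  "tmap k (ind_mod k H C V) X = tmap k (htensor H C V) X"
  "tmap k X (ind_mod k H C V) = tmap k X (htensor H C V)"
  "tmap k X Y (ind_mod k H C V) = tmap k X Y (htensor H C V)"
  "tmap k X Y Z (ind_mod k H C V) = tmap k X Y Z (htensor H C V)"
  "tassoc_inv k (ind_mod k H C V) = tassoc_inv k (htensor H C V)"
  "tassoc_inv k X (ind_mod k H C V) = tassoc_inv k X (htensor H C V)"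
  "tassoc_inv k X Y (ind_mod k H C V) = tassoc_inv k X Y (htensor H C V)"
  by (simp_all add: ind_mod_def fun_eq_iff)

lemma triv_mod_simps [simp]:
  "carrier (triv_mod k H) = carrier k"
  "smult (triv_mod k H) = mult k"
  "Module.module k (triv_mod k H) \<longleftrightarrow> Module.module k (ground k)"
  "klin k (triv_mod k H) = klin k (ground k)"
  "klin k X (triv_mod k H) = klin k X (ground k)"
  "kbilin k X (triv_mod k H) P = kbilin k X (ground k) P"
  "tensor k (triv_mod k H) X = tensor k (ground k) X"
  "tensor k X (triv_mod k H) = tensor k X (ground k)"
  "tpure k (triv_mod k H) X = tpure k (ground k) X"
  "tmap k (triv_mod k H) X = tmap k (ground k) X"
  "tmap k X (triv_mod k H) = tmap k X (ground k)"
  "tmap k X Y (triv_mod k H) = tmap k X Y (ground k)"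
  "tmap k X Y Z (triv_mod k H) = tmap k X Y Z (ground k)"
  "act (triv_mod k H) h r = counit H h \<otimes>\<^bsub>k\<^esub> r"
  by (simp_all add: triv_mod_def fun_eq_iff)

lemma tensor_coalg_simps [simp]:
  "carrier (tensor_coalg k C D) = carrier (tensor k C D)"
  "add (tensor_coalg k C D) = add (tensor k C D)"
  "smult (tensor_coalg k C D) = smult (tensor k C D)"
  by (simp_all add: tensor_coalg_def Let_def)

lemma tmap_tensor_coalg [simp]:
  "tmap k (tensor_coalg k C D) (tensor_coalg k C D) M N = tmap k (tensor k C D) (tensor k C D) M N"
proof -
  have "blift R ra la k (tensor_coalg k C D) (tensor_coalg k C D) P =
      blift R ra la k (tensor k C D) (tensor k C D) P"
    for R :: "'a set" and ra la and P :: "('a,'a) module"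
    by (rule blift_cong_modules) simp_all
  then show ?thesis
    by (simp add: tmap_def tlift_def fun_eq_iff)
qed

lemma act_act_tensor:
  "act (act_tensor k B B' \<delta> V W) a t =
    tlift k B B' (tensor k V W) (\<lambda>b b'. tmap k V W V W (act V b) (act W b') t) (\<delta> a)"
  by (simp add: act_tensor_def)

lemma Eob_ind_functor [simp]: "Eob (ind_functor k H C) = ind_mod k H C"
  by (simp add: ind_functor_def)

section \<open>Linear calculus of tensor products over the ground ring\<close>

context tensor_universe
begin

interpretation k: cring k by (rule cring)

lemma module_ground [simp]: "Module.module k (ground k)"
proof (rule moduleI[OF cring])
  show "abelian_group (ground k)"
  proof (rule abelian_groupI)
    show "\<exists>y\<in>carrier (ground k). y \<oplus>\<^bsub>ground k\<^esub> x = \<zero>\<^bsub>ground k\<^esub>" if "x \<in> carrier (ground k)" for x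
      using that by (auto intro!: bexI[of _ "\<ominus>\<^bsub>k\<^esub> x"] k.l_neg)
  qed (simp_all add: k.a_ac)
qed (simp_all add: k.l_distr k.r_distr k.m_assoc)

lemma klin_ident: "klin k M M (\<lambda>x. x)"
  by (simp add: klinI)

lemma klin_comp: "klin k M N f \<Longrightarrow> klin k X M g \<Longrightarrow> klin k X N (\<lambda>x. f (g x))"
  by (simp add: klin_def Pi_iff)

lemma klin_cong:
  assumes eq: "\<And>x. x \<in> carrier M \<Longrightarrow> f x = g x" and "Module.module k M"
  shows "klin k M N f \<longleftrightarrow> klin k M N g"
proof -
  interpret M: Module.module k M by fact
  show ?thesis
    using eq by (simp add: klin_def Pi_iff)
qed

lemma klin_smult_fun:
  assumes "Module.module k M" "r \<in> carrier k" "klin k X M f"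
  shows "klin k X M (\<lambda>x. r \<odot>\<^bsub>M\<^esub> f x)"
proof -
  interpret M: Module.module k M by fact
  show ?thesis
    using assms(2,3)
    by (intro klinI) (simp_all add: klin_closed klin_add klin_smult M.smult_r_distr k.m_comm flip: M.smult_assoc1)
qed

lemma klin_fun_smult:
  assumes "Module.module k M" "m \<in> carrier M" "klin k X (ground k) f"
  shows "klin k X M (\<lambda>x. f x \<odot>\<^bsub>M\<^esub> m)"
proof -
  interpret M: Module.module k M by fact
  have "f x \<in> carrier k" if "x \<in> carrier X" for x
    using klin_closed[OF assms(3)] that by simp
  then show ?thesis
    using assms(2) klin_add[OF assms(3)] klin_smult[OF assms(3)]
    by (intro klinI) (simp_all add: M.smult_l_distr M.smult_assoc1)
qed

lemma balanced_tensor: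
  assumes "Module.module k M" "Module.module k N"
  shows "balanced k (carrier k) (\<lambda>m r. r \<odot>\<^bsub>M\<^esub> m) (\<lambda>r n. r \<odot>\<^bsub>N\<^esub> n) M N"
proof -
  interpret M: Module.module k M by fact
  interpret N: Module.module k N by fact
  show ?thesis
    using infinite_universe cring assms klin_smult_fun[OF assms(1) _ klin_ident]
    by unfold_locales auto
qed

context
  fixes M :: "('u,'u,'x) module_scheme" and N :: "('u,'u,'y) module_scheme"
  assumes M: "Module.module k M" and N: "Module.module k N"
begin

interpretation balanced k "carrier k" "\<lambda>m r. r \<odot>\<^bsub>M\<^esub> m" "\<lambda>r n. r \<odot>\<^bsub>N\<^esub> n" M N
  by (rule balanced_tensor[OF M N])

lemma module_tensor: "Module.module k (tensor k M N)"
  unfolding tensor_def by (rule module_T)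

lemma tpure_closed: "m \<in> carrier M \<Longrightarrow> n \<in> carrier N \<Longrightarrow> tpure k M N m n \<in> carrier (tensor k M N)"
  unfolding tensor_def tpure_def by (rule bpure_closed)

text \<open>By construction scalars act on the left factor; they reach the right one through the
  balancing relation.\<close>

lemma kbilin_tpure: "kbilin k M N (tensor k M N) (tpure k M N)"
proof -
  interpret N: Module.module k N by (rule N)
  show ?thesis
    unfolding tensor_def tpure_def
    by (intro kbilinI klinI) (simp_all add: bpure_closed bpure_add_left bpure_add_right
        bpure_smult_left flip: bpure_balanced)
qed

lemma tensor_ext:
  assumes "Module.module k P" "klin k (tensor k M N) P f" "klin k (tensor k M N) P g"
    and "\<And>m n. m \<in> carrier M \<Longrightarrow> n \<in> carrier N \<Longrightarrow> f (tpure k M N m n) = g (tpure k M N m n)"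
    and "t \<in> carrier (tensor k M N)"
  shows "f t = g t"
  using assms unfolding tensor_def tpure_def by (rule klin_T_ext)

lemma
  assumes P: "Module.module k P" and b: "kbilin k M N P b"
  shows tlift_extensional: "tlift k M N P b \<in> extensional (carrier (tensor k M N))"
    and tlift_klin: "klin k (tensor k M N) P (tlift k M N P b)"
    and tlift_tpure: "m \<in> carrier M \<Longrightarrow> n \<in> carrier N \<Longrightarrow> tlift k M N P b (tpure k M N m n) = b m n"
proof -
  \<comment> \<open>A bilinear map is balanced over \<open>k\<close> by itself: both sides are the
    multiple of \<open>b m n\<close> by \<open>r\<close>.\<close>
  have "b (r \<odot>\<^bsub>M\<^esub> m) n = b m (r \<odot>\<^bsub>N\<^esub> n)" if "m \<in> carrier M" "r \<in> carrier k" "n \<in> carrier N" for m r n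
    using that klin_smult[OF kbilin_left[OF b]] klin_smult[OF kbilin_right[OF b]] by simp
  note * = blift[OF P b this]
  show "tlift k M N P b \<in> extensional (carrier (tensor k M N))"
    and "klin k (tensor k M N) P (tlift k M N P b)"
    and "m \<in> carrier M \<Longrightarrow> n \<in> carrier N \<Longrightarrow> tlift k M N P b (tpure k M N m n) = b m n"
    unfolding tlift_def tensor_def tpure_def using * by blast+
qed

lemma klin_tlift_param:
  assumes "Module.module k X" "Module.module k P"
    and b: "\<And>x. x \<in> carrier X \<Longrightarrow> kbilin k M N P (b x)"
    and "\<And>m n. m \<in> carrier M \<Longrightarrow> n \<in> carrier N \<Longrightarrow> klin k X P (\<lambda>x. b x m n)"
    and "t \<in> carrier (tensor k M N)"
  shows "klin k X P (\<lambda>x. tlift k M N P (b x) t)"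
proof -
  have "b x (r \<odot>\<^bsub>M\<^esub> m) n = b x m (r \<odot>\<^bsub>N\<^esub> n)"
    if "x \<in> carrier X" "m \<in> carrier M" "r \<in> carrier k" "n \<in> carrier N" for x m r n
    using that klin_smult[OF kbilin_left[OF b]] klin_smult[OF kbilin_right[OF b]] by simp
  from klin_blift_param[OF assms(1-3) this assms(4)] assms(5) show ?thesis
    unfolding tlift_def tensor_def by blast
qed

end

lemma klin_tpure_left:
  assumes "Module.module k M" "Module.module k N" "klin k X M f" "n \<in> carrier N"
  shows "klin k X (tensor k M N) (\<lambda>x. tpure k M N (f x) n)"
  using klin_comp[OF kbilin_left[OF kbilin_tpure] assms(3)] assms by blast

lemma klin_tpure_right:
  assumes "Module.module k M" "Module.module k N" "m \<in> carrier M" "klin k X N f"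
  shows "klin k X (tensor k M N) (\<lambda>x. tpure k M N m (f x))"
  using klin_comp[OF kbilin_right[OF kbilin_tpure] assms(4)] assms by blast

lemma tlift_closed:
  assumes "Module.module k M" "Module.module k N" "Module.module k P" "kbilin k M N P b"
    "t \<in> carrier (tensor k M N)"
  shows "tlift k M N P b t \<in> carrier P"
  using klin_closed[OF tlift_klin[OF assms(1-4)] assms(5)] .

lemma klin_tlift_arg:
  assumes "Module.module k M" "Module.module k N" "Module.module k P" "kbilin k M N P b"
    "klin k X (tensor k M N) f"
  shows "klin k X P (\<lambda>x. tlift k M N P b (f x))"
  using klin_comp[OF tlift_klin[OF assms(1-4)] assms(5)] .

text \<open>Rewriting with these rules decides linearity of iterated Sweedler expressions: each rule
  peels off one operation in the position where the variable occurs.\<close>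

lemmas tensor_rules = module_tensor tpure_closed tlift_closed tlift_tpure kbilinI klin_ident
  klin_tpure_left klin_tpure_right klin_tlift_arg klin_tlift_param klin_smult_fun klin_fun_smult
  module.smult_closed[of k]

lemma tmap_kbilin:
  assumes "Module.module k M'" "Module.module k N'" "klin k M M' f" "klin k N N' g"
  shows "kbilin k M N (tensor k M' N') (\<lambda>m n. tpure k M' N' (f m) (g n))"
  using assms by (auto intro!: kbilinI klin_tpure_left klin_tpure_right elim: klin_closed)

lemma
  assumes M: "Module.module k M" "Module.module k N" "Module.module k M'" "Module.module k N'"
    and fg: "klin k M M' f" "klin k N N' g"
  shows tmap_klin: "klin k (tensor k M N) (tensor k M' N') (tmap k M N M' N' f g)"
    and tmap_tpure: "m \<in> carrier M \<Longrightarrow> n \<in> carrier N \<Longrightarrow>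
      tmap k M N M' N' f g (tpure k M N m n) = tpure k M' N' (f m) (g n)"
  unfolding tmap_def
  using tlift_klin[OF M(1,2) module_tensor[OF M(3,4)] tmap_kbilin[OF M(3,4) fg]]
    tlift_tpure[OF M(1,2) module_tensor[OF M(3,4)] tmap_kbilin[OF M(3,4) fg]]
  by blast+

lemma tmap_closed:
  assumes "Module.module k M" "Module.module k N" "Module.module k M'" "Module.module k N'"
    and "klin k M M' f" "klin k N N' g" "t \<in> carrier (tensor k M N)"
  shows "tmap k M N M' N' f g t \<in> carrier (tensor k M' N')"
  using klin_closed[OF tmap_klin[OF assms(1-6)] assms(7)] .

lemma klin_tmap_arg:
  assumes "Module.module k M" "Module.module k N" "Module.module k M'" "Module.module k N'"
    and "klin k M M' f" "klin k N N' g" "klin k X (tensor k M N) h"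
  shows "klin k X (tensor k M' N') (\<lambda>x. tmap k M N M' N' f g (h x))"
  using klin_comp[OF tmap_klin[OF assms(1-6)] assms(7)] .

text \<open>The variable sits in the map and not in the tensor. This occurs in the Yetter-Drinfeld
  condition, where the acting elements run through a coaction.\<close>

lemma klin_tmap_param_left:
  assumes "Module.module k X"
    and "Module.module k M" "Module.module k N" "Module.module k M'" "Module.module k N'"
    and f: "\<And>x. x \<in> carrier X \<Longrightarrow> klin k M M' (f x)" "\<And>m. m \<in> carrier M \<Longrightarrow> klin k X M' (\<lambda>x. f x m)"
    and "klin k N N' g" "t \<in> carrier (tensor k M N)"
  shows "klin k X (tensor k M' N') (\<lambda>x. tmap k M N M' N' (f x) g t)"
  unfolding tmap_def using assms klin_closed[OF \<open>klin k N N' g\<close>]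
  by (intro klin_tlift_param tmap_kbilin klin_tpure_left) (simp_all add: module_tensor)

lemma klin_tmap_param_right:
  assumes "Module.module k X"
    and "Module.module k M" "Module.module k N" "Module.module k M'" "Module.module k N'"
    and "klin k M M' f" and g: "\<And>x. x \<in> carrier X \<Longrightarrow> klin k N N' (g x)"
      "\<And>n. n \<in> carrier N \<Longrightarrow> klin k X N' (\<lambda>x. g x n)"
    and "t \<in> carrier (tensor k M N)"
  shows "klin k X (tensor k M' N') (\<lambda>x. tmap k M N M' N' f (g x) t)"
  unfolding tmap_def using assms klin_closed[OF \<open>klin k M M' f\<close>]
  by (intro klin_tlift_param tmap_kbilin klin_tpure_right) (simp_all add: module_tensor)

lemmas tmap_rules = tmap_closed tmap_tpure klin_tmap_arg klin_tmap_param_left klin_tmap_param_right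

lemma tmap_ident:
  assumes "Module.module k M" "Module.module k N" "t \<in> carrier (tensor k M N)"
  shows "tmap k M N M N (\<lambda>x. x) (\<lambda>x. x) t = t"
  using assms(1,2) module_tensor[OF assms(1,2)] _ _ _ assms(3)
  by (rule tensor_ext) (simp_all add: assms(1,2) tensor_rules tmap_rules)

lemma tassoc_tassoc_inv:
  assumes "Module.module k X" "Module.module k Y" "Module.module k Z"
    "t \<in> carrier (tensor k X (tensor k Y Z))"
  shows "tassoc k X Y Z (tassoc_inv k X Y Z t) = t"
proof -
  note rules = tensor_rules assms(1-3)
  have *: "tassoc k X Y Z (tassoc_inv k X Y Z (tpure k X (tensor k Y Z) x s)) = tpure k X (tensor k Y Z) x s"
    if x: "x \<in> carrier X" and s: "s \<in> carrier (tensor k Y Z)" for x s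
    using assms(2,3) module_tensor[OF assms(1) module_tensor[OF assms(2,3)]] _ _ _ s
    by (rule tensor_ext) (simp_all add: x rules tassoc_def tassoc_inv_def)
  show ?thesis
    using assms(1) module_tensor[OF assms(2,3)] module_tensor[OF assms(1) module_tensor[OF assms(2,3)]] _ _ _ assms(4)
    by (rule tensor_ext) (simp_all add: *, simp_all add: tassoc_def tassoc_inv_def rules)
qed

lemma tassoc_inv_tassoc:
  assumes "Module.module k X" "Module.module k Y" "Module.module k Z"
    "t \<in> carrier (tensor k (tensor k X Y) Z)"
  shows "tassoc_inv k X Y Z (tassoc k X Y Z t) = t"
proof -
  note rules = tensor_rules assms(1-3)
  have *: "tassoc_inv k X Y Z (tassoc k X Y Z (tpure k (tensor k X Y) Z s z)) = tpure k (tensor k X Y) Z s z"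
    if z: "z \<in> carrier Z" and s: "s \<in> carrier (tensor k X Y)" for z s
    by (rule tensor_ext[OF _ _ _ _ _ _ s, where P = "tensor k (tensor k X Y) Z"])
      (simp_all add: z rules tassoc_def tassoc_inv_def)
  show ?thesis
    by (rule tensor_ext[OF _ _ _ _ _ _ assms(4), where P = "tensor k (tensor k X Y) Z"])
      (simp_all add: *, simp_all add: tassoc_def tassoc_inv_def rules)
qed

text \<open>The simplifier does not get \<open>kbilinI\<close> to apply to \<open>ground k\<close>, whose carrier it rewrites to
  \<open>carrier k\<close>; hence these variants.\<close>

lemma kbilin_ground:
  "(\<And>r. r \<in> carrier k \<Longrightarrow> klin k N P (b r)) \<Longrightarrow>
    (\<And>n. n \<in> carrier N \<Longrightarrow> klin k (ground k) P (\<lambda>r. b r n)) \<Longrightarrow> kbilin k (ground k) N P b"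
  "(\<And>m. m \<in> carrier M \<Longrightarrow> klin k (ground k) P (b m)) \<Longrightarrow>
    (\<And>r. r \<in> carrier k \<Longrightarrow> klin k M P (\<lambda>m. b m r)) \<Longrightarrow> kbilin k M (ground k) P b"
  by (simp_all add: kbilin_def)

lemma
  assumes M: "Module.module k X" "Module.module k Y" "Module.module k Z"
  shows tassoc_closed: "t \<in> carrier (tensor k (tensor k X Y) Z) \<Longrightarrow>
      tassoc k X Y Z t \<in> carrier (tensor k X (tensor k Y Z))"
    and tassoc_tpure: "x \<in> carrier X \<Longrightarrow> y \<in> carrier Y \<Longrightarrow> z \<in> carrier Z \<Longrightarrow>
      tassoc k X Y Z (tpure k (tensor k X Y) Z (tpure k X Y x y) z) =
      tpure k X (tensor k Y Z) x (tpure k Y Z y z)"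
    and klin_tassoc: "klin k W (tensor k (tensor k X Y) Z) f \<Longrightarrow>
      klin k W (tensor k X (tensor k Y Z)) (\<lambda>w. tassoc k X Y Z (f w))"
    and tassoc_inv_closed: "t \<in> carrier (tensor k X (tensor k Y Z)) \<Longrightarrow>
      tassoc_inv k X Y Z t \<in> carrier (tensor k (tensor k X Y) Z)"
    and tassoc_inv_tpure: "x \<in> carrier X \<Longrightarrow> y \<in> carrier Y \<Longrightarrow> z \<in> carrier Z \<Longrightarrow>
      tassoc_inv k X Y Z (tpure k X (tensor k Y Z) x (tpure k Y Z y z)) =
      tpure k (tensor k X Y) Z (tpure k X Y x y) z"
    and klin_tassoc_inv: "klin k W (tensor k X (tensor k Y Z)) f \<Longrightarrow>
      klin k W (tensor k (tensor k X Y) Z) (\<lambda>w. tassoc_inv k X Y Z (f w))"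
  by (simp_all add: tassoc_def tassoc_inv_def tensor_rules M)

end

section \<open>Yetter-Drinfeld data\<close>

text \<open>The case in which the functors change only the objects and are the identity on
  morphisms, the Hom sets being literally equal. The category axioms of \<open>C\<close> are then
  inherited from \<open>D\<close> and have to be checked on one side only.\<close>

lemma isomorphic_categoriesI:
  assumes D: "category D"
    and F: "\<And>X. X \<in> Ob C \<Longrightarrow> F X \<in> Ob D" and G: "\<And>Y. Y \<in> Ob D \<Longrightarrow> G Y \<in> Ob C"
    and GF: "\<And>X. X \<in> Ob C \<Longrightarrow> G (F X) = X" and FG: "\<And>Y. Y \<in> Ob D \<Longrightarrow> F (G Y) = Y"
    and Hom: "\<And>X Y. X \<in> Ob C \<Longrightarrow> Y \<in> Ob C \<Longrightarrow> Hom C X Y = Hom D (F X) (F Y)"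
    and Id: "\<And>X. X \<in> Ob C \<Longrightarrow> Id C X = Id D (F X)"
    and Comp: "\<And>X Y Z g f. X \<in> Ob C \<Longrightarrow> Y \<in> Ob C \<Longrightarrow> Z \<in> Ob C \<Longrightarrow>
      Comp C X Y Z g f = Comp D (F X) (F Y) (F Z) g f"
  shows "isomorphic_categories C D"
proof -
  have "category C"
    using D unfolding category_def by (simp add: F Hom Id Comp)
  moreover have "is_functor C D F (\<lambda>_ _ f. f)"
    unfolding is_functor_def by (simp add: F Hom Id Comp)
  moreover have "is_functor D C G (\<lambda>_ _ f. f)"
    unfolding is_functor_def by (simp add: F G FG Hom Id Comp)
  ultimately show ?thesis
    unfolding isomorphic_categories_def using D GF FG by fastforce
qed

section \<open>Structure maps of the datum and the H-modules it provides\<close>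

locale yd = tensor_universe k for k :: "'u ring" +
  fixes H K :: "'u coalg" and A :: "'u bicomod_alg" and C :: "'u bimod_coalg"
  assumes datum: "yd_datum k H K A C"
begin

interpretation k: cring k by (rule cring)

lemma datum':
  "k_algebra k H" "coalgebra k H" "algebra_map k H (tensor_alg k H H) (comul H)"
  "algebra_map k H (ground k) (counit H)" "k_algebra k K" "bicomodule_algebra k H K A"
  "bimodule_coalgebra k K H C"
  using datum by (simp_all add: yd_datum_def bialgebra_def)

lemma modules [simp]:
  "Module.module k H" "Module.module k K" "Module.module k A" "Module.module k C"
  using datum' by (simp_all add: k_algebra_def bicomodule_algebra_def bimodule_coalgebra_def
      coalgebra_def)

interpretation H: Ring.ring H using datum'(1) by (simp add: k_algebra_def)

lemma structure_klin:
  "klin k H (tensor k H H) (comul H)" "klin k H (ground k) (counit H)"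
  "klin k A (tensor k H A) (lcoact A)" "klin k A (tensor k A K) (rcoact A)"
  "klin k C (tensor k C C) (comul C)" "klin k C (ground k) (counit C)"
  using datum' by (simp_all add: bicomodule_algebra_def bimodule_coalgebra_def coalgebra_def
      left_comodule_def right_comodule_def)

lemma H_kbilin: "kbilin k H H H (mult H)"
  using datum'(1)
  by (intro kbilinI klinI) (auto simp: k_algebra_def H.l_distr H.r_distr)

lemma C_kbilin: "kbilin k K C C (lact C)" "kbilin k C H C (ract C)"
  using datum' by (auto simp: bimodule_coalgebra_def left_module_def right_action_def)

lemmas datum_closed = klin_closed[OF structure_klin(1)] klin_closed[OF structure_klin(2), simplified]
  klin_closed[OF structure_klin(3)] klin_closed[OF structure_klin(4)]
  klin_closed[OF structure_klin(5)] klin_closed[OF structure_klin(6), simplified]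
  kbilin_closed[OF H_kbilin] kbilin_closed[OF C_kbilin(1)] kbilin_closed[OF C_kbilin(2)]
  H.one_closed

lemmas datum_klin = structure_klin[THEN klin_comp]
  klin_comp[OF kbilin_left[OF H_kbilin]] klin_comp[OF kbilin_right[OF H_kbilin]]
  klin_comp[OF kbilin_left[OF C_kbilin(1)]] klin_comp[OF kbilin_right[OF C_kbilin(1)]]
  klin_comp[OF kbilin_left[OF C_kbilin(2)]] klin_comp[OF kbilin_right[OF C_kbilin(2)]]

lemmas rules = tensor_rules tmap_rules datum_closed datum_klin

lemma ground_klin:
  "r \<in> carrier k \<Longrightarrow> klin k X (ground k) f \<Longrightarrow> klin k X (ground k) (\<lambda>x. r \<otimes>\<^bsub>k\<^esub> f x)"
  "r \<in> carrier k \<Longrightarrow> klin k X (ground k) f \<Longrightarrow> klin k X (ground k) (\<lambda>x. f x \<otimes>\<^bsub>k\<^esub> r)"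
  using klin_smult_fun[of "ground k"] klin_fun_smult[of "ground k"] by simp_all

lemma comul_H_mult:
  assumes "g \<in> carrier H" "h \<in> carrier H"
  shows "comul H (g \<otimes>\<^bsub>H\<^esub> h) =
    tlift k H H (tensor k H H) (\<lambda>a b. tlift k H H (tensor k H H)
      (\<lambda>a' b'. tpure k H H (a \<otimes>\<^bsub>H\<^esub> a') (b \<otimes>\<^bsub>H\<^esub> b')) (comul H h)) (comul H g)"
  using datum'(3) assms by (auto simp: algebra_map_def ring_hom_def tensor_alg_def)

lemma comul_H_one: "comul H \<one>\<^bsub>H\<^esub> = tpure k H H \<one>\<^bsub>H\<^esub> \<one>\<^bsub>H\<^esub>"
  using datum'(3) by (auto simp: algebra_map_def ring_hom_def tensor_alg_def)

lemma counit_H: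
  shows counit_H_one: "counit H \<one>\<^bsub>H\<^esub> = \<one>\<^bsub>k\<^esub>"
    and counit_H_mult: "g \<in> carrier H \<Longrightarrow> h \<in> carrier H \<Longrightarrow>
      counit H (g \<otimes>\<^bsub>H\<^esub> h) = counit H g \<otimes>\<^bsub>k\<^esub> counit H h"
  using datum'(4) by (auto simp: algebra_map_def ring_hom_def)

lemma ract:
  assumes "c \<in> carrier C"
  shows ract_one: "ract C c \<one>\<^bsub>H\<^esub> = c"
    and ract_mult: "g \<in> carrier H \<Longrightarrow> h \<in> carrier H \<Longrightarrow> ract C c (g \<otimes>\<^bsub>H\<^esub> h) = ract C (ract C c g) h"
    and ract_lact: "x \<in> carrier K \<Longrightarrow> h \<in> carrier H \<Longrightarrow> ract C (lact C x c) h = lact C x (ract C c h)"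
  using datum'(7) assms by (auto simp: bimodule_coalgebra_def right_action_def)

text \<open>The requirement that C (x) H -> C be a coalgebra map, evaluated at c (x) h. The first
  formula makes \<open>psi\<close> well defined on C (x)_H (V (x) W), the second does the same for
  \<open>psi0\<close>.\<close>

lemma
  assumes c: "c \<in> carrier C" and h: "h \<in> carrier H"
  shows comul_ract: "comul C (ract C c h) = tlift k C C (tensor k C C) (\<lambda>c1 c2.
      tlift k H H (tensor k C C) (\<lambda>h1 h2. tpure k C C (ract C c1 h1) (ract C c2 h2)) (comul H h))
      (comul C c)"
    and counit_ract: "counit C (ract C c h) = counit C c \<otimes>\<^bsub>k\<^esub> counit H h"
proof -
  let ?T = "tensor k C H" and ?f = "tlift k C H C (ract C)"
  have f: "?f (tpure k C H d g) = ract C d g" if "d \<in> carrier C" "g \<in> carrier H" for d g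
    using that by (simp add: tlift_tpure C_kbilin)
  have fk: "klin k (tensor k C H) C ?f"
    by (rule tlift_klin) (simp_all add: C_kbilin)
  have map: "coalgebra_map k (tensor_coalg k C H) C ?f"
    using datum'(7) by (simp add: bimodule_coalgebra_def)
  have "comul C (?f t) = tmap k ?T ?T C C ?f ?f (comul (tensor_coalg k C H) t)"
    and counit: "counit C (?f t) = counit (tensor_coalg k C H) t" if "t \<in> carrier ?T" for t
    using map that by (simp_all add: coalgebra_map_def)
  from this(1)[of "tpure k C H c h"] have "comul C (ract C c h) = tmap k ?T ?T C C ?f ?f
      (tlift k C C (tensor k ?T ?T)
          (\<lambda>c1 c2. tlift k H H (tensor k ?T ?T)
            (\<lambda>d1 d2. tpure k ?T ?T (tpure k C H c1 d1) (tpure k C H c2 d2)) (comul H h)) (comul C c))"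
    using c h by (simp add: f tensor_coalg_def Let_def rules)
  also have "\<dots> = tlift k C C (tensor k C C) (\<lambda>c1 c2.
      tlift k H H (tensor k C C) (\<lambda>h1 h2. tpure k C C (ract C c1 h1) (ract C c2 h2)) (comul H h))
      (comul C c)" (is "?l (comul H h) (comul C c) = ?r (comul H h) (comul C c)")
  proof -
    \<comment> \<open>The coproducts of h and c are replaced by arbitrary tensors \<open>s\<close>
      and \<open>t\<close>; both sides are linear in each of them.\<close>
    have "?l s t = ?r s t" if s: "s \<in> carrier (tensor k H H)" and t: "t \<in> carrier (tensor k C C)" for s t
    proof (rule tensor_ext[OF _ _ _ _ _ _ t, where P = "tensor k C C"])
      fix c1 c2 assume cc: "c1 \<in> carrier C" "c2 \<in> carrier C"
      show "?l s (tpure k C C c1 c2) = ?r s (tpure k C C c1 c2)"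
        by (rule tensor_ext[OF _ _ _ _ _ _ s, where P = "tensor k C C"])
          (simp_all add: rules cc f fk klin_comp[OF fk])
    qed (simp_all add: rules s f fk klin_comp[OF fk])
    then show ?thesis using c h by (simp add: rules)
  qed
  finally show "comul C (ract C c h) = tlift k C C (tensor k C C) (\<lambda>c1 c2.
      tlift k H H (tensor k C C) (\<lambda>h1 h2. tpure k C C (ract C c1 h1) (ract C c2 h2)) (comul H h))
      (comul C c)" .
  show "counit C (ract C c h) = counit C c \<otimes>\<^bsub>k\<^esub> counit H h"
    using counit[of "tpure k C H c h"] c h by (simp add: f tensor_coalg_def Let_def rules ground_klin)
qed

lemma left_module_reg: "left_module k H (with_act H (mult H))"
  by (auto simp: left_module_def H_kbilin H.m_assoc)

text \<open>H acts on the unit object through its counit, which is unital and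
  multiplicative.\<close>

lemma left_module_triv: "left_module k H (triv_mod k H)"
  by (simp add: left_module_def rules ground_klin k.m_assoc counit_H_mult counit_H_one
      kbilin_def del: kbilinI triv_mod_simps(10)) (simp add: triv_mod_def rules ground_klin)

lemma
  assumes "left_module k B V"
  shows left_module_module: "Module.module k V"
    and act_closed: "b \<in> carrier B \<Longrightarrow> v \<in> carrier V \<Longrightarrow> act V b v \<in> carrier V"
    and klin_act_left: "v \<in> carrier V \<Longrightarrow> klin k X B f \<Longrightarrow> klin k X V (\<lambda>x. act V (f x) v)"
    and klin_act_right: "b \<in> carrier B \<Longrightarrow> klin k X V f \<Longrightarrow> klin k X V (\<lambda>x. act V b (f x))"
    and act_one: "v \<in> carrier V \<Longrightarrow> act V \<one>\<^bsub>B\<^esub> v = v"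
    and act_mult: "b \<in> carrier B \<Longrightarrow> b' \<in> carrier B \<Longrightarrow> v \<in> carrier V \<Longrightarrow>
      act V (b \<otimes>\<^bsub>B\<^esub> b') v = act V b (act V b' v)"
proof -
  have V: "kbilin k B V V (act V)"
    using assms by (simp add: left_module_def)
  show "Module.module k V"
    and "v \<in> carrier V \<Longrightarrow> act V \<one>\<^bsub>B\<^esub> v = v"
    and "b \<in> carrier B \<Longrightarrow> b' \<in> carrier B \<Longrightarrow> v \<in> carrier V \<Longrightarrow>
      act V (b \<otimes>\<^bsub>B\<^esub> b') v = act V b (act V b' v)"
    using assms by (auto simp: left_module_def)
  show "b \<in> carrier B \<Longrightarrow> v \<in> carrier V \<Longrightarrow> act V b v \<in> carrier V"
    by (rule kbilin_closed[OF V])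
  show "v \<in> carrier V \<Longrightarrow> klin k X B f \<Longrightarrow> klin k X V (\<lambda>x. act V (f x) v)"
    by (rule klin_comp[OF kbilin_left[OF V]])
  show "b \<in> carrier B \<Longrightarrow> klin k X V f \<Longrightarrow> klin k X V (\<lambda>x. act V b (f x))"
    by (rule klin_comp[OF kbilin_right[OF V]])
qed

lemmas act_rules = left_module_module act_closed klin_act_left klin_act_right act_one act_mult

text \<open>The coproduct of H is an algebra map to H (x) H, and H (x) H acts on V (x) W factor by
  factor.\<close>

lemma left_module_tensor:
  assumes V: "left_module k H V" and W: "left_module k H W"
  shows "left_module k H (act_tensor k H H (comul H) V W)"
proof -
  let ?T = "tensor k V W"
  let ?a = "\<lambda>s t. tlift k H H (tensor k V W) (\<lambda>b b'. tmap k V W V W (act V b) (act W b') t) s"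
  note r = rules act_rules[OF V] act_rules[OF W]
  \<comment> \<open>Associativity with both coproducts and the acted-on element free; each of the
    three tensors is then reduced to pure ones.\<close>
  have mult: "?a (tlift k H H (tensor k H H) (\<lambda>a b. tlift k H H (tensor k H H)
      (\<lambda>a' b'. tpure k H H (a \<otimes>\<^bsub>H\<^esub> a') (b \<otimes>\<^bsub>H\<^esub> b')) s') s) t = ?a s (?a s' t)"
    (is "?l s s' t = ?r s s' t")
    if s: "s \<in> carrier (tensor k H H)" "s' \<in> carrier (tensor k H H)" and t: "t \<in> carrier ?T" for s s' t
  proof (rule tensor_ext[OF _ _ _ _ _ _ s(1), where P = ?T])
    fix a b assume ab: "a \<in> carrier H" "b \<in> carrier H"
    show "?l (tpure k H H a b) s' t = ?r (tpure k H H a b) s' t"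
    proof (rule tensor_ext[OF _ _ _ _ _ _ s(2), where P = ?T])
      fix a' b' assume ab': "a' \<in> carrier H" "b' \<in> carrier H"
      show "?l (tpure k H H a b) (tpure k H H a' b') t = ?r (tpure k H H a b) (tpure k H H a' b') t"
        by (rule tensor_ext[OF _ _ _ _ _ _ t, where P = ?T]) (simp_all add: r ab ab')
    qed (simp_all add: r ab s t)
  qed (simp_all add: r s t)
  have one: "tmap k V W V W (act V \<one>\<^bsub>H\<^esub>) (act W \<one>\<^bsub>H\<^esub>) t = t" if t: "t \<in> carrier ?T" for t
    by (rule tensor_ext[OF _ _ _ _ _ _ t, where P = ?T]) (simp_all add: r)
  show ?thesis
    by (simp add: left_module_def act_tensor_def r mult one comul_H_mult comul_H_one)
qed

subsection \<open>The op-monoidal functor\<close>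

context
  fixes V :: "'u lmod"
  assumes V: "left_module k H V"
begin

lemma balanced_htensor: "balanced k (carrier H) (ract C) (act V) C V"
  by (intro balanced.intro balanced_axioms.intro tensor_universe_axioms modules
      left_module_module[OF V] kbilin_left[OF C_kbilin(2)] act_closed[OF V])

interpretation balanced k "carrier H" "ract C" "act V" C V
  by (rule balanced_htensor)

lemma module_htensor: "Module.module k (htensor H C V)"
  unfolding htensor_def by (rule module_T)

lemma hpure_closed: "c \<in> carrier C \<Longrightarrow> v \<in> carrier V \<Longrightarrow> hpure H C V c v \<in> carrier (htensor H C V)"
  unfolding htensor_def hpure_def by (rule bpure_closed)

lemma hpure_ract:
  "c \<in> carrier C \<Longrightarrow> h \<in> carrier H \<Longrightarrow> v \<in> carrier V \<Longrightarrow>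
    hpure H C V (ract C c h) v = hpure H C V c (act V h v)"
  unfolding hpure_def by (rule bpure_balanced)

text \<open>In the right slot a scalar r has to cross the tensor sign, which only elements of H may
  do. It crosses as r 1_H, which acts on V and on C as r.\<close>

lemma kbilin_hpure: "kbilin k C V (htensor H C V) (hpure H C V)"
proof -
  interpret V: Module.module k V by (rule module_N)
  have "hpure H C V c (r \<odot>\<^bsub>V\<^esub> v) = r \<odot>\<^bsub>htensor H C V\<^esub> hpure H C V c v"
    if "c \<in> carrier C" "r \<in> carrier k" "v \<in> carrier V" for c r v
  proof -
    have rh: "r \<odot>\<^bsub>H\<^esub> \<one>\<^bsub>H\<^esub> \<in> carrier H"
      using that by (simp add: rules)
    have "act V (r \<odot>\<^bsub>H\<^esub> \<one>\<^bsub>H\<^esub>) v = r \<odot>\<^bsub>V\<^esub> v"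
      using klin_smult[OF klin_act_left[OF V that(3) klin_ident], of r "\<one>\<^bsub>H\<^esub>"] that act_one[OF V]
      by simp
    moreover have "ract C c (r \<odot>\<^bsub>H\<^esub> \<one>\<^bsub>H\<^esub>) = r \<odot>\<^bsub>C\<^esub> c"
      using klin_smult[OF kbilin_right[OF C_kbilin(2)], of c r "\<one>\<^bsub>H\<^esub>"] that ract_one by simp
    ultimately have "hpure H C V c (r \<odot>\<^bsub>V\<^esub> v) = hpure H C V (r \<odot>\<^bsub>C\<^esub> c) v"
      using hpure_ract[OF that(1) rh that(3)] by simp
    then show ?thesis
      using that by (simp add: hpure_def htensor_def bpure_smult_left)
  qed
  then show ?thesis
    by (intro kbilinI klinI)
      (simp_all add: hpure_closed, simp_all add: hpure_def htensor_def bpure_add_left bpure_add_right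
        bpure_smult_left)
qed

lemma klin_hpure:
  "v \<in> carrier V \<Longrightarrow> klin k X C f \<Longrightarrow> klin k X (htensor H C V) (\<lambda>x. hpure H C V (f x) v)"
  "c \<in> carrier C \<Longrightarrow> klin k X V g \<Longrightarrow> klin k X (htensor H C V) (\<lambda>x. hpure H C V c (g x))"
  by (rule klin_comp[OF kbilin_left[OF kbilin_hpure]] klin_comp[OF kbilin_right[OF kbilin_hpure]];
      assumption)+

lemma htensor_ext:
  assumes "Module.module k P" "klin k (htensor H C V) P f" "klin k (htensor H C V) P g"
    and "\<And>c v. c \<in> carrier C \<Longrightarrow> v \<in> carrier V \<Longrightarrow> f (hpure H C V c v) = g (hpure H C V c v)"
    and "t \<in> carrier (htensor H C V)"
  shows "f t = g t"
  using assms unfolding htensor_def hpure_def by (rule klin_T_ext)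

lemma
  assumes P: "Module.module k P" and b: "kbilin k C V P b"
    and bal: "\<And>c h v. c \<in> carrier C \<Longrightarrow> h \<in> carrier H \<Longrightarrow> v \<in> carrier V \<Longrightarrow>
      b (ract C c h) v = b c (act V h v)"
  shows hlift_klin: "klin k (htensor H C V) P (hlift k H C V P b)"
    and hlift_hpure: "c \<in> carrier C \<Longrightarrow> v \<in> carrier V \<Longrightarrow> hlift k H C V P b (hpure H C V c v) = b c v"
    and hlift_closed: "t \<in> carrier (htensor H C V) \<Longrightarrow> hlift k H C V P b t \<in> carrier P"
    and klin_hlift_arg: "klin k X (htensor H C V) f \<Longrightarrow> klin k X P (\<lambda>x. hlift k H C V P b (f x))"
proof -
  show *: "klin k (htensor H C V) P (hlift k H C V P b)"
    and "c \<in> carrier C \<Longrightarrow> v \<in> carrier V \<Longrightarrow> hlift k H C V P b (hpure H C V c v) = b c v"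
    unfolding hlift_def htensor_def hpure_def using blift[OF P b bal] by blast+
  show "t \<in> carrier (htensor H C V) \<Longrightarrow> hlift k H C V P b t \<in> carrier P"
    and "klin k X (htensor H C V) f \<Longrightarrow> klin k X P (\<lambda>x. hlift k H C V P b (f x))"
    using klin_closed[OF *] klin_comp[OF *] by blast+
qed

lemma klin_hlift_param:
  assumes "Module.module k X" "Module.module k P"
    and "\<And>x. x \<in> carrier X \<Longrightarrow> kbilin k C V P (b x)"
    and "\<And>x c h v. x \<in> carrier X \<Longrightarrow> c \<in> carrier C \<Longrightarrow> h \<in> carrier H \<Longrightarrow> v \<in> carrier V \<Longrightarrow>
      b x (ract C c h) v = b x c (act V h v)"
    and "\<And>c v. c \<in> carrier C \<Longrightarrow> v \<in> carrier V \<Longrightarrow> klin k X P (\<lambda>x. b x c v)"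
    and "t \<in> carrier (htensor H C V)"
  shows "klin k X P (\<lambda>x. hlift k H C V P (b x) t)"
  using assms unfolding hlift_def htensor_def by (rule klin_blift_param)

lemmas htensor_rules = module_htensor hpure_closed klin_hpure hlift_hpure hlift_closed klin_hlift_arg
  klin_hlift_param act_rules[OF V]

text \<open>K acts on the factor C; this descends to C (x)_H V because the left and the right action
  on C commute.\<close>

lemma act_ind:
  shows act_ind_closed: "x \<in> carrier K \<Longrightarrow> t \<in> carrier (htensor H C V) \<Longrightarrow>
      act (ind_mod k H C V) x t \<in> carrier (htensor H C V)"
    and act_ind_hpure: "x \<in> carrier K \<Longrightarrow> c \<in> carrier C \<Longrightarrow> v \<in> carrier V \<Longrightarrow>
      act (ind_mod k H C V) x (hpure H C V c v) = hpure H C V (lact C x c) v"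
    and klin_act_ind_left: "t \<in> carrier (htensor H C V) \<Longrightarrow> klin k X K f \<Longrightarrow>
      klin k X (htensor H C V) (\<lambda>y. act (ind_mod k H C V) (f y) t)"
    and klin_act_ind_right: "x \<in> carrier K \<Longrightarrow> klin k X (htensor H C V) g \<Longrightarrow>
      klin k X (htensor H C V) (\<lambda>y. act (ind_mod k H C V) x (g y))"
proof -
  have bal: "hpure H C V (lact C x (ract C c h)) v = hpure H C V (lact C x c) (act V h v)"
    if "x \<in> carrier K" "c \<in> carrier C" "h \<in> carrier H" "v \<in> carrier V" for x c h v
    using that hpure_ract[of "lact C x c" h v] by (simp add: rules ract_lact)
  show "x \<in> carrier K \<Longrightarrow> t \<in> carrier (htensor H C V) \<Longrightarrow>
      act (ind_mod k H C V) x t \<in> carrier (htensor H C V)"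
    and "x \<in> carrier K \<Longrightarrow> c \<in> carrier C \<Longrightarrow> v \<in> carrier V \<Longrightarrow>
      act (ind_mod k H C V) x (hpure H C V c v) = hpure H C V (lact C x c) v"
    and "x \<in> carrier K \<Longrightarrow> klin k X (htensor H C V) g \<Longrightarrow>
      klin k X (htensor H C V) (\<lambda>y. act (ind_mod k H C V) x (g y))"
    by (simp_all add: ind_mod_def rules htensor_rules bal)
  show "t \<in> carrier (htensor H C V) \<Longrightarrow> klin k X K f \<Longrightarrow>
      klin k X (htensor H C V) (\<lambda>y. act (ind_mod k H C V) (f y) t)"
    using klin_comp[of K "htensor H C V" "\<lambda>y. act (ind_mod k H C V) y t" X f]
    by (simp add: ind_mod_def rules htensor_rules bal)
qed

end

lemmas act_ind_rules = act_ind_closed act_ind_hpure klin_act_ind_left klin_act_ind_right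

text \<open>H-linearity of \<open>f\<close> makes c (x) v |-> c (x)_H f v balanced over H.\<close>

lemma Emor:
  assumes V: "left_module k H V" and W: "left_module k H W" and f: "lmod_map k H V W f"
  shows Emor_klin: "klin k (htensor H C V) (htensor H C W) (Emor (ind_functor k H C) V W f)"
    and Emor_hpure: "c \<in> carrier C \<Longrightarrow> v \<in> carrier V \<Longrightarrow>
      Emor (ind_functor k H C) V W f (hpure H C V c v) = hpure H C W c (f v)"
proof -
  have fk: "klin k V W f" and fa: "\<And>h v. h \<in> carrier H \<Longrightarrow> v \<in> carrier V \<Longrightarrow> f (act V h v) = act W h (f v)"
    using f by (auto simp: lmod_map_def)
  have "kbilin k C V (htensor H C W) (\<lambda>c v. hpure H C W c (f v))"
    by (simp add: rules htensor_rules[OF W] fk klin_closed[OF fk])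
  moreover have "hpure H C W (ract C c h) (f v) = hpure H C W c (f (act V h v))"
    if "c \<in> carrier C" "h \<in> carrier H" "v \<in> carrier V" for c h v
    using that by (simp add: fa hpure_ract[OF W] klin_closed[OF fk])
  ultimately show "klin k (htensor H C V) (htensor H C W) (Emor (ind_functor k H C) V W f)"
    and "c \<in> carrier C \<Longrightarrow> v \<in> carrier V \<Longrightarrow>
      Emor (ind_functor k H C) V W f (hpure H C V c v) = hpure H C W c (f v)"
    using hlift_klin[OF V module_htensor[OF W]] hlift_hpure[OF V module_htensor[OF W]]
    by (simp_all add: ind_functor_def)
qed

text \<open>Balancing: the coproduct of c h is c_1 h_1 (x) c_2 h_2, while the diagonal action sends
  v (x) w to h_1 v (x) h_2 w. So h_1 and h_2 each cross their own tensor sign.\<close>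

lemma psi:
  assumes V: "left_module k H V" and W: "left_module k H W"
  shows psi_klin: "klin k (htensor H C (act_tensor k H H (comul H) V W))
        (tensor k (htensor H C V) (htensor H C W)) (psi (ind_functor k H C) V W)"
    and psi_hpure: "c \<in> carrier C \<Longrightarrow> v \<in> carrier V \<Longrightarrow> w \<in> carrier W \<Longrightarrow>
      psi (ind_functor k H C) V W (hpure H C (act_tensor k H H (comul H) V W) c (tpure k V W v w)) =
      tmap k C C (htensor H C V) (htensor H C W) (\<lambda>c. hpure H C V c v) (\<lambda>c. hpure H C W c w) (comul C c)"
proof -
  let ?VW = "act_tensor k H H (comul H) V W"
  let ?P = "tensor k (htensor H C V) (htensor H C W)"
  let ?b = "\<lambda>s t. tlift k C C ?P
            (\<lambda>c1 c2. tlift k V W ?P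
              (\<lambda>v w. tpure k (htensor H C V) (htensor H C W) (hpure H C V c1 v) (hpure H C W c2 w)) t)
            s"
  note VW = left_module_tensor[OF V W]
  note r = rules htensor_rules[OF V] htensor_rules[OF W]
  have bal: "?b (tlift k C C (tensor k C C) (\<lambda>c1 c2.
      tlift k H H (tensor k C C) (\<lambda>h1 h2. tpure k C C (ract C c1 h1) (ract C c2 h2)) u) s) t =
      ?b s (tlift k H H (tensor k V W) (\<lambda>b b'. tmap k V W V W (act V b) (act W b') t) u)"
      (is "?l s u t = ?r s u t")
    if s: "s \<in> carrier (tensor k C C)" and u: "u \<in> carrier (tensor k H H)"
      and t: "t \<in> carrier (tensor k V W)" for s u t
  proof (rule tensor_ext[OF _ _ _ _ _ _ s, where P = ?P])
    fix c c' assume c: "c \<in> carrier C" "c' \<in> carrier C"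
    show "?l (tpure k C C c c') u t = ?r (tpure k C C c c') u t"
    proof (rule tensor_ext[OF _ _ _ _ _ _ u, where P = ?P])
      fix h h' assume h: "h \<in> carrier H" "h' \<in> carrier H"
      show "?l (tpure k C C c c') (tpure k H H h h') t = ?r (tpure k C C c c') (tpure k H H h h') t"
        by (rule tensor_ext[OF _ _ _ _ _ _ t, where P = ?P])
          (simp_all add: r c h hpure_ract[OF V] hpure_ract[OF W])
    qed (simp_all add: r c s t)
  qed (simp_all add: r u t)
  have psi_eq: "psi (ind_functor k H C) V W = hlift k H C ?VW ?P (\<lambda>c t. ?b (comul C c) t)"
    by (simp add: ind_functor_def Let_def)
  have P: "Module.module k ?P"
    by (simp add: r)
  have b: "kbilin k C ?VW ?P (\<lambda>c t. ?b (comul C c) t)"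
    by (simp add: r)
  have bal': "?b (comul C (ract C c h)) t = ?b (comul C c) (act ?VW h t)"
    if "c \<in> carrier C" "h \<in> carrier H" "t \<in> carrier ?VW" for c h t
    using bal[of "comul C c" "comul H h" t] that by (simp add: act_tensor_def comul_ract r)
  show "klin k (htensor H C ?VW) ?P (psi (ind_functor k H C) V W)"
    unfolding psi_eq by (rule hlift_klin[OF VW P b bal'])
  show "psi (ind_functor k H C) V W (hpure H C ?VW c (tpure k V W v w)) =
      tmap k C C (htensor H C V) (htensor H C W) (\<lambda>c. hpure H C V c v) (\<lambda>c. hpure H C W c w) (comul C c)"
    if "c \<in> carrier C" "v \<in> carrier V" "w \<in> carrier W"
  proof -
    have "psi (ind_functor k H C) V W (hpure H C ?VW c (tpure k V W v w)) =
        ?b (comul C c) (tpure k V W v w)"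
      unfolding psi_eq using that by (subst hlift_hpure[OF VW P b bal']) (simp_all add: r)
    also have "\<dots> = tmap k C C (htensor H C V) (htensor H C W)
        (\<lambda>c. hpure H C V c v) (\<lambda>c. hpure H C W c w) (comul C c)"
      unfolding tmap_def tlift_def[of k C C]
      by (rule fun_cong[OF blift_cong]) (simp add: r that)
    finally show ?thesis .
  qed
qed

text \<open>Balanced because the counit of c h is the product of the counits, and H acts on the unit
  object through its counit.\<close>

lemma psi0:
  shows psi0_klin: "klin k (htensor H C (triv_mod k H)) (ground k) (psi0 (ind_functor k H C))"
    and psi0_hpure: "c \<in> carrier C \<Longrightarrow> r \<in> carrier k \<Longrightarrow>
      psi0 (ind_functor k H C) (hpure H C (triv_mod k H) c r) = counit C c \<otimes>\<^bsub>k\<^esub> r"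
proof -
  have b: "kbilin k C (triv_mod k H) (ground k) (\<lambda>c r. counit C c \<otimes>\<^bsub>k\<^esub> r)"
    by (auto intro!: kbilinI ground_klin structure_klin klin_ident datum_closed)
  have bal: "counit C (ract C c h) \<otimes>\<^bsub>k\<^esub> r = counit C c \<otimes>\<^bsub>k\<^esub> act (triv_mod k H) h r"
    if "c \<in> carrier C" "h \<in> carrier H" "r \<in> carrier (triv_mod k H)" for c h r
    using that by (simp add: counit_ract k.m_assoc datum_closed)
  show "klin k (htensor H C (triv_mod k H)) (ground k) (psi0 (ind_functor k H C))"
    and "c \<in> carrier C \<Longrightarrow> r \<in> carrier k \<Longrightarrow>
      psi0 (ind_functor k H C) (hpure H C (triv_mod k H) c r) = counit C c \<otimes>\<^bsub>k\<^esub> r"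
    using hlift_klin[OF left_module_triv module_ground b bal]
      hlift_hpure[OF left_module_triv module_ground b bal]
    by (simp_all add: ind_functor_def)
qed

subsection \<open>Objects and morphisms of the lax center\<close>

lemmas assoc_rules = tassoc_closed tassoc_tpure klin_tassoc tassoc_inv_closed tassoc_inv_tpure klin_tassoc_inv

text \<open>The canonical isomorphism C (x)_H H -> C is \<open>\<theta>\<close>.
  \<open>insertion M V v\<close> sends m (x) c to m (x) (c (x)_H v); with \<open>reg\<close> and the
  unit of H it is a section of \<open>\<theta>' M\<close>.\<close>

abbreviation "reg \<equiv> with_act H (mult H)"
abbreviation "\<theta> \<equiv> hlift k H C reg C (ract C)"
abbreviation "insertion M V v \<equiv> tmap k M C M (htensor H C V) (\<lambda>x. x) (\<lambda>c. hpure H C V c v)"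
abbreviation "\<theta>' M \<equiv> tmap k M (htensor H C reg) M C (\<lambda>x. x) \<theta>"

text \<open>The associativity law of the right action, c (g h) = (c g) h, is the balancing condition
  here.\<close>

lemma theta:
  shows theta_klin: "klin k (htensor H C reg) C \<theta>"
    and theta_hpure: "c \<in> carrier C \<Longrightarrow> h \<in> carrier H \<Longrightarrow> \<theta> (hpure H C reg c h) = ract C c h"
  using hlift_klin[OF left_module_reg modules(4), of "ract C"]
    hlift_hpure[OF left_module_reg modules(4), of "ract C"]
  by (simp_all add: C_kbilin ract_mult)

lemmas theta_rules = theta_hpure klin_closed[OF theta_klin] theta_klin klin_comp[OF theta_klin]

text \<open>m (x) c goes to m (x) (c (x)_H 1) and back to m (x) c 1. With this, equations inserted
  into C (x)_H H can be cancelled for every M, flat or not.\<close>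

lemma theta_insertion:
  assumes M: "Module.module k M" and t: "t \<in> carrier (tensor k M C)"
  shows "\<theta>' M (insertion M reg \<one>\<^bsub>H\<^esub> t) = t"
  by (rule tensor_ext[OF _ _ _ _ _ _ t, where P = "tensor k M C"])
    (simp_all add: rules M htensor_rules[OF left_module_reg, simplified] theta_rules ract_one)

text \<open>Linearity of the components over \<open>k\<close> and over A is separated: the former
  will be known in advance from the formula for the family, the latter becomes the Yetter-Drinfeld
  condition.\<close>

lemma nat_family_iff:
  "nat_family (mod_moncat k H) (mod_moncat k K) (ind_functor k H C) (mod_biact k H K A) M \<beta> \<longleftrightarrow>
    \<beta> \<in> extensional {V. left_module k H V} \<and>
    (\<forall>V. left_module k H V \<longrightarrow> \<beta> V \<in> extensional (carrier (tensor k V M)) \<and>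
      klin k (tensor k V M) (tensor k M (htensor H C V)) (\<beta> V) \<and>
      (\<forall>a\<in>carrier A. \<forall>t\<in>carrier (tensor k V M).
        \<beta> V (tlift k H A (tensor k V M) (\<lambda>h a. tmap k V M V M (act V h) (act M a) t) (lcoact A a)) =
        tlift k A K (tensor k M (htensor H C V)) (\<lambda>a x. tmap k M (htensor H C V) M (htensor H C V)
          (act M a) (act (ind_mod k H C V) x) (\<beta> V t)) (rcoact A a))) \<and>
    (\<forall>V W f. left_module k H V \<longrightarrow> left_module k H W \<longrightarrow> f \<in> extensional (carrier V) \<longrightarrow>
      lmod_map k H V W f \<longrightarrow> (\<forall>t\<in>carrier (tensor k V M).
        tmap k M (htensor H C V) M (htensor H C W) (\<lambda>x. x) (Emor (ind_functor k H C) V W f) (\<beta> V t) =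
        \<beta> W (tmap k V M W M f (\<lambda>x. x) t)))"
proof -
  have klin_ind: "klin k X (ind_mod k H C V) = klin k X (htensor H C V)"
    "klin k (ind_mod k H C V) = klin k (htensor H C V)"
    for X V by (simp_all add: ind_mod_def fun_eq_iff)
  show ?thesis
    unfolding nat_family_def
    by (simp add: mod_biact_def mod_moncat_def mod_cat_def compose_eq_iff act_act_tensor lmod_map_def
        klin_ind) (meson)
qed

lemma coaction_determines:
  assumes M: "Module.module k M"
    and nat: "nat_family (mod_moncat k H) (mod_moncat k K) (ind_functor k H C) (mod_biact k H K A) M \<beta>"
    and V: "left_module k H V" and v: "v \<in> carrier V" and m: "m \<in> carrier M"
  shows "\<beta> V (tpure k V M v m) = insertion M V v (\<theta>' M (\<beta> reg (tpure k H M \<one>\<^bsub>H\<^esub> m)))"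
proof -
  note r = rules M act_rules[OF V] htensor_rules[OF V] htensor_rules[OF left_module_reg, simplified]
  \<comment> \<open>Restricted to the carrier, as Hom sets consist of extensional functions and
    naturality speaks of these only.\<close>
  define f where "f = (\<lambda>h\<in>carrier H. act V h v)"
  have f_apply: "f h = act V h v" if "h \<in> carrier H" for h
    using that by (simp add: f_def)
  have f: "lmod_map k H reg V f"
    using klin_act_left[OF V v klin_ident] v
    by (auto simp: lmod_map_def act_mult[OF V] klin_def f_apply module.smult_closed[OF modules(1)])
  let ?E = "Emor (ind_functor k H C) reg V f"
  note E = Emor_klin[OF left_module_reg V f] Emor_hpure[OF left_module_reg V f, simplified]
  let ?s = "\<beta> reg (tpure k H M \<one>\<^bsub>H\<^esub> m)"
  have one_m: "tpure k H M \<one>\<^bsub>H\<^esub> m \<in> carrier (tensor k H M)"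
    using m by (simp add: r)
  have fk: "klin k H V f"
    using f by (simp add: lmod_map_def)
  have reg_lin: "klin k (tensor k H M) (tensor k M (htensor H C reg)) (\<beta> reg)"
    using nat left_module_reg by (auto simp: nat_family_iff)
  \<comment> \<open>In C (x)_H V the element h crosses the tensor sign: c (x) h v = c h (x) v. So
    the functor sends \<open>f\<close> to \<open>\<theta>\<close> followed by insertion of
    v.\<close>
  have E_theta: "?E t = hpure H C V (\<theta> t) v" if "t \<in> carrier (htensor H C reg)" for t
    by (rule htensor_ext[OF left_module_reg _ _ _ _ that, where P = "htensor H C V"])
      (simp_all add: r E theta_rules v hpure_ract[OF V] f_apply)
  have "tmap k M (htensor H C reg) M (htensor H C V) (\<lambda>x. x) ?E ?s =
      \<beta> V (tmap k H M V M f (\<lambda>x. x) (tpure k H M \<one>\<^bsub>H\<^esub> m))"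
    using nat[unfolded nat_family_iff] left_module_reg V f one_m
    by (force simp: f_def simp del: restrict_apply)
  also have "\<dots> = \<beta> V (tpure k V M v m)"
    using m v by (simp add: r fk f_apply)
  finally have "\<beta> V (tpure k V M v m) =
    tmap k M (htensor H C reg) M (htensor H C V) (\<lambda>x. x) ?E ?s" ..
  also have "\<dots> = insertion M V v (\<theta>' M ?s)"
    by (rule tensor_ext[OF _ _ _ _ _ _ klin_closed[OF reg_lin one_m], where P = "tensor k M (htensor H C V)"])
      (simp_all add: r E klin_comp[OF E(1)] theta_rules v E_theta)
  finally show ?thesis .
qed

text \<open>A linear \<rho> and a family related to it on pure tensors. Both directions of the
  correspondence enter here: once with the family built from \<rho>, once with \<rho> read off from
  an object of the center.\<close>

context
  fixes M :: "'u lmod" and \<rho> :: "'u \<Rightarrow> 'u" and \<beta> :: "'u lmod \<Rightarrow> 'u \<Rightarrow> 'u"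
  assumes M: "left_module k A M" and \<rho>: "klin k M (tensor k M C) \<rho>"
    and \<beta>: "left_module k H V \<Longrightarrow> klin k (tensor k V M) (tensor k M (htensor H C V)) (\<beta> V)"
    and \<beta>_tpure: "left_module k H V \<Longrightarrow> v \<in> carrier V \<Longrightarrow> m \<in> carrier M \<Longrightarrow>
      \<beta> V (tpure k V M v m) = insertion M V v (\<rho> m)"
begin

lemmas \<rho>_rules = klin_closed[OF \<rho>] \<rho> klin_comp[OF \<rho>]
lemmas \<beta>_rules = klin_closed[OF \<beta>] \<beta> klin_comp[OF \<beta>] \<beta>_tpure

text \<open>Naturality is automatic: v occurs only in the last factor of the formula, where the
  functor replaces it by f v.\<close>

lemma center_natural:
  assumes V: "left_module k H V" and W: "left_module k H W" and f: "lmod_map k H V W f"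
    and t: "t \<in> carrier (tensor k V M)"
  shows "tmap k M (htensor H C V) M (htensor H C W) (\<lambda>x. x) (Emor (ind_functor k H C) V W f) (\<beta> V t) =
        \<beta> W (tmap k V M W M f (\<lambda>x. x) t)"
proof -
  note E = Emor_klin[OF V W f] Emor_hpure[OF V W f]
  have fk: "klin k V W f" using f by (simp add: lmod_map_def)
  note r = rules act_rules[OF M] htensor_rules[OF V] htensor_rules[OF W] \<rho>_rules
    \<beta>_rules[OF V] \<beta>_rules[OF W] E klin_comp[OF E(1)] fk klin_closed[OF fk] klin_comp[OF fk]
  show ?thesis
  proof (rule tensor_ext[OF _ _ _ _ _ _ t, where P = "tensor k M (htensor H C W)"])
    fix v m assume vm: "v \<in> carrier V" "m \<in> carrier M"
    have s: "\<rho> m \<in> carrier (tensor k M C)" using vm by (simp add: r)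
    have "tmap k M (htensor H C V) M (htensor H C W) (\<lambda>x. x) (Emor (ind_functor k H C) V W f)
      (insertion M V v (\<rho> m)) = insertion M W (f v) (\<rho> m)"
      by (rule tensor_ext[OF _ _ _ _ _ _ s, where P = "tensor k M (htensor H C W)"])
        (simp_all add: r vm)
    then show "tmap k M (htensor H C V) M (htensor H C W) (\<lambda>x. x) (Emor (ind_functor k H C) V W f)
        (\<beta> V (tpure k V M v m)) = \<beta> W (tmap k V M W M f (\<lambda>x. x) (tpure k V M v m))"
      by (simp add: r vm)
  qed (simp_all add: r)
qed

text \<open>At v (x) m, the two sides of A-linearity are \<open>insertion M V v\<close> of the two
  sides of the Yetter-Drinfeld condition. So the condition suffices for all V, and at the regular
  module with v = 1 the insertion cancels.\<close>

lemma center_linear_iff: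
  "(\<forall>V. left_module k H V \<longrightarrow> (\<forall>a\<in>carrier A. \<forall>t\<in>carrier (tensor k V M).
      \<beta> V (tlift k H A (tensor k V M) (\<lambda>h a. tmap k V M V M (act V h) (act M a) t) (lcoact A a)) =
      tlift k A K (tensor k M (htensor H C V)) (\<lambda>a x. tmap k M (htensor H C V) M (htensor H C V)
        (act M a) (act (ind_mod k H C V) x) (\<beta> V t)) (rcoact A a))) \<longleftrightarrow>
    yd_condition k H K A C M \<rho>"
    (is "(\<forall>V. _ \<longrightarrow> (\<forall>a\<in>_. \<forall>t\<in>_. \<beta> V (?l V t (lcoact A a)) = ?r V (\<beta> V t) (rcoact A a))) \<longleftrightarrow> _")
proof -
  \<comment> \<open>The two sides of the Yetter-Drinfeld condition with an arbitrary tensor in place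
    of the coaction of a, so that \<open>left\<close> and \<open>right\<close> can be checked on
    pure tensors.\<close>
  define L where "L m = tlift k H A (tensor k M C)
    (\<lambda>h a. tmap k M C M C (\<lambda>x. x) (\<lambda>c. ract C c h) (\<rho> (act M a m)))" for m
  define R where "R m = tlift k A K (tensor k M C) (\<lambda>a x. tmap k M C M C (act M a) (lact C x) (\<rho> m))" for m
  note rM = rules act_rules[OF M] \<rho>_rules
  have yd: "yd_condition k H K A C M \<rho> \<longleftrightarrow>
      (\<forall>a\<in>carrier A. \<forall>m\<in>carrier M. L m (lcoact A a) = R m (rcoact A a))"
    by (simp add: yd_condition_def L_def R_def)
  have left: "\<beta> V (?l V (tpure k V M v m) s) = insertion M V v (L m s)"
    if V: "left_module k H V" and v: "v \<in> carrier V" and m: "m \<in> carrier M"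
      and s: "s \<in> carrier (tensor k H A)" for V v m s
  proof -
    note r = rM act_rules[OF V] htensor_rules[OF V] \<beta>_rules[OF V]
    show ?thesis
      unfolding L_def
    proof (rule tensor_ext[OF _ _ _ _ _ _ s, where P = "tensor k M (htensor H C V)"])
      fix h a assume ha: "h \<in> carrier H" "a \<in> carrier A"
      have x: "\<rho> (act M a m) \<in> carrier (tensor k M C)"
        using ha m by (simp add: r)
      \<comment> \<open>Linearity lets h act on v, the Yetter-Drinfeld condition lets it act on c;
        the balancing relation of C (x)_H V identifies the two.\<close>
      have "insertion M V (act V h v) (\<rho> (act M a m)) =
          insertion M V v (tmap k M C M C (\<lambda>x. x) (\<lambda>c. ract C c h) (\<rho> (act M a m)))"
        by (rule tensor_ext[OF _ _ _ _ _ _ x, where P = "tensor k M (htensor H C V)"])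
          (simp_all add: r ha v m hpure_ract[OF V])
      then show "\<beta> V (?l V (tpure k V M v m) (tpure k H A h a)) =
          insertion M V v (tlift k H A (tensor k M C)
            (\<lambda>h a. tmap k M C M C (\<lambda>x. x) (\<lambda>c. ract C c h) (\<rho> (act M a m))) (tpure k H A h a))"
        by (simp add: r ha v m)
    qed (simp_all add: r v m)
  qed
  have right: "?r V (\<beta> V (tpure k V M v m)) s = insertion M V v (R m s)"
    if V: "left_module k H V" and v: "v \<in> carrier V" and m: "m \<in> carrier M"
      and s: "s \<in> carrier (tensor k A K)" for V v m s
  proof -
    note r = rM act_rules[OF V] htensor_rules[OF V] \<beta>_rules[OF V] act_ind_rules[OF V]
    have x: "\<rho> m \<in> carrier (tensor k M C)"
      using m by (simp add: r)
    show ?thesis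
      unfolding R_def
    proof (rule tensor_ext[OF _ _ _ _ _ _ s, where P = "tensor k M (htensor H C V)"])
      fix a y assume ay: "a \<in> carrier A" "y \<in> carrier K"
      have "tmap k M (htensor H C V) M (htensor H C V) (act M a) (act (ind_mod k H C V) y)
          (insertion M V v (\<rho> m)) = insertion M V v (tmap k M C M C (act M a) (lact C y) (\<rho> m))"
        by (rule tensor_ext[OF _ _ _ _ _ _ x, where P = "tensor k M (htensor H C V)"])
          (simp_all add: r ay v m)
      then show "?r V (\<beta> V (tpure k V M v m)) (tpure k A K a y) =
          insertion M V v (tlift k A K (tensor k M C)
            (\<lambda>a x. tmap k M C M C (act M a) (lact C x) (\<rho> m)) (tpure k A K a y))"
        by (simp add: r ay v m)
    qed (simp_all add: r v m)
  qed
  show ?thesis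
  proof (intro iffI allI impI ballI)
    assume *: "\<forall>V. left_module k H V \<longrightarrow> (\<forall>a\<in>carrier A. \<forall>t\<in>carrier (tensor k V M).
      \<beta> V (?l V t (lcoact A a)) = ?r V (\<beta> V t) (rcoact A a))"
    show "yd_condition k H K A C M \<rho>"
      unfolding yd
    proof (intro ballI)
      fix a m assume am: "a \<in> carrier A" "m \<in> carrier M"
      have "\<beta> reg (?l reg (tpure k reg M \<one>\<^bsub>H\<^esub> m) (lcoact A a)) =
          ?r reg (\<beta> reg (tpure k reg M \<one>\<^bsub>H\<^esub> m)) (rcoact A a)"
        using *[rule_format, OF left_module_reg am(1)] am by (simp add: rM)
      then have "insertion M reg \<one>\<^bsub>H\<^esub> (L m (lcoact A a)) = insertion M reg \<one>\<^bsub>H\<^esub> (R m (rcoact A a))"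
        using left[OF left_module_reg, of "\<one>\<^bsub>H\<^esub>" m "lcoact A a"]
          right[OF left_module_reg, of "\<one>\<^bsub>H\<^esub>" m "rcoact A a"] am by (simp add: rM)
      moreover have "L m (lcoact A a) \<in> carrier (tensor k M C)" "R m (rcoact A a) \<in> carrier (tensor k M C)"
        using am by (simp_all add: L_def R_def rM)
      \<comment> \<open>The retraction \<open>\<theta>' M\<close> is applied to both inserted
        elements.\<close>
      ultimately show "L m (lcoact A a) = R m (rcoact A a)"
        by (metis theta_insertion left_module_module[OF M])
    qed
  next
    fix V :: "'u lmod" and a t
    assume "yd_condition k H K A C M \<rho>" and V: "left_module k H V" and a: "a \<in> carrier A"
      and t: "t \<in> carrier (tensor k V M)"
    then have eq: "L m (lcoact A a) = R m (rcoact A a)" if "m \<in> carrier M" for m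
      using that by (simp add: yd)
    note r = rM act_rules[OF V] htensor_rules[OF V] \<beta>_rules[OF V] act_ind_rules[OF V]
    show "\<beta> V (?l V t (lcoact A a)) = ?r V (\<beta> V t) (rcoact A a)"
    proof (rule tensor_ext[OF _ _ _ _ _ _ t, where P = "tensor k M (htensor H C V)"])
      fix v m assume vm: "v \<in> carrier V" "m \<in> carrier M"
      show "\<beta> V (?l V (tpure k V M v m) (lcoact A a)) = ?r V (\<beta> V (tpure k V M v m)) (rcoact A a)"
        using vm a by (simp add: left[OF V] right[OF V] eq datum_closed del: \<beta>_tpure)
    qed (simp_all add: r a)
  qed
qed

lemma nat_family_iff_yd:
  "nat_family (mod_moncat k H) (mod_moncat k K) (ind_functor k H C) (mod_biact k H K A) M \<beta> \<longleftrightarrow>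
    \<beta> \<in> extensional {V. left_module k H V} \<and>
    (\<forall>V. left_module k H V \<longrightarrow> \<beta> V \<in> extensional (carrier (tensor k V M))) \<and>
    yd_condition k H K A C M \<rho>"
  unfolding nat_family_iff center_linear_iff[symmetric] using \<beta> center_natural by blast

text \<open>At c (x) m the composite gives c times the counit contraction of \<rho> m, and the unit
  constraint gives c m. Taking c = 1 yields counitality; the converse is linearity.\<close>

lemma unit_triangle_iff:
  "unit_triangle (mod_moncat k H) (mod_moncat k K) (ind_functor k H C) (mod_biact k H K A) M \<beta> \<longleftrightarrow>
    (\<forall>m\<in>carrier M. tlift k M C M (\<lambda>x c. counit C c \<odot>\<^bsub>M\<^esub> x) (\<rho> m) = m)"
proof -
  interpret M: Module.module k M by (rule left_module_module[OF M])
  let ?I = "triv_mod k H"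
  let ?E = "htensor H C ?I"
  let ?f = "\<lambda>t. trunit k M (tmap k M ?E M (ground k) (\<lambda>x. x) (psi0 (ind_functor k H C)) (\<beta> ?I t))"
  note act_triv = htensor_rules[OF left_module_triv, simplified] \<beta>_rules[OF left_module_triv, simplified]
  note r = rules ground_klin kbilin_ground act_rules[OF M] \<rho>_rules act_triv psi0_hpure psi0_klin
    klin_comp[OF psi0_klin]
  have unit: "unit_triangle (mod_moncat k H) (mod_moncat k K) (ind_functor k H C) (mod_biact k H K A) M \<beta>
      \<longleftrightarrow> (\<forall>t\<in>carrier (tensor k (ground k) M). ?f t = tlunit k M t)"
  proof -
    \<comment> \<open>The right side of the triangle is not a composite; it can be compared
      pointwise on the carrier because it is extensional.\<close>
    have "tlunit k M \<in> extensional (carrier (tensor k (ground k) M))"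
      unfolding tlunit_def by (rule tlift_extensional) (simp_all add: r)
    then show ?thesis
      unfolding unit_triangle_def Let_def
      by (simp add: mod_biact_def mod_moncat_def mod_cat_def compose_eq_ext_iff compose_eq)
  qed
  have pure: "?f (tpure k (ground k) M c m) = c \<odot>\<^bsub>M\<^esub> tlift k M C M (\<lambda>x c. counit C c \<odot>\<^bsub>M\<^esub> x) (\<rho> m)"
    if c: "c \<in> carrier k" and m: "m \<in> carrier M" for c m
  proof -
    have x: "\<rho> m \<in> carrier (tensor k M C)" using m by (simp add: r)
    have "trunit k M (tmap k M ?E M (ground k) (\<lambda>x. x) (psi0 (ind_functor k H C)) (insertion M ?I c (\<rho> m))) =
      c \<odot>\<^bsub>M\<^esub> tlift k M C M (\<lambda>x c. counit C c \<odot>\<^bsub>M\<^esub> x) (\<rho> m)"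
      by (rule tensor_ext[OF _ _ _ _ _ _ x, where P = M])
        (simp_all add: r c m trunit_def k.m_comm flip: M.smult_assoc1)
    then show ?thesis
      using c m by (simp add: r)
  qed
  show ?thesis
    unfolding unit
  proof (intro iffI ballI)
    fix m assume *: "\<forall>t\<in>carrier (tensor k (ground k) M). ?f t = tlunit k M t" and m: "m \<in> carrier M"
    have "tpure k (ground k) M \<one>\<^bsub>k\<^esub> m \<in> carrier (tensor k (ground k) M)"
      using m by (simp add: r)
    then have "?f (tpure k (ground k) M \<one>\<^bsub>k\<^esub> m) = tlunit k M (tpure k (ground k) M \<one>\<^bsub>k\<^esub> m)"
      by (rule *[rule_format])
    also have "\<dots> = m"
      using m by (simp add: tlunit_def r)
    finally show "tlift k M C M (\<lambda>x c. counit C c \<odot>\<^bsub>M\<^esub> x) (\<rho> m) = m"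
      using m pure[of "\<one>\<^bsub>k\<^esub>" m] by (simp add: r)
  next
    fix t assume *: "\<forall>m\<in>carrier M. tlift k M C M (\<lambda>x c. counit C c \<odot>\<^bsub>M\<^esub> x) (\<rho> m) = m"
      and t: "t \<in> carrier (tensor k (ground k) M)"
    show "?f t = tlunit k M t"
    proof (rule tensor_ext[OF _ _ _ _ _ _ t, where P = M])
      fix c m assume cm: "c \<in> carrier (ground k)" "m \<in> carrier M"
      show "?f (tpure k (ground k) M c m) = tlunit k M (tpure k (ground k) M c m)"
        using cm pure[of c m] * by (simp add: tlunit_def r del: \<beta>_tpure)
    qed (simp_all add: r trunit_def tlunit_def)
  qed
qed

lemma heptagon_unfold:
  "heptagon (mod_moncat k H) (mod_moncat k K) (ind_functor k H C) (mod_biact k H K A) M \<beta> \<longleftrightarrow>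
    (\<forall>V W. left_module k H V \<longrightarrow> left_module k H W \<longrightarrow> (\<forall>t\<in>carrier (tensor k (tensor k V W) M).
      tassoc_inv k M (htensor H C V) (htensor H C W)
        (tmap k M (htensor H C (act_tensor k H H (comul H) V W)) M
          (tensor k (htensor H C V) (htensor H C W)) (\<lambda>x. x) (psi (ind_functor k H C) V W)
          (\<beta> (act_tensor k H H (comul H) V W) t)) =
      tmap k (tensor k V M) (htensor H C W) (tensor k M (htensor H C V)) (htensor H C W) (\<beta> V) (\<lambda>x. x)
        (tassoc_inv k V M (htensor H C W)
          (tmap k V (tensor k W M) V (tensor k M (htensor H C W)) (\<lambda>x. x) (\<beta> W)
            (tassoc k V W M t)))))"
proof -
  have restrict_ind: "(\<lambda>x\<in>carrier (ind_mod k H C V). x) = (\<lambda>x\<in>carrier (htensor H C V). x)" for V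
    by (simp only: ind_mod_simps)
  show ?thesis
    unfolding heptagon_def Let_def
    by (simp add: mod_biact_def mod_moncat_def mod_cat_def compose_eq_iff compose_eq restrict_ind
        del: restrict_apply)
qed

text \<open>\<open>psi\<close> splits c (x) (v (x) w) along the coproduct of c. So this side carries
  the coproduct applied after \<rho>, with v inserted at the first copy of C and w at the
  second.\<close>

lemma heptagon_left:
  assumes V: "left_module k H V" and W: "left_module k H W"
    and v: "v \<in> carrier V" and w: "w \<in> carrier W" and m: "m \<in> carrier M"
  shows "tassoc_inv k M (htensor H C V) (htensor H C W)
        (tmap k M (htensor H C (act_tensor k H H (comul H) V W)) M
          (tensor k (htensor H C V) (htensor H C W)) (\<lambda>x. x) (psi (ind_functor k H C) V W)
          (\<beta> (act_tensor k H H (comul H) V W) (tpure k (tensor k V W) M (tpure k V W v w) m))) =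
    tmap k (tensor k M C) C (tensor k M (htensor H C V)) (htensor H C W)
      (insertion M V v) (\<lambda>c. hpure H C W c w)
      (tassoc_inv k M C C (tmap k M C M (tensor k C C) (\<lambda>x. x) (comul C) (\<rho> m)))"
proof -
  let ?VW = "act_tensor k H H (comul H) V W"
  let ?T = "tensor k (tensor k M (htensor H C V)) (htensor H C W)"
  note VW = left_module_tensor[OF V W]
  note rVW = htensor_rules[OF VW, simplified] \<beta>_rules[OF VW, simplified]
  note r = rules assoc_rules act_rules[OF M] \<rho>_rules htensor_rules[OF V] htensor_rules[OF W] rVW
    psi_hpure[OF V W] psi_klin[OF V W] klin_comp[OF psi_klin[OF V W]]
  have pure: "tassoc_inv k M (htensor H C V) (htensor H C W) (tpure k M (tensor k (htensor H C V) (htensor H C W)) m'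
        (tmap k C C (htensor H C V) (htensor H C W) (\<lambda>c. hpure H C V c v) (\<lambda>c. hpure H C W c w) s)) =
      tmap k (tensor k M C) C (tensor k M (htensor H C V)) (htensor H C W)
        (insertion M V v) (\<lambda>c. hpure H C W c w) (tassoc_inv k M C C (tpure k M (tensor k C C) m' s))"
    if "m' \<in> carrier M" and s: "s \<in> carrier (tensor k C C)" for m' s
    by (rule tensor_ext[OF _ _ _ _ _ _ s, where P = ?T]) (simp_all add: r that v w)
  have x: "\<rho> m \<in> carrier (tensor k M C)"
    using m by (simp add: r)
  have "tassoc_inv k M (htensor H C V) (htensor H C W)
      (tmap k M (htensor H C ?VW) M
        (tensor k (htensor H C V) (htensor H C W)) (\<lambda>x. x) (psi (ind_functor k H C) V W)
        (insertion M ?VW (tpure k V W v w) (\<rho> m))) =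
    tmap k (tensor k M C) C (tensor k M (htensor H C V)) (htensor H C W)
      (insertion M V v) (\<lambda>c. hpure H C W c w)
      (tassoc_inv k M C C (tmap k M C M (tensor k C C) (\<lambda>x. x) (comul C) (\<rho> m)))"
    by (rule tensor_ext[OF _ _ _ _ _ _ x, where P = ?T]) (simp_all add: r v w pure)
  then show ?thesis
    using v w m by (simp add: r)
qed

text \<open>\<open>\<beta> W\<close> acts first, so the C-component of \<rho> m receives w;
  \<open>\<beta> V\<close> then applies \<rho> to the remaining factor in M, and the new component
  receives v. The copies of C thus appear in the same order as on the other side.\<close>

lemma heptagon_right:
  assumes V: "left_module k H V" and W: "left_module k H W"
    and v: "v \<in> carrier V" and w: "w \<in> carrier W" and m: "m \<in> carrier M"
  shows "tmap k (tensor k V M) (htensor H C W) (tensor k M (htensor H C V)) (htensor H C W) (\<beta> V) (\<lambda>x. x)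
        (tassoc_inv k V M (htensor H C W)
          (tmap k V (tensor k W M) V (tensor k M (htensor H C W)) (\<lambda>x. x) (\<beta> W)
            (tassoc k V W M (tpure k (tensor k V W) M (tpure k V W v w) m)))) =
    tmap k (tensor k M C) C (tensor k M (htensor H C V)) (htensor H C W)
      (insertion M V v) (\<lambda>c. hpure H C W c w)
      (tmap k M C (tensor k M C) C \<rho> (\<lambda>c. c) (\<rho> m))"
proof -
  let ?T = "tensor k (tensor k M (htensor H C V)) (htensor H C W)"
  note r = rules assoc_rules act_rules[OF M] \<rho>_rules htensor_rules[OF V] htensor_rules[OF W]
    \<beta>_rules[OF V] \<beta>_rules[OF W]
  have x: "\<rho> m \<in> carrier (tensor k M C)"
    using m by (simp add: r)
  have "tmap k (tensor k V M) (htensor H C W) (tensor k M (htensor H C V)) (htensor H C W) (\<beta> V) (\<lambda>x. x)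
        (tassoc_inv k V M (htensor H C W) (tpure k V (tensor k M (htensor H C W)) v (insertion M W w (\<rho> m)))) =
    tmap k (tensor k M C) C (tensor k M (htensor H C V)) (htensor H C W)
      (insertion M V v) (\<lambda>c. hpure H C W c w)
      (tmap k M C (tensor k M C) C \<rho> (\<lambda>c. c) (\<rho> m))"
    by (rule tensor_ext[OF _ _ _ _ _ _ x, where P = ?T]) (simp_all add: r v w)
  then show ?thesis
    using v w m by (simp add: r)
qed

text \<open>Both sides are values of the same map on (M (x) C) (x) C, the one inserting v and w, so
  coassociativity implies the heptagon. Conversely, this map has a left inverse when both modules
  are regular and v = w = 1.\<close>

lemma heptagon_iff:
  "heptagon (mod_moncat k H) (mod_moncat k K) (ind_functor k H C) (mod_biact k H K A) M \<beta> \<longleftrightarrow>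
    (\<forall>m\<in>carrier M. tassoc k M C C (tmap k M C (tensor k M C) C \<rho> (\<lambda>c. c) (\<rho> m)) =
          tmap k M C M (tensor k C C) (\<lambda>x. x) (comul C) (\<rho> m))"
proof -
  note MC = left_module_module[OF M] modules(4)
  let ?x = "\<lambda>m. tmap k M C M (tensor k C C) (\<lambda>x. x) (comul C) (\<rho> m)"
  let ?y = "\<lambda>m. tmap k M C (tensor k M C) C \<rho> (\<lambda>c. c) (\<rho> m)"
  have closed: "?x m \<in> carrier (tensor k M (tensor k C C))" "?y m \<in> carrier (tensor k (tensor k M C) C)"
    if "m \<in> carrier M" for m
    using that by (simp_all add: rules act_rules[OF M] \<rho>_rules)
  show ?thesis
  proof (intro iffI ballI)
    fix m
    assume hept: "heptagon (mod_moncat k H) (mod_moncat k K) (ind_functor k H C) (mod_biact k H K A) M \<beta>"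
      and m: "m \<in> carrier M"
    let ?ins = "tmap k (tensor k M C) C (tensor k M (htensor H C reg)) (htensor H C reg)
      (insertion M reg \<one>\<^bsub>H\<^esub>) (\<lambda>c. hpure H C reg c \<one>\<^bsub>H\<^esub>)"
    \<comment> \<open>The retraction of \<open>?ins\<close>, with \<open>\<theta>\<close> applied at
      each copy of C.\<close>
    let ?back = "tmap k (tensor k M (htensor H C reg)) (htensor H C reg) (tensor k M C) C (\<theta>' M) \<theta>"
    note r = rules assoc_rules act_rules[OF M] htensor_rules[OF left_module_reg, simplified] theta_rules
    have cancel: "?back (?ins s) = s" if s: "s \<in> carrier (tensor k (tensor k M C) C)" for s
      by (rule tensor_ext[OF _ _ _ _ _ _ s, where P = "tensor k (tensor k M C) C"])
        (simp_all add: theta_insertion r ract_one)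
    have "tpure k (tensor k reg reg) M (tpure k reg reg \<one>\<^bsub>H\<^esub> \<one>\<^bsub>H\<^esub>) m
        \<in> carrier (tensor k (tensor k reg reg) M)"
      using m by (simp add: r)
    then have "?ins (tassoc_inv k M C C (?x m)) = ?ins (?y m)"
      using hept[unfolded heptagon_unfold, rule_format, OF left_module_reg left_module_reg]
        heptagon_left[OF left_module_reg left_module_reg, of "\<one>\<^bsub>H\<^esub>" "\<one>\<^bsub>H\<^esub>" m]
        heptagon_right[OF left_module_reg left_module_reg, of "\<one>\<^bsub>H\<^esub>" "\<one>\<^bsub>H\<^esub>" m] m
      by (simp only: with_act_simps datum_closed)
    then have "tassoc_inv k M C C (?x m) = ?y m"
      using cancel closed[OF m] by (metis tassoc_inv_closed[OF MC modules(4)])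
    then show "tassoc k M C C (?y m) = ?x m"
      using tassoc_tassoc_inv[OF MC modules(4) closed(1)[OF m]] by simp
  next
    assume *: "\<forall>m\<in>carrier M. tassoc k M C C (?y m) = ?x m"
    have eq: "tassoc_inv k M C C (?x m) = ?y m" if "m \<in> carrier M" for m
      using *[rule_format, OF that] tassoc_inv_tassoc[OF MC modules(4) closed(2)[OF that]] by simp
    show "heptagon (mod_moncat k H) (mod_moncat k K) (ind_functor k H C) (mod_biact k H K A) M \<beta>"
      unfolding heptagon_unfold
    proof (intro allI impI ballI)
      fix V W :: "'u lmod" and t
      assume V: "left_module k H V" and W: "left_module k H W"
        and t: "t \<in> carrier (tensor k (tensor k V W) M)"
      let ?VW = "act_tensor k H H (comul H) V W"
      let ?T = "tensor k (tensor k M (htensor H C V)) (htensor H C W)"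
      note VW = left_module_tensor[OF V W]
      note rVW = htensor_rules[OF VW, simplified] \<beta>_rules[OF VW, simplified]
      note r = rules assoc_rules act_rules[OF M] htensor_rules[OF V] htensor_rules[OF W] rVW
        \<beta>_rules(1-3)[OF V] \<beta>_rules(1-3)[OF W] psi_klin[OF V W] klin_comp[OF psi_klin[OF V W]]
      let ?l = "\<lambda>t. tassoc_inv k M (htensor H C V) (htensor H C W)
        (tmap k M (htensor H C ?VW) M (tensor k (htensor H C V) (htensor H C W)) (\<lambda>x. x)
          (psi (ind_functor k H C) V W) (\<beta> ?VW t))"
      let ?r = "\<lambda>t. tmap k (tensor k V M) (htensor H C W) (tensor k M (htensor H C V)) (htensor H C W)
        (\<beta> V) (\<lambda>x. x) (tassoc_inv k V M (htensor H C W)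
          (tmap k V (tensor k W M) V (tensor k M (htensor H C W)) (\<lambda>x. x) (\<beta> W) (tassoc k V W M t)))"
      show "?l t = ?r t"
      proof (rule tensor_ext[OF _ _ _ _ _ _ t, where P = ?T])
        fix s m assume s: "s \<in> carrier (tensor k V W)" and m: "m \<in> carrier M"
        show "?l (tpure k (tensor k V W) M s m) = ?r (tpure k (tensor k V W) M s m)"
        proof (rule tensor_ext[OF _ _ _ _ _ _ s, where P = ?T])
          fix v w assume "v \<in> carrier V" "w \<in> carrier W"
          then show "?l (tpure k (tensor k V W) M (tpure k V W v w) m) =
              ?r (tpure k (tensor k V W) M (tpure k V W v w) m)"
            using heptagon_left[OF V W _ _ m] heptagon_right[OF V W _ _ m] eq[OF m] by simp
        qed (simp_all add: r m)
      qed (simp_all add: r)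
    qed
  qed
qed

end

text \<open>Applying f to the factor M commutes with inserting v. So at v (x) m the two sides are
  insertions of the two sides of colinearity, and the regular module with v = 1 detects their
  equality.\<close>

lemma center_morphism_iff:
  assumes M: "left_module k A M" and \<rho>: "klin k M (tensor k M C) \<rho>"
    and N: "left_module k A N" and \<sigma>: "klin k N (tensor k N C) \<sigma>"
    and \<beta>: "\<And>V. left_module k H V \<Longrightarrow> klin k (tensor k V M) (tensor k M (htensor H C V)) (\<beta> V)"
    and \<beta>_tpure: "\<And>V v m. left_module k H V \<Longrightarrow> v \<in> carrier V \<Longrightarrow> m \<in> carrier M \<Longrightarrow>
      \<beta> V (tpure k V M v m) = insertion M V v (\<rho> m)"
    and \<gamma>: "\<And>V. left_module k H V \<Longrightarrow> klin k (tensor k V N) (tensor k N (htensor H C V)) (\<gamma> V)"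
    and \<gamma>_tpure: "\<And>V v n. left_module k H V \<Longrightarrow> v \<in> carrier V \<Longrightarrow> n \<in> carrier N \<Longrightarrow>
      \<gamma> V (tpure k V N v n) = insertion N V v (\<sigma> n)"
    and f: "klin k M N f"
  shows "(\<forall>V. left_module k H V \<longrightarrow> (\<forall>t\<in>carrier (tensor k V M).
      \<gamma> V (tmap k V M V N (\<lambda>x. x) f t) =
      tmap k M (htensor H C V) N (htensor H C V) f (\<lambda>x. x) (\<beta> V t))) \<longleftrightarrow>
    (\<forall>m\<in>carrier M. \<sigma> (f m) = tmap k M C N C f (\<lambda>c. c) (\<rho> m))"
proof -
  note MN = rules act_rules[OF M] act_rules[OF N]
    klin_closed[OF \<rho>] klin_comp[OF \<rho>] klin_closed[OF \<sigma>] klin_comp[OF \<sigma>]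
    f klin_closed[OF f] klin_comp[OF f]
  note maps = klin_closed[OF \<beta>] klin_comp[OF \<beta>] \<beta>_tpure klin_closed[OF \<gamma>] klin_comp[OF \<gamma>] \<gamma>_tpure
  have right: "tmap k M (htensor H C V) N (htensor H C V) f (\<lambda>x. x) (insertion M V v (\<rho> m)) =
      insertion N V v (tmap k M C N C f (\<lambda>c. c) (\<rho> m))"
    if V: "left_module k H V" and v: "v \<in> carrier V" and m: "m \<in> carrier M" for V v m
  proof -
    have x: "\<rho> m \<in> carrier (tensor k M C)" using m by (simp add: MN)
    show ?thesis
      by (rule tensor_ext[OF _ _ _ _ _ _ x, where P = "tensor k N (htensor H C V)"])
        (simp_all add: MN htensor_rules[OF V] v)
  qed
  show ?thesis
  proof (intro iffI allI impI ballI)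
    fix m
    assume *: "\<forall>V. left_module k H V \<longrightarrow> (\<forall>t\<in>carrier (tensor k V M).
      \<gamma> V (tmap k V M V N (\<lambda>x. x) f t) =
      tmap k M (htensor H C V) N (htensor H C V) f (\<lambda>x. x) (\<beta> V t))" and m: "m \<in> carrier M"
    have "tpure k reg M \<one>\<^bsub>H\<^esub> m \<in> carrier (tensor k reg M)"
      using m by (simp add: MN)
    from *[rule_format, OF left_module_reg this]
    have "insertion N reg \<one>\<^bsub>H\<^esub> (\<sigma> (f m)) = insertion N reg \<one>\<^bsub>H\<^esub> (tmap k M C N C f (\<lambda>c. c) (\<rho> m))"
      using m right[OF left_module_reg, of "\<one>\<^bsub>H\<^esub>" m]
        \<beta>_tpure[OF left_module_reg, of "\<one>\<^bsub>H\<^esub>" m] \<gamma>_tpure[OF left_module_reg, of "\<one>\<^bsub>H\<^esub>" "f m"]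
      by (simp add: MN)
    moreover have "\<sigma> (f m) \<in> carrier (tensor k N C)"
      "tmap k M C N C f (\<lambda>c. c) (\<rho> m) \<in> carrier (tensor k N C)"
      using m by (simp_all add: MN)
    ultimately show "\<sigma> (f m) = tmap k M C N C f (\<lambda>c. c) (\<rho> m)"
      by (metis theta_insertion left_module_module[OF N])
  next
    fix V :: "'u lmod" and t
    assume *: "\<forall>m\<in>carrier M. \<sigma> (f m) = tmap k M C N C f (\<lambda>c. c) (\<rho> m)"
      and V: "left_module k H V" and t: "t \<in> carrier (tensor k V M)"
    note r = MN htensor_rules[OF V] klin_closed[OF \<beta>[OF V]] klin_comp[OF \<beta>[OF V]] \<beta>_tpure[OF V]
      klin_closed[OF \<gamma>[OF V]] klin_comp[OF \<gamma>[OF V]] \<gamma>_tpure[OF V] right[OF V]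
    show "\<gamma> V (tmap k V M V N (\<lambda>x. x) f t) =
        tmap k M (htensor H C V) N (htensor H C V) f (\<lambda>x. x) (\<beta> V t)"
      by (rule tensor_ext[OF _ _ _ _ _ _ t, where P = "tensor k N (htensor H C V)"])
        (simp_all add: r \<beta>[OF V] *)
  qed
qed

section \<open>The mutually inverse assignments on objects\<close>

definition center_map :: "'u lmod \<Rightarrow> ('u \<Rightarrow> 'u) \<Rightarrow> 'u lmod \<Rightarrow> 'u \<Rightarrow> 'u" where
  "center_map M \<rho> = (\<lambda>V\<in>{V. left_module k H V}.
     tlift k V M (tensor k M (htensor H C V)) (\<lambda>v m. insertion M V v (\<rho> m)))"

text \<open>The restriction to the carrier, like that to H-modules in \<open>center_map\<close>,
  matches the extensionality demanded of objects, so that both round trips are equalities.\<close>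

definition coaction :: "'u lmod \<Rightarrow> ('u lmod \<Rightarrow> 'u \<Rightarrow> 'u) \<Rightarrow> 'u \<Rightarrow> 'u" where
  "coaction M \<beta> = (\<lambda>m\<in>carrier M. \<theta>' M (\<beta> reg (tpure k H M \<one>\<^bsub>H\<^esub> m)))"

abbreviation "center \<equiv>
  lax_center (mod_moncat k H) (mod_moncat k K) (ind_functor k H C) (mod_biact k H K A)"

lemma center_map:
  assumes M: "left_module k A M" and \<rho>: "klin k M (tensor k M C) \<rho>" and V: "left_module k H V"
  shows center_map_klin: "klin k (tensor k V M) (tensor k M (htensor H C V)) (center_map M \<rho> V)"
    and center_map_tpure: "v \<in> carrier V \<Longrightarrow> m \<in> carrier M \<Longrightarrow>
      center_map M \<rho> V (tpure k V M v m) = insertion M V v (\<rho> m)"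
    and center_map_extensional: "center_map M \<rho> V \<in> extensional (carrier (tensor k V M))"
proof -
  note r = rules act_rules[OF M] htensor_rules[OF V] klin_closed[OF \<rho>] klin_comp[OF \<rho>]
  have b: "kbilin k V M (tensor k M (htensor H C V)) (\<lambda>v m. insertion M V v (\<rho> m))"
    by (simp add: r)
  have mods: "Module.module k V" "Module.module k M" "Module.module k (tensor k M (htensor H C V))"
    by (simp_all add: r)
  show "klin k (tensor k V M) (tensor k M (htensor H C V)) (center_map M \<rho> V)"
    and "v \<in> carrier V \<Longrightarrow> m \<in> carrier M \<Longrightarrow>
      center_map M \<rho> V (tpure k V M v m) = insertion M V v (\<rho> m)"
    and "center_map M \<rho> V \<in> extensional (carrier (tensor k V M))"
    using tlift_klin[OF mods b] tlift_tpure[OF mods b] tlift_extensional[OF mods b] V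
    by (simp_all add: center_map_def)
qed

lemma right_comodule_klin: "right_comodule k C M \<rho> \<Longrightarrow> klin k M (tensor k M C) \<rho>"
  by (simp add: right_comodule_def)

lemma Ob_yd: "(M, \<rho>) \<in> Ob (yd_cat k H K A C) \<longleftrightarrow> left_module k A M \<and> \<rho> \<in> extensional (carrier M) \<and>
    right_comodule k C M \<rho> \<and> yd_condition k H K A C M \<rho>"
  by (simp add: yd_cat_def)

lemma Ob_center: "(M, \<beta>) \<in> Ob center \<longleftrightarrow> left_module k A M \<and>
    nat_family (mod_moncat k H) (mod_moncat k K) (ind_functor k H C) (mod_biact k H K A) M \<beta> \<and>
    heptagon (mod_moncat k H) (mod_moncat k K) (ind_functor k H C) (mod_biact k H K A) M \<beta> \<and>
    unit_triangle (mod_moncat k H) (mod_moncat k K) (ind_functor k H C) (mod_biact k H K A) M \<beta>"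
  by (simp add: lax_center_def mod_biact_def mod_cat_def)

text \<open>The axioms transfer through the equivalences above. The round trip returns \<rho>
  because at 1 (x) m the family is the insertion of \<rho> m, which \<open>\<theta>' M\<close>
  undoes.\<close>

lemma center_map_object:
  assumes "(M, \<rho>) \<in> Ob (yd_cat k H K A C)"
  shows "(M, center_map M \<rho>) \<in> Ob center"
    and "coaction M (center_map M \<rho>) = \<rho>"
proof -
  have M: "left_module k A M" and ext: "\<rho> \<in> extensional (carrier M)"
    and com: "right_comodule k C M \<rho>" and yd: "yd_condition k H K A C M \<rho>"
    using assms by (simp_all add: Ob_yd)
  note \<rho> = right_comodule_klin[OF com]
  note maps = center_map_klin[OF M \<rho>] center_map_tpure[OF M \<rho>]
  have "nat_family (mod_moncat k H) (mod_moncat k K) (ind_functor k H C) (mod_biact k H K A) M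
      (center_map M \<rho>)"
    using yd center_map_extensional[OF M \<rho>]
    by (simp add: nat_family_iff_yd[OF M \<rho> maps]) (simp add: center_map_def)
  moreover have "heptagon (mod_moncat k H) (mod_moncat k K) (ind_functor k H C) (mod_biact k H K A) M
      (center_map M \<rho>)"
    using com by (simp add: heptagon_iff[OF M \<rho> maps] right_comodule_def)
  moreover have "unit_triangle (mod_moncat k H) (mod_moncat k K) (ind_functor k H C) (mod_biact k H K A) M
      (center_map M \<rho>)"
    using com by (simp add: unit_triangle_iff[OF M \<rho> maps] right_comodule_def)
  ultimately show "(M, center_map M \<rho>) \<in> Ob center"
    using M by (simp add: Ob_center)
  show "coaction M (center_map M \<rho>) = \<rho>"
  proof (rule extensionalityI[OF _ ext])
    show "coaction M (center_map M \<rho>) m = \<rho> m" if "m \<in> carrier M" for m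
      using that maps(2)[OF left_module_reg, of "\<one>\<^bsub>H\<^esub>" m] klin_closed[OF \<rho> that]
        theta_insertion[OF left_module_module[OF M]]
      by (simp add: coaction_def)
  qed (simp add: coaction_def)
qed

text \<open>\<open>coaction_determines\<close> brings an arbitrary object of the center into the
  form to which the equivalences above apply; read backwards, they give the axioms for its
  coaction.\<close>

lemma center_object:
  assumes "(M, \<beta>) \<in> Ob center"
  shows center_coaction_klin: "klin k M (tensor k M C) (coaction M \<beta>)"
    and center_klin: "left_module k H V \<Longrightarrow> klin k (tensor k V M) (tensor k M (htensor H C V)) (\<beta> V)"
    and center_tpure: "left_module k H V \<Longrightarrow> v \<in> carrier V \<Longrightarrow> m \<in> carrier M \<Longrightarrow>
      \<beta> V (tpure k V M v m) = insertion M V v (coaction M \<beta> m)"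
    and coaction_object: "(M, coaction M \<beta>) \<in> Ob (yd_cat k H K A C)"
    and center_map_coaction: "center_map M (coaction M \<beta>) = \<beta>"
proof -
  have M: "left_module k A M"
    and nat: "nat_family (mod_moncat k H) (mod_moncat k K) (ind_functor k H C) (mod_biact k H K A) M \<beta>"
    and hept: "heptagon (mod_moncat k H) (mod_moncat k K) (ind_functor k H C) (mod_biact k H K A) M \<beta>"
    and unit: "unit_triangle (mod_moncat k H) (mod_moncat k K) (ind_functor k H C) (mod_biact k H K A) M \<beta>"
    using assms by (simp_all add: Ob_center)
  note modM = left_module_module[OF M]
  have \<beta>: "klin k (tensor k V M) (tensor k M (htensor H C V)) (\<beta> V)"
    and \<beta>_ext: "\<beta> V \<in> extensional (carrier (tensor k V M))"
    if "left_module k H V" for V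
    using nat that by (simp_all add: nat_family_iff)
  note \<beta>_reg = \<beta>[OF left_module_reg, simplified]
  note r = rules modM htensor_rules[OF left_module_reg, simplified] theta_rules
    klin_closed[OF \<beta>_reg] klin_comp[OF \<beta>_reg]
  have "klin k M (tensor k M C) (\<lambda>m. \<theta>' M (\<beta> reg (tpure k H M \<one>\<^bsub>H\<^esub> m)))"
    by (simp add: r)
  then show \<rho>: "klin k M (tensor k M C) (coaction M \<beta>)"
    by (subst klin_cong) (simp_all add: coaction_def modM)
  have \<beta>_tpure: "\<beta> V (tpure k V M v m) = insertion M V v (coaction M \<beta> m)"
    if "left_module k H V" "v \<in> carrier V" "m \<in> carrier M" for V v m
    using coaction_determines[OF modM nat that] that by (simp add: coaction_def)
  note maps = \<rho> \<beta> \<beta>_tpure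
  have "yd_condition k H K A C M (coaction M \<beta>)"
    using nat by (simp add: nat_family_iff_yd[OF M maps])
  moreover have "right_comodule k C M (coaction M \<beta>)"
    using hept unit \<rho> modM
    by (simp add: right_comodule_def heptagon_iff[OF M maps] unit_triangle_iff[OF M maps])
  ultimately show "(M, coaction M \<beta>) \<in> Ob (yd_cat k H K A C)"
    using M by (simp add: Ob_yd coaction_def)
  \<comment> \<open>Equality of families as functions: extensionality in V, then on the carrier of V
    (x) M, then pure tensors.\<close>
  show "center_map M (coaction M \<beta>) = \<beta>"
  proof (rule extensionalityI[of _ "{V. left_module k H V}"])
    show "center_map M (coaction M \<beta>) V = \<beta> V" if "V \<in> {V. left_module k H V}" for V
    proof (rule extensionalityI[OF center_map_extensional[OF M \<rho>] \<beta>_ext])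
      have V: "left_module k H V" using that by simp
      fix t assume t: "t \<in> carrier (tensor k V M)"
      show "center_map M (coaction M \<beta>) V t = \<beta> V t"
        by (rule tensor_ext[OF _ _ _ center_map_klin[OF M \<rho> V] \<beta>[OF V] _ t])
          (simp_all add: rules modM htensor_rules[OF V] center_map_tpure[OF M \<rho> V] \<beta>_tpure[OF V])
    qed (use that in auto)
  qed (use nat in \<open>auto simp: center_map_def nat_family_iff\<close>)
  show "left_module k H V \<Longrightarrow> klin k (tensor k V M) (tensor k M (htensor H C V)) (\<beta> V)"
    and "left_module k H V \<Longrightarrow> v \<in> carrier V \<Longrightarrow> m \<in> carrier M \<Longrightarrow>
      \<beta> V (tpure k V M v m) = insertion M V v (coaction M \<beta> m)"
    using \<beta> \<beta>_tpure by auto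
qed

text \<open>The condition on the left ranges over all H-modules, the one on the right involves C
  alone; by \<open>center_morphism_iff\<close> the same functions satisfy both, so the functors can
  be the identity on morphisms.\<close>

lemma Hom_center:
  assumes "(M, \<beta>) \<in> Ob center" "(N, \<gamma>) \<in> Ob center"
  shows "Hom center (M, \<beta>) (N, \<gamma>) =
    Hom (yd_cat k H K A C) (M, coaction M \<beta>) (N, coaction N \<gamma>)"
proof -
  have M: "left_module k A M" and N: "left_module k A N"
    using assms by (simp_all add: Ob_center)
  have restrict_ind: "(\<lambda>x\<in>carrier (ind_mod k H C V). x) = (\<lambda>x\<in>carrier (htensor H C V). x)" for V
    by (simp only: ind_mod_simps)
  have "Hom center (M, \<beta>) (N, \<gamma>) = {f \<in> extensional (carrier M). lmod_map k A M N f \<and>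
      (\<forall>V. left_module k H V \<longrightarrow> (\<forall>t\<in>carrier (tensor k V M).
        \<gamma> V (tmap k V M V N (\<lambda>x. x) f t) =
        tmap k M (htensor H C V) N (htensor H C V) f (\<lambda>x. x) (\<beta> V t)))}"
    by (simp add: lax_center_def mod_biact_def mod_moncat_def mod_cat_def compose_eq_iff restrict_ind
        conj_assoc del: restrict_apply)
  also have "\<dots> = Hom (yd_cat k H K A C) (M, coaction M \<beta>) (N, coaction N \<gamma>)"
    using center_morphism_iff[OF M center_coaction_klin[OF assms(1)] N center_coaction_klin[OF assms(2)]
        center_klin[OF assms(1)] center_tpure[OF assms(1)] center_klin[OF assms(2)] center_tpure[OF assms(2)]]
    by (auto simp: yd_cat_def lmod_map_def)
  finally show ?thesis .
qed

text \<open>The one direct check of category axioms; the lax center inherits them through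
  \<open>isomorphic_categoriesI\<close>. Closure under composition is functoriality of tensoring
  with C.\<close>

lemma category_yd: "category (yd_cat k H K A C)"
proof -
  let ?Y = "yd_cat k H K A C"
  have Hom: "f \<in> Hom ?Y (M, \<rho>) (N, \<sigma>) \<longleftrightarrow> f \<in> extensional (carrier M) \<and> lmod_map k A M N f \<and>
      (\<forall>m\<in>carrier M. \<sigma> (f m) = tmap k M C N C f (\<lambda>c. c) (\<rho> m))" for f M \<rho> N \<sigma>
    by (simp add: yd_cat_def)
  have Comp: "Comp ?Y (M, \<rho>) Y Z g f = compose (carrier M) g f" for M \<rho> Y Z g f
    by (simp add: yd_cat_def split: prod.splits)
  have Id: "Id ?Y (M, \<rho>) = (\<lambda>x\<in>carrier M. x)" for M \<rho>
    by (simp add: yd_cat_def)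
  have closed: "f m \<in> carrier N" if "f \<in> Hom ?Y (M, \<rho>) (N, \<sigma>)" "m \<in> carrier M" for f M \<rho> N \<sigma> m
    using that by (auto simp: Hom lmod_map_def klin_closed)
  have id: "(\<lambda>x\<in>carrier M. x) \<in> Hom ?Y (M, \<rho>) (M, \<rho>)" if "(M, \<rho>) \<in> Ob ?Y" for M \<rho>
  proof -
    have M: "left_module k A M" and \<rho>: "klin k M (tensor k M C) \<rho>"
      using that by (simp_all add: Ob_yd right_comodule_klin)
    note modM = left_module_module[OF M]
    have "klin k M M (\<lambda>x\<in>carrier M. x)"
      by (subst klin_cong[where g = "\<lambda>x. x"]) (simp_all add: klin_ident modM)
    then show ?thesis
      using act_closed[OF M] tmap_ident[OF modM modules(4) klin_closed[OF \<rho>]]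
      by (simp add: Hom lmod_map_def)
  qed
  have comp: "compose (carrier M) g f \<in> Hom ?Y (M, \<rho>) (P, \<tau>)"
    if obs: "(M, \<rho>) \<in> Ob ?Y" "(N, \<sigma>) \<in> Ob ?Y" "(P, \<tau>) \<in> Ob ?Y"
      and f: "f \<in> Hom ?Y (M, \<rho>) (N, \<sigma>)" and g: "g \<in> Hom ?Y (N, \<sigma>) (P, \<tau>)"
    for M \<rho> N \<sigma> P \<tau> f g
  proof -
    have M: "left_module k A M" and N: "left_module k A N" and P: "left_module k A P"
      and \<rho>: "klin k M (tensor k M C) \<rho>"
      using obs by (simp_all add: Ob_yd right_comodule_klin)
    have fk: "klin k M N f" and gk: "klin k N P g"
      using f g by (simp_all add: Hom lmod_map_def)
    have gf: "compose (carrier M) g f x = g (f x)" if "x \<in> carrier M" for x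
      using that by (simp add: compose_eq)
    have "klin k M P (compose (carrier M) g f)"
      by (subst klin_cong[where g = "\<lambda>x. g (f x)"])
        (simp_all add: gf klin_comp[OF gk fk] left_module_module[OF M])
    moreover have "compose (carrier M) g f (act M a m) = act P a (compose (carrier M) g f m)"
      if "a \<in> carrier A" "m \<in> carrier M" for a m
      using that f g by (simp add: gf act_closed[OF M] Hom lmod_map_def klin_closed[OF fk])
    moreover have "\<tau> (compose (carrier M) g f m) =
        tmap k M C P C (compose (carrier M) g f) (\<lambda>c. c) (\<rho> m)" if m: "m \<in> carrier M" for m
    proof -
      have x: "\<rho> m \<in> carrier (tensor k M C)"
        using klin_closed[OF \<rho> m] .
      have "tmap k N C P C g (\<lambda>c. c) (tmap k M C N C f (\<lambda>c. c) (\<rho> m)) =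
          tmap k M C P C (\<lambda>x. g (f x)) (\<lambda>c. c) (\<rho> m)"
        by (rule tensor_ext[OF _ _ _ _ _ _ x, where P = "tensor k P C"])
          (simp_all add: rules act_rules[OF M] act_rules[OF N] act_rules[OF P] fk gk
            klin_comp[OF gk] klin_closed[OF fk] klin_closed[OF gk])
      moreover have "tmap k M C P C (compose (carrier M) g f) (\<lambda>c. c) =
          tmap k M C P C (\<lambda>x. g (f x)) (\<lambda>c. c)"
        by (rule tmap_cong) (simp_all add: gf)
      ultimately show ?thesis
        using f g m klin_closed[OF fk m] by (simp add: gf Hom)
    qed
    ultimately show ?thesis
      by (simp add: Hom lmod_map_def)
  qed
  have ident: "compose (carrier M) f (\<lambda>x\<in>carrier M. x) = f"
      "compose (carrier M) (\<lambda>x\<in>carrier N. x) f = f"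
    if "f \<in> Hom ?Y (M, \<rho>) (N, \<sigma>)" for f M \<rho> N \<sigma>
    using that closed[OF that]
    by (auto simp: Hom compose_def restrict_def extensional_def fun_eq_iff)
  have assoc: "compose (carrier M) h (compose (carrier M) g f) = compose (carrier M) (compose (carrier N) h g) f"
    if "f \<in> Hom ?Y (M, \<rho>) (N, \<sigma>)" for f g h M \<rho> N \<sigma>
    using closed[OF that] by (auto simp: compose_def restrict_def fun_eq_iff)
  show ?thesis
    unfolding category_def
    by (intro conjI ballI; simp only: split_paired_all Comp Id)
      (blast intro: id, blast intro: comp, (rule ident assoc; assumption)+)
qed

lemma center_isomorphic_yd: "isomorphic_categories center (yd_cat k H K A C)"
proof (rule isomorphic_categoriesI[OF category_yd,
    where F = "\<lambda>(M, \<beta>). (M, coaction M \<beta>)" and G = "\<lambda>(M, \<rho>). (M, center_map M \<rho>)"],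
    unfold split_paired_all prod.case)
  fix M \<beta> assume "(M, \<beta>) \<in> Ob center"
  then show "(M, coaction M \<beta>) \<in> Ob (yd_cat k H K A C)"
    and "(M, center_map M (coaction M \<beta>)) = (M, \<beta>)"
    by (simp_all add: coaction_object center_map_coaction)
next
  fix M \<rho> assume "(M, \<rho>) \<in> Ob (yd_cat k H K A C)"
  then show "(M, center_map M \<rho>) \<in> Ob center"
    and "(M, coaction M (center_map M \<rho>)) = (M, \<rho>)"
    by (simp_all add: center_map_object)
qed (simp_all add: Hom_center, simp_all add: lax_center_def yd_cat_def mod_biact_def mod_cat_def)

end

theorem theorem4p3:
  fixes k :: "'u ring" and H K :: "'u coalg" and A :: "'u bicomod_alg" and C :: "'u bimod_coalg"
  assumes "infinite (UNIV :: 'u set)"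
    and "cring k"
    and "yd_datum k H K A C"
  shows "isomorphic_categories
    (lax_center (mod_moncat k H) (mod_moncat k K) (ind_functor k H C) (mod_biact k H K A))
    (yd_cat k H K A C)"
proof -
  interpret yd k H K A C
    by (intro yd.intro tensor_universe.intro yd_axioms.intro assms)
  show ?thesis by (rule center_isomorphic_yd)
qed

end
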